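(* If the number $K$ of budget constraints in $\mathcal{U}^{\mathcal{HP}}_1$ is constant, then the robust two-stage \textsc{Selection} problem with uncertainty set $\mathcal{U}^{\mathcal{HP}}_1$ admits an FPTAS.
   Context: \textsc{Selection}: $\mathcal{X}=\{\mathbf{x}\in\{0,1\}^n:\sum_{i\in[n]}x_i=p\}$; first-stage costs $\mathbf{C}\in\mathbb{R}^n_{\ge0}$; $\mathcal{R}(\mathbf{x})=\{\mathbf{y}\in\{0,1\}^n:\mathbf{x}+\mathbf{y}\in\mathcal{X}\}$, $\mathcal{X}'=\{\mathbf{x}\in\{0,1\}^n:\mathcal{R}(\mathbf{x})\ne\emptyset\}$; the robust two-stage problem is $\min_{\mathbf{x}\in\mathcal{X}'}\max_{\mathbf{c}\in\mathcal{U}}\min_{\mathbf{y}\in\mathcal{R}(\mathbf{x})}(\mathbf{C}^T\mathbf{x}+\mathbf{c}^T\mathbf{y})$. Here $\mathcal{U}=\mathcal{U}^{\mathcal{HP}}_1=\{\underline{\mathbf{c}}+\boldsymbol{\delta}:\sum_{i\in U_j}\delta_i\le\Gamma_j,\ j\in[K],\ \boldsymbol{\delta}\ge\mathbf{0}\}$ with $\underline{\mathbf{c}}\ge\mathbf{0}$, subsets $U_1,\dots,U_K\subseteq[n]$ and $\Gamma_j\ge0$. An FPTAS returns, for every $\epsilon>0$, a solution of value at most $(1+\epsilon)$ times optimal in time polynomial in the input size and $1/\epsilon$. *)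

theory Defs
  imports Complex_Main
    "HOL-Library.Log_Nat"
    "HOL-Library.Extended_Real"
    "HOL-Computational_Algebra.Polynomial"
begin

section \<open>Programs and their running time\<close>

text \<open>
  The model of computation is the random access machine with logarithmic cost, in structured form:
  while-programs over integer memory cells.  A cell is addressed by one of the finitely many names
  occurring in the program together with an integer index, which may be computed at run time.
  Every access is charged the bit lengths of the index and of the content, every arithmetic
  operation the bit lengths of its operands and of its result.  Thus the bit size of the memory
  grows by at most the time spent, and running times agree with those of Turing machines up to
  polynomials.
\<close>

type_synonym name = string
type_synonym state = "name \<Rightarrow> int \<Rightarrow> int"

datatype aexp =
    Const int
  | Elem name aexp
  | Plus aexp aexp
  | Minus aexp aexp
  | Times aexp aexp
  | Div aexp aexp

datatype bexp =
    Less aexp aexp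
  | Neg bexp
  | And bexp bexp

datatype com =
    Skip
  | Store name aexp aexp
  | Seq com com
  | Cond bexp com com
  | While bexp com

abbreviation Var :: "name \<Rightarrow> aexp" where
  "Var x \<equiv> Elem x (Const 0)"

abbreviation Assign :: "name \<Rightarrow> aexp \<Rightarrow> com" where
  "Assign x e \<equiv> Store x (Const 0) e"

text \<open>Binary length of the absolute value, plus one for the sign; in particular it is positive.\<close>

definition isize :: "int \<Rightarrow> nat" where
  "isize z = floorlog 2 (nat \<bar>z\<bar>) + 1"

fun aval :: "aexp \<Rightarrow> state \<Rightarrow> int" where
  "aval (Const z) s = z"
| "aval (Elem a e) s = s a (aval e s)"
| "aval (Plus e f) s = aval e s + aval f s"
| "aval (Minus e f) s = aval e s - aval f s"
| "aval (Times e f) s = aval e s * aval f s"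
| "aval (Div e f) s = aval e s div aval f s"

fun bval :: "bexp \<Rightarrow> state \<Rightarrow> bool" where
  "bval (Less e f) s \<longleftrightarrow> aval e s < aval f s"
| "bval (Neg b) s \<longleftrightarrow> \<not> bval b s"
| "bval (And b b') s \<longleftrightarrow> bval b s \<and> bval b' s"

text \<open>
  The cost of evaluating an expression bounds the bit length of its value, so the operands of an
  operation are paid for by the summands for the subexpressions.
\<close>

fun acost :: "aexp \<Rightarrow> state \<Rightarrow> nat" where
  "acost (Const z) s = isize z"
| "acost (Elem a e) s = acost e s + isize (s a (aval e s))"
| "acost (Plus e f) s = acost e s + acost f s + isize (aval (Plus e f) s)"
| "acost (Minus e f) s = acost e s + acost f s + isize (aval (Minus e f) s)"
| "acost (Times e f) s = acost e s + acost f s + isize (aval (Times e f) s)"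
| "acost (Div e f) s = acost e s + acost f s + isize (aval (Div e f) s)"

fun bcost :: "bexp \<Rightarrow> state \<Rightarrow> nat" where
  "bcost (Less e f) s = acost e s + acost f s"
| "bcost (Neg b) s = bcost b s + 1"
| "bcost (And b b') s = bcost b s + bcost b' s + 1"

text \<open>\<open>exec c s t s'\<close>: started in \<open>s\<close>, the program \<open>c\<close> halts in \<open>s'\<close> after time \<open>t\<close>.\<close>

inductive exec :: "com \<Rightarrow> state \<Rightarrow> nat \<Rightarrow> state \<Rightarrow> bool" where
  Skip: "exec Skip s 1 s"
| Store: "exec (Store a e f) s (acost e s + acost f s)
            (s(a := (s a)(aval e s := aval f s)))"
| Seq: "exec c s t s' \<Longrightarrow> exec d s' u s'' \<Longrightarrow> exec (Seq c d) s (t + u) s''"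
| CondTrue: "bval b s \<Longrightarrow> exec c s t s' \<Longrightarrow> exec (Cond b c d) s (bcost b s + t) s'"
| CondFalse: "\<not> bval b s \<Longrightarrow> exec d s t s' \<Longrightarrow> exec (Cond b c d) s (bcost b s + t) s'"
| WhileFalse: "\<not> bval b s \<Longrightarrow> exec (While b c) s (bcost b s) s"
| WhileTrue: "bval b s \<Longrightarrow> exec c s t s' \<Longrightarrow> exec (While b c) s' u s'' \<Longrightarrow>
                exec (While b c) s (bcost b s + t + u) s''"

inductive_cases SkipE: "exec Skip s t s'"
inductive_cases StoreE: "exec (Store a e f) s t s'"
inductive_cases SeqE: "exec (Seq c d) s t s'"
inductive_cases CondE: "exec (Cond b c d) s t s'"
inductive_cases WhileE: "exec (While b c) s t s'"

lemma exec_deterministic: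
  "exec c s t s' \<Longrightarrow> exec c s u s'' \<Longrightarrow> u = t \<and> s'' = s'"
proof (induction arbitrary: u s'' rule: exec.induct)
  case (Skip s)
  then show ?case by (rule SkipE) simp
next
  case (Store a e f s)
  then show ?case by (rule StoreE) simp
next
  case (Seq c s t s' d v r)
  from Seq.prems obtain t1 s1 u1 where
    1: "exec c s t1 s1" and 2: "exec d s1 u1 s''" and u: "u = t1 + u1"
    by (rule SeqE)
  from Seq.IH(1)[OF 1] have "t1 = t" "s1 = s'" by simp_all
  moreover from this Seq.IH(2) 2 have "u1 = v" "s'' = r" by simp_all
  ultimately show ?case using u by simp
next
  case (CondTrue b s c t s' d)
  from CondTrue.prems obtain t1 where "exec c s t1 s''" "u = bcost b s + t1"
    by (rule CondE) (use CondTrue.hyps(1) in blast)+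
  with CondTrue.IH show ?case by simp
next
  case (CondFalse b s d t s' c)
  from CondFalse.prems obtain t1 where "exec d s t1 s''" "u = bcost b s + t1"
    by (rule CondE) (use CondFalse.hyps(1) in blast)+
  with CondFalse.IH show ?case by simp
next
  case (WhileFalse b s c)
  from WhileFalse.prems show ?case
    by (rule WhileE) (use WhileFalse.hyps in blast)+
next
  case (WhileTrue b s c t s' v r)
  from WhileTrue.prems obtain t1 s1 u1 where
    1: "exec c s t1 s1" and 2: "exec (While b c) s1 u1 s''" and u: "u = bcost b s + t1 + u1"
    by (rule WhileE) (use WhileTrue.hyps(1) in blast)+
  from WhileTrue.IH(1)[OF 1] have "t1 = t" "s1 = s'" by simp_all
  moreover from this WhileTrue.IH(2) 2 have "u1 = v" "s'' = r" by simp_all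
  ultimately show ?case using u by simp
qed

definition init_state :: "int list \<Rightarrow> state" where
  "init_state zs = (\<lambda>a i. if a = ''in'' \<and> 0 \<le> i \<and> i < int (length zs) then zs ! nat i else 0)"

definition output_is :: "state \<Rightarrow> int list \<Rightarrow> bool" where
  "output_is s zs \<longleftrightarrow> (\<forall>i < length zs. s ''out'' (int i) = zs ! i)"

definition input_size :: "int list \<Rightarrow> nat" where
  "input_size zs = (\<Sum>z\<leftarrow>zs. isize z)"


section \<open>Fully polynomial-time approximation schemes\<close>

text \<open>
  A minimization problem is given by its instances \<open>A\<close>, their encoding \<open>enc\<close>, the feasible
  solutions \<open>feas\<close>, the encoding \<open>out\<close> of solutions, and the objective \<open>val\<close>.

  One program serves all instances and all real \<open>\<epsilon> > 0\<close>.  As a real number is not a finite input,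
  the program receives the accuracy as the integer \<open>\<lceil>1 / \<epsilon>\<rceil>\<close>; it can use \<open>1 / \<lceil>1 / \<epsilon>\<rceil> \<le> \<epsilon>\<close>.
  The time bound is the polynomial \<open>q\<close> in two variables, evaluated at \<open>1 / \<epsilon>\<close> and at the size of
  the instance.
\<close>

definition admits_fptas ::
  "'i set \<Rightarrow> ('i \<Rightarrow> int list) \<Rightarrow> ('i \<Rightarrow> 's set) \<Rightarrow> ('i \<Rightarrow> 's \<Rightarrow> int list) \<Rightarrow> ('i \<Rightarrow> 's \<Rightarrow> ereal) \<Rightarrow> bool"
  where
  "admits_fptas A enc feas out val \<longleftrightarrow>
    (\<exists>(prog :: com) (q :: real poly poly). \<forall>I\<in>A. \<forall>\<epsilon>::real. \<epsilon> > 0 \<longrightarrow>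
      (\<exists>t s x.
        exec prog (init_state (\<lceil>1 / \<epsilon>\<rceil> # enc I)) t s \<and>
        real t \<le> poly (poly q [:1 / \<epsilon>:]) (real (input_size (enc I))) \<and>
        x \<in> feas I \<and> output_is s (out I x) \<and>
        val I x \<le> ereal (1 + \<epsilon>) * (INF z\<in>feas I. val I z)))"


section \<open>Robust two-stage selection\<close>

text \<open>
  Vectors of length \<open>n\<close> are functions on \<open>nat\<close>, with the indices \<open>0, \<dots>, n - 1\<close> in place of
  \<open>1, \<dots>, n\<close>.  Binary vectors vanish beyond \<open>n\<close>; the entries of cost vectors beyond \<open>n\<close> are
  never used.
\<close>

definition binary_vectors :: "nat \<Rightarrow> (nat \<Rightarrow> nat) set" where
  "binary_vectors n = {x. (\<forall>i<n. x i \<in> {0, 1}) \<and> (\<forall>i\<ge>n. x i = 0)}"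

definition selection :: "nat \<Rightarrow> nat \<Rightarrow> (nat \<Rightarrow> nat) set" where
  "selection n p = {x \<in> binary_vectors n. (\<Sum>i<n. x i) = p}"

definition recourse :: "nat \<Rightarrow> (nat \<Rightarrow> nat) set \<Rightarrow> (nat \<Rightarrow> nat) \<Rightarrow> (nat \<Rightarrow> nat) set" where
  "recourse n X x = {y \<in> binary_vectors n. (\<lambda>i. x i + y i) \<in> X}"

definition first_stage :: "nat \<Rightarrow> (nat \<Rightarrow> nat) set \<Rightarrow> (nat \<Rightarrow> nat) set" where
  "first_stage n X = {x \<in> binary_vectors n. recourse n X x \<noteq> {}}"

text \<open>
  The supremum is taken in the extended reals because the uncertainty set is unbounded if some
  item lies in none of the budget sets.
\<close>

definition robust_value ::
  "nat \<Rightarrow> (nat \<Rightarrow> nat) set \<Rightarrow> (nat \<Rightarrow> real) \<Rightarrow> (nat \<Rightarrow> real) set \<Rightarrow> (nat \<Rightarrow> nat) \<Rightarrow> ereal" where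
  "robust_value n X C \<U> x =
    (SUP c\<in>\<U>. INF y\<in>recourse n X x.
      ereal ((\<Sum>i<n. C i * real (x i)) + (\<Sum>i<n. c i * real (y i))))"

definition budgeted_set ::
  "nat \<Rightarrow> nat \<Rightarrow> (nat \<Rightarrow> real) \<Rightarrow> (nat \<Rightarrow> nat set) \<Rightarrow> (nat \<Rightarrow> real) \<Rightarrow> (nat \<Rightarrow> real) set" where
  "budgeted_set n K c U \<Gamma> =
    {\<lambda>i. c i + \<delta> i | \<delta>. (\<forall>i<n. \<delta> i \<ge> 0) \<and> (\<forall>j<K. (\<Sum>i\<in>U j. \<delta> i) \<le> \<Gamma> j)}"

text \<open>All numbers are rational, so that an instance is a finite input.\<close>

record sel_instance =
  num_items :: nat
  num_selected :: nat
  num_budgets :: nat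
  first_cost :: "nat \<Rightarrow> rat"
  base_cost :: "nat \<Rightarrow> rat"
  budget_set :: "nat \<Rightarrow> nat set"
  budget :: "nat \<Rightarrow> rat"

definition valid_instance :: "sel_instance \<Rightarrow> bool" where
  "valid_instance I \<longleftrightarrow>
    num_selected I \<le> num_items I \<and>
    (\<forall>i<num_items I. first_cost I i \<ge> 0 \<and> base_cost I i \<ge> 0) \<and>
    (\<forall>j<num_budgets I. budget_set I j \<subseteq> {..<num_items I} \<and> budget I j \<ge> 0)"

definition sel_feasible :: "sel_instance \<Rightarrow> (nat \<Rightarrow> nat) set" where
  "sel_feasible I = first_stage (num_items I) (selection (num_items I) (num_selected I))"

definition sel_value :: "sel_instance \<Rightarrow> (nat \<Rightarrow> nat) \<Rightarrow> ereal" where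
  "sel_value I =
    robust_value (num_items I) (selection (num_items I) (num_selected I))
      (\<lambda>i. of_rat (first_cost I i))
      (budgeted_set (num_items I) (num_budgets I)
        (\<lambda>i. of_rat (base_cost I i)) (budget_set I) (\<lambda>j. of_rat (budget I j)))"

definition enc_rat :: "rat \<Rightarrow> int list" where
  "enc_rat r = [fst (quotient_of r), snd (quotient_of r)]"

text \<open>Numbers in binary, budget sets by their incidence vectors.\<close>

definition enc_instance :: "sel_instance \<Rightarrow> int list" where
  "enc_instance I =
    [int (num_items I), int (num_selected I), int (num_budgets I)] @
    concat (map (\<lambda>i. enc_rat (first_cost I i)) [0..<num_items I]) @
    concat (map (\<lambda>i. enc_rat (base_cost I i)) [0..<num_items I]) @
    concat (map (\<lambda>j. enc_rat (budget I j)) [0..<num_budgets I]) @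
    concat (map (\<lambda>j. map (\<lambda>i. if i \<in> budget_set I j then 1 else 0) [0..<num_items I])
      [0..<num_budgets I])"

definition enc_solution :: "sel_instance \<Rightarrow> (nat \<Rightarrow> nat) \<Rightarrow> int list" where
  "enc_solution I x = map (\<lambda>i. int (x i)) [0..<num_items I]"

end

theory Submission
  imports Defs
begin

text \<open>
  By linear duality, the value of a first-stage solution \<open>x\<close> is the minimum of
  \<open>C x + c y + \<Gamma> \<alpha>\<close> over fractional second-stage selections \<open>y\<close> and dual variables \<open>\<alpha> \<ge> 0\<close> of the
  \<open>K\<close> budget constraints with \<open>y i \<le> (\<Sum>j | i \<in> U j. \<alpha> j)\<close>.  With \<open>N = \<lceil>1 / \<epsilon>\<rceil>\<close> and
  \<open>M = (n + 1) (K + 1) N\<close>, rounding \<open>(1 + 1 / N) y\<close> and \<open>(1 + 1 / N) \<alpha>\<close> down to multiples of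
  \<open>1 / M\<close>, and capping \<open>y\<close> by the rounded \<open>\<alpha>\<close>, still covers the demand.  There are only
  \<open>(M + 1) ^ K\<close> vectors \<open>\<alpha>\<close> on the grid, and for each of them the best \<open>x\<close> and \<open>y\<close> on the grid
  solve a knapsack problem with demand \<open>p M\<close>, in which item \<open>i\<close> covers either \<open>M\<close> units (\<open>x i = 1\<close>)
  or up to \<open>min M (\<Sum>j | i \<in> U j. \<alpha> j)\<close> units.  Dynamic programming solves it; the costs are scaled
  to integers and multiplied by \<open>2 ^ n\<close>, and the incidence vector of \<open>x\<close> is kept in the \<open>n\<close> low
  bits, so that the optimal value reveals \<open>x\<close>.
\<close>

section \<open>Linear duality\<close>

text \<open>Two facts link robust values and dual points. For a fixed cost vector the best recourse
  is a minimum-weight selection, so a fractional \<open>y\<close> can be rounded to a binary one at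
  no extra cost; the binary vector may depend on the scenario, as recourse does. Conversely, a bound
  \<open>v\<close> on the robust value only says that each scenario has its own cheap answer; a
  Farkas argument turns this into one fractional \<open>y\<close> and one \<open>\<alpha>\<close>,
  doing the work of minimax and of linear duality at once. What is discretised is the demand, not
  the cost: all costs stay exact, a row of the table has \<open>p M + 1\<close> entries, and the
  factor \<open>1 + 1 / N\<close> is the only loss. An item outside all budget sets has capacity 0
  for every \<open>\<alpha>\<close>, which matches its unbounded second-stage cost. Such items can
  make the value of some \<open>x\<close> infinite, but buying \<open>p\<close> items in the first
  stage keeps the optimum finite.\<close>

lemma finite_between:
  fixes X Y :: "real set"
  assumes "finite X" "finite Y" "\<And>x y. x \<in> X \<Longrightarrow> y \<in> Y \<Longrightarrow> x \<le> y"
  obtains t where "\<And>x. x \<in> X \<Longrightarrow> x \<le> t" "\<And>y. y \<in> Y \<Longrightarrow> t \<le> y"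
proof (cases "X = {}")
  case True
  show ?thesis
  proof (cases "Y = {}")
    case True
    with \<open>X = {}\<close> show ?thesis using that by blast
  next
    case False
    with \<open>X = {}\<close> assms(2) show ?thesis using that[of "Min Y"] by simp
  qed
next
  case False
  with assms show ?thesis using that[of "Max X"] by (meson Max_ge Max_in)
qed

text \<open>A pair \<open>(a, b)\<close> stands for the inequality that bounds the sum of
  \<open>a k * z k\<close> by \<open>b\<close>; the cone consists of the inequalities implied by
  \<open>S\<close> through nonnegative multipliers. Rows are added one at a time, so that facts
  about such combinations become inductions and no indexed family of multipliers has to be carried
  along.\<close>

inductive_set cone :: "((nat \<Rightarrow> real) \<times> real) set \<Rightarrow> ((nat \<Rightarrow> real) \<times> real) set"
  for S where
  zero: "(\<lambda>k. 0, 0) \<in> cone S"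
| add: "(a, b) \<in> S \<Longrightarrow> (a', b') \<in> cone S \<Longrightarrow> u \<ge> 0 \<Longrightarrow> (\<lambda>k. u * a k + a' k, u * b + b') \<in> cone S"

lemma cone_add_cone:
  assumes "(a, b) \<in> cone S" "(a', b') \<in> cone S" "u \<ge> 0"
  shows "(\<lambda>k. u * a k + a' k, u * b + b') \<in> cone S"
  using assms(1)
proof (induction rule: cone.induct)
  case zero
  then show ?case using assms(2) by simp
next
  case (add a b a'' b'' v)
  from cone.add[OF add(1) add(4), of "u * v"] add(3) assms(3)
  show ?case by (simp add: algebra_simps)
qed

lemma cone_base: "(a, b) \<in> S \<Longrightarrow> (a, b) \<in> cone S"
  using cone.add[of a b S "\<lambda>k. 0" 0 1] cone.zero by simp

lemma cone_induct_pred: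
  assumes "(a, b) \<in> cone S" "Q (\<lambda>k. 0) 0"
    and "\<And>a b a' b' u. (a, b) \<in> S \<Longrightarrow> Q a' b' \<Longrightarrow> u \<ge> 0 \<Longrightarrow> Q (\<lambda>k. u * a k + a' k) (u * b + b')"
  shows "Q a b"
  using assms(1) by (induction rule: cone.induct) (use assms(2,3) in auto)

text \<open>By Fourier--Motzkin elimination of the last variable.\<close>

lemma farkas:
  assumes "finite S" "\<And>z. \<exists>(a, b)\<in>S. (\<Sum>k<d. a k * z k) > b"
  shows "\<exists>a b. (a, b) \<in> cone S \<and> (\<forall>k<d. a k = 0) \<and> b < 0"
  using assms
proof (induction d arbitrary: S)
  case 0
  then obtain a b where "(a, b) \<in> S" "b < 0" by auto
  then show ?case using cone_base by (intro exI[of _ a] exI[of _ b]) auto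
next
  case (Suc d)
  define Z where "Z = {(a, b). (a, b) \<in> S \<and> a d = 0}"
  define P where "P = {(a, b). (a, b) \<in> S \<and> a d > 0}"
  define N where "N = {(a, b). (a, b) \<in> S \<and> a d < 0}"
  \<comment> \<open>For rows from \<open>P\<close> and \<open>N\<close> both multipliers
    \<open>- a' d\<close> and \<open>a d\<close> are positive, and they cancel the coefficient of
    variable \<open>d\<close>.\<close>
  define comb where "comb = (\<lambda>((a, b), (a', b')).
    (\<lambda>k. (- a' d) * a k + a d * a' k, (- a' d) * b + a d * (b'::real)))"
  define S' where "S' = Z \<union> comb ` (P \<times> N)"
  have sub: "Z \<subseteq> S" "P \<subseteq> S" "N \<subseteq> S" unfolding Z_def P_def N_def by auto
  with Suc.prems(1) have fin: "finite Z" "finite P" "finite N" by (auto intro: finite_subset)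
  have "\<exists>(a, b)\<in>S'. (\<Sum>k<d. a k * z k) > b" for z
  proof (rule ccontr)
    assume "\<not> ?thesis"
    then have le: "(\<Sum>k<d. a k * z k) \<le> b" if "(a, b) \<in> S'" for a b using that by force
    \<comment> \<open>With the other variables fixed, a row bounds variable \<open>d\<close> by this
      quotient: from above for rows in \<open>P\<close>, from below for rows in \<open>N\<close>.
      The combined rows say that no lower bound exceeds an upper bound.\<close>
    define sl where "sl = (\<lambda>(a, b). (b - (\<Sum>k<d. a k * z k)) / a d)"
    have lu: "sl q \<le> sl p" if p: "p \<in> P" and q: "q \<in> N" for p q
    proof -
      obtain a b where pe: "p = (a, b)" by fastforce
      obtain a' b' where qe: "q = (a', b')" by fastforce
      have pos: "a d > 0" "a' d < 0" using p q pe qe unfolding P_def N_def by auto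
      have "comb (p, q) \<in> S'" using p q unfolding S'_def by blast
      then have "(\<Sum>k<d. ((- a' d) * a k + a d * a' k) * z k) \<le> (- a' d) * b + a d * b'"
        using le unfolding comb_def pe qe by fastforce
      then have "(- a' d) * (\<Sum>k<d. a k * z k) + a d * (\<Sum>k<d. a' k * z k) \<le> (- a' d) * b + a d * b'"
        by (simp add: distrib_right sum.distrib sum_distrib_left mult.assoc sum_subtractf sum_negf left_diff_distrib)
      then show ?thesis using pos unfolding sl_def pe qe
        by (simp add: field_simps)
    qed
    obtain t where "\<And>q. q \<in> sl ` N \<Longrightarrow> q \<le> t" "\<And>p. p \<in> sl ` P \<Longrightarrow> t \<le> p"
      by (rule finite_between[of "sl ` N" "sl ` P"]) (use fin lu in auto)
    then have t: "\<And>q. q \<in> N \<Longrightarrow> sl q \<le> t" "\<And>p. p \<in> P \<Longrightarrow> t \<le> sl p" by blast+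
    \<comment> \<open>Some row of \<open>S\<close> is violated at \<open>z\<close> extended by
      \<open>t\<close>. It contradicts \<open>le\<close> if \<open>a d = 0\<close>, and the choice
      of \<open>t\<close> otherwise.\<close>
    obtain a b where ab: "(a, b) \<in> S" "(\<Sum>k<Suc d. a k * (z(d := t)) k) > b"
      using Suc.prems(2) by blast
    then have gt: "(\<Sum>k<d. a k * z k) + a d * t > b" by simp
    consider "a d = 0" | "a d > 0" | "a d < 0" by linarith
    then show False
    proof cases
      case 1
      then have "(a, b) \<in> S'" using ab unfolding S'_def Z_def by auto
      with le gt 1 show False by fastforce
    next
      case 2
      then have "t \<le> sl (a, b)" using t(2) ab unfolding P_def by auto
      with 2 gt show False unfolding sl_def by (simp add: field_simps)
    next
      case 3
      then have "sl (a, b) \<le> t" using t(1) ab unfolding N_def by auto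
      with 3 gt show False unfolding sl_def by (simp add: field_simps)
    qed
  qed
  moreover have "finite S'" unfolding S'_def using fin by simp
  ultimately obtain a b where ab: "(a, b) \<in> cone S'" "\<forall>k<d. a k = 0" "b < 0"
    using Suc.IH by blast
  \<comment> \<open>The rows of \<open>S'\<close> lie in the cone of \<open>S\<close>, so a
    certificate for \<open>S'\<close> is one for \<open>S\<close>; the vanishing coefficient of
    variable \<open>d\<close> is inherited by all combinations.\<close>
  have el: "(a, b) \<in> cone S \<and> a d = 0" if ab': "(a, b) \<in> S'" for a b
  proof (cases "(a, b) \<in> Z")
    case True
    then show ?thesis using cone_base unfolding Z_def by auto
  next
    case False
    then obtain a1 b1 a2 b2 where p: "(a1, b1) \<in> P" "(a2, b2) \<in> N" "(a, b) = comb ((a1, b1), (a2, b2))"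
      using ab' unfolding S'_def by auto
    have "(\<lambda>k. a1 d * a2 k + 0, a1 d * b2 + 0) \<in> cone S"
      by (rule cone.add[OF _ cone.zero]) (use p in \<open>auto simp: P_def N_def\<close>)
    then have "(\<lambda>k. (- a2 d) * a1 k + (a1 d * a2 k + 0), (- a2 d) * b1 + (a1 d * b2 + 0)) \<in> cone S"
      using p \<open>(\<lambda>k. a1 d * a2 k + 0, a1 d * b2 + 0) \<in> cone S\<close>
      by (intro cone.add[of a1 b1]) (auto simp: P_def N_def)
    then show ?thesis using p(3) unfolding comb_def by simp
  qed
  have "(a, b) \<in> cone S \<and> a d = 0" using ab(1)
  proof (rule cone_induct_pred[where Q = "\<lambda>a b. (a, b) \<in> cone S \<and> a d = 0"])
    show "((\<lambda>k. 0), 0) \<in> cone S \<and> (0::real) = 0" by (simp add: cone.zero)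
  next
    fix a b a' b' and u :: real
    assume "(a, b) \<in> S'" and 2: "(a', b') \<in> cone S \<and> a' d = 0" and u: "u \<ge> 0"
    from el[OF this(1)] 2 u cone_add_cone[of a b S a' b' u]
    show "(\<lambda>k. u * a k + a' k, u * b + b') \<in> cone S \<and> u * a d + a' d = 0" by simp
  qed
  with ab show ?case by (auto simp: less_Suc_eq)
qed

text \<open>If no such \<open>y\<close> and \<open>\<alpha>\<close> exist, Farkas gives multipliers:
  \<open>l\<close> for the cost row, \<open>\<delta>\<close> for the coupling of \<open>y\<close>
  and \<open>\<alpha>\<close>, \<open>\<mu>\<close> for the upper bounds, \<open>\<theta>\<close>
  for the demand. The columns of \<open>\<alpha>\<close> say that \<open>\<delta>\<close> respects
  the budgets \<open>l * \<Gamma> j\<close>, and those of \<open>y\<close> give weak duality. So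
  \<open>\<delta> / l\<close> is a scenario in which every \<open>y\<close> in \<open>Y\<close>
  costs more than \<open>v\<close>, against the assumption. In the application \<open>Y\<close> is
  the finite set of binary recourse vectors, while the conclusion provides a fractional
  point.\<close>

lemma two_stage_duality:
  fixes c \<Gamma> r :: "nat \<Rightarrow> real" and U :: "nat \<Rightarrow> nat set" and Y :: "(nat \<Rightarrow> real) set"
  assumes U: "\<And>j. j < K \<Longrightarrow> U j \<subseteq> {..<n}"
    and \<Gamma>: "\<And>j. j < K \<Longrightarrow> \<Gamma> j \<ge> 0"
    and c: "\<And>i. i < n \<Longrightarrow> c i \<ge> 0"
    and Y: "\<And>y i. y \<in> Y \<Longrightarrow> i < n \<Longrightarrow> 0 \<le> y i \<and> y i \<le> r i" "\<And>y. y \<in> Y \<Longrightarrow> (\<Sum>i<n. y i) = m"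
    and v: "\<And>\<delta>. \<lbrakk>\<And>i. i < n \<Longrightarrow> \<delta> i \<ge> 0; \<And>j. j < K \<Longrightarrow> (\<Sum>i\<in>U j. \<delta> i) \<le> \<Gamma> j\<rbrakk> \<Longrightarrow>
      \<exists>y\<in>Y. (\<Sum>i<n. (c i + \<delta> i) * y i) \<le> v"
  shows "\<exists>y \<alpha>. (\<forall>i<n. 0 \<le> y i \<and> y i \<le> r i \<and> y i \<le> (\<Sum>j | j < K \<and> i \<in> U j. \<alpha> j)) \<and>
    (\<forall>j<K. \<alpha> j \<ge> 0) \<and> (\<Sum>i<n. y i) = m \<and> (\<Sum>i<n. c i * y i) + (\<Sum>j<K. \<Gamma> j * \<alpha> j) \<le> v"
proof (rule ccontr)
  assume no: "\<not> ?thesis"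
  \<comment> \<open>Variables below \<open>n\<close> are the \<open>y i\<close>, variable
    \<open>n + j\<close> is \<open>\<alpha> j\<close>. The rows are cost, demand in both directions,
    coupling, upper bounds and nonnegativity.\<close>
  define S where "S =
    {(\<lambda>k. if k < n then c k else \<Gamma> (k - n), v), (\<lambda>k. if k < n then 1 else 0, m), (\<lambda>k. if k < n then - 1 else 0, - m)}
    \<union> (\<lambda>i. (\<lambda>k. if k < n then of_bool (k = i) else - of_bool (i \<in> U (k - n)), 0)) ` {..<n}
    \<union> (\<lambda>i. (\<lambda>k. of_bool (k = i), r i)) ` {..<n}
    \<union> (\<lambda>i. (\<lambda>k. - of_bool (k = i), 0)) ` {..<n + K}"
  have split: "(\<Sum>k<n + K. g k) = (\<Sum>k<n. g k) + (\<Sum>j<K. g (n + j))" for g :: "nat \<Rightarrow> real"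
    by (induction K) (auto simp: add.assoc)
  have one: "(\<Sum>k<N. of_bool (k = i) * z k) = z i" if "i < N" for i N and z :: "nat \<Rightarrow> real"
    using that by (subst sum.remove[of _ i]) auto
  have "\<exists>(a, b)\<in>S. (\<Sum>k<n + K. a k * z k) > b" for z
  proof (rule ccontr)
    assume "\<not> ?thesis"
    then have le: "(\<Sum>k<n + K. a k * z k) \<le> b" if "(a, b) \<in> S" for a b using that by force
    have 1: "(\<Sum>k<n. c k * z k) + (\<Sum>j<K. \<Gamma> j * z (n + j)) \<le> v"
      using le[of "\<lambda>k. if k < n then c k else \<Gamma> (k - n)" v] unfolding S_def split by simp
    have 2: "(\<Sum>k<n. z k) = m"
      using le[of "\<lambda>k. if k < n then 1 else 0" m] le[of "\<lambda>k. if k < n then -1 else 0" "-m"]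
      unfolding S_def split by (simp add: sum_negf)
    have 3: "z i \<le> (\<Sum>j | j < K \<and> i \<in> U j. z (n + j))" if "i < n" for i
    proof -
      have "(\<Sum>k<n. of_bool (k = i) * z k) + (\<Sum>j<K. - of_bool (i \<in> U j) * z (n + j)) \<le> 0"
        using le[of "\<lambda>k. if k < n then of_bool (k = i) else - of_bool (i \<in> U (k - n))" 0] that
        unfolding S_def split by simp
      moreover have "(\<Sum>j<K. - of_bool (i \<in> U j) * z (n + j)) = - (\<Sum>j | j < K \<and> i \<in> U j. z (n + j))"
        unfolding sum_negf[symmetric] by (rule sum.mono_neutral_cong_right) auto
      ultimately show ?thesis using one[OF that] by simp
    qed
    have 4: "z i \<le> r i" if "i < n" for i
      using le[of "\<lambda>k. of_bool (k = i)" "r i"] that one[of i "n + K" z] unfolding S_def by simp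
    have 5: "z i \<ge> 0" if "i < n + K" for i
    proof -
      have "(\<lambda>k. - of_bool (k = i), 0) \<in> S" unfolding S_def using that by blast
      from le[OF this] that one[of i "n + K" z] show ?thesis by (simp add: sum_negf)
    qed
    from no have "\<not> ((\<forall>i<n. 0 \<le> z i \<and> z i \<le> r i \<and> z i \<le> (\<Sum>j | j < K \<and> i \<in> U j. z (n + j))) \<and>
    (\<forall>j<K. z (n + j) \<ge> 0) \<and> (\<Sum>i<n. z i) = m \<and> (\<Sum>i<n. c i * z i) + (\<Sum>j<K. \<Gamma> j * z (n + j)) \<le> v)"
      by blast
    with 1 2 3 4 5 show False by simp
  qed
  moreover have "finite S" unfolding S_def by simp
  ultimately obtain a b where ab: "(a, b) \<in> cone S" "\<forall>k<n + K. a k = 0" "b < 0"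
    using farkas by blast
  \<comment> \<open>The multipliers of a cone element, recorded column by column so that they can be
    built by induction. The inequalities for \<open>a\<close> absorb the multipliers of the
    nonnegativity rows, and \<open>\<theta>\<close>, of either sign, is the difference of those of
    the two demand rows.\<close>
  define Q where "Q a b \<longleftrightarrow> (\<exists>l \<delta> \<mu> \<theta>. l \<ge> 0 \<and>
      (\<forall>i<n. \<delta> i \<ge> 0 \<and> \<mu> i \<ge> 0 \<and> a i \<le> l * c i + \<delta> i + \<mu> i - \<theta>) \<and>
      (\<forall>j<K. a (n + j) \<le> l * \<Gamma> j - (\<Sum>i\<in>U j. \<delta> i)) \<and>
      b \<ge> l * v + (\<Sum>i<n. \<mu> i * r i) - \<theta> * m)" for a b
  have QI: "Q a b" if "l \<ge> 0" "\<And>i. i < n \<Longrightarrow> \<delta> i \<ge> 0 \<and> \<mu> i \<ge> 0 \<and> a i \<le> l * c i + \<delta> i + \<mu> i - \<theta>"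
      "\<And>j. j < K \<Longrightarrow> a (n + j) \<le> l * \<Gamma> j - (\<Sum>i\<in>U j. \<delta> i)"
      "b \<ge> l * v + (\<Sum>i<n. \<mu> i * r i) - \<theta> * m" for a b l \<delta> \<mu> \<theta>
    unfolding Q_def using that by blast
  have Q0: "Q (\<lambda>k. 0) 0" by (rule QI[of 0 "\<lambda>_. 0" "\<lambda>_. 0" _ 0]) auto
  have QS: "Q a b" if ab: "(a, b) \<in> S" for a b
  proof -
    from ab consider
        "a = (\<lambda>k. if k < n then c k else \<Gamma> (k - n))" "b = v"
      | "a = (\<lambda>k. if k < n then 1 else 0)" "b = m"
      | "a = (\<lambda>k. if k < n then - 1 else 0)" "b = - m"
      | i where "i < n" "a = (\<lambda>k. if k < n then of_bool (k = i) else - of_bool (i \<in> U (k - n)))" "b = 0"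
      | i where "i < n" "a = (\<lambda>k. of_bool (k = i))" "b = r i"
      | i where "i < n + K" "a = (\<lambda>k. - of_bool (k = i))" "b = 0"
      unfolding S_def by blast
    then show ?thesis
    proof cases
      case 1
      show ?thesis by (rule QI[of 1 "\<lambda>_. 0" "\<lambda>_. 0" _ 0]) (use 1 in auto)
    next
      case 2
      show ?thesis by (rule QI[of 0 "\<lambda>_. 0" "\<lambda>_. 0" _ "-1"]) (use 2 in auto)
    next
      case 3
      show ?thesis by (rule QI[of 0 "\<lambda>_. 0" "\<lambda>_. 0" _ 1]) (use 3 in auto)
    next
      case (4 i)
      have "(\<Sum>k\<in>U j. of_bool (k = i)) = (of_bool (i \<in> U j) :: real)" if "j < K" for j
      proof -
        have "finite (U j)" using U[OF that] by (rule finite_subset) simp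
        then show ?thesis by (simp add: of_bool_def sum.delta)
      qed
      then show ?thesis by (intro QI[of 0 "\<lambda>k. of_bool (k = i)" "\<lambda>_. 0" _ 0]) (use 4 in auto)
    next
      case (5 i)
      show ?thesis by (rule QI[of 0 "\<lambda>_. 0" "\<lambda>k. of_bool (k = i)" _ 0]) (use 5 one[of i n r] in auto)
    next
      case (6 i)
      show ?thesis by (rule QI[of 0 "\<lambda>_. 0" "\<lambda>_. 0" _ 0]) (use 6 in auto)
    qed
  qed
  have "Q a b" using ab(1) Q0
  proof (rule cone_induct_pred)
    fix a b a' b' and u :: real
    assume "(a, b) \<in> S" and Q': "Q a' b'" and u: "u \<ge> 0"
    from QS[OF this(1)] obtain l \<delta> \<mu> \<theta> where
      1: "l \<ge> 0" "\<And>i. i < n \<Longrightarrow> \<delta> i \<ge> 0 \<and> \<mu> i \<ge> 0 \<and> a i \<le> l * c i + \<delta> i + \<mu> i - \<theta>"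
      "\<And>j. j < K \<Longrightarrow> a (n + j) \<le> l * \<Gamma> j - (\<Sum>i\<in>U j. \<delta> i)"
      "b \<ge> l * v + (\<Sum>i<n. \<mu> i * r i) - \<theta> * m"
      unfolding Q_def by blast
    from Q' obtain l' \<delta>' \<mu>' \<theta>' where
      2: "l' \<ge> 0" "\<And>i. i < n \<Longrightarrow> \<delta>' i \<ge> 0 \<and> \<mu>' i \<ge> 0 \<and> a' i \<le> l' * c i + \<delta>' i + \<mu>' i - \<theta>'"
      "\<And>j. j < K \<Longrightarrow> a' (n + j) \<le> l' * \<Gamma> j - (\<Sum>i\<in>U j. \<delta>' i)"
      "b' \<ge> l' * v + (\<Sum>i<n. \<mu>' i * r i) - \<theta>' * m"
      unfolding Q_def by blast
    show "Q (\<lambda>k. u * a k + a' k) (u * b + b')"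
    proof (rule QI[of "u * l + l'" "\<lambda>i. u * \<delta> i + \<delta>' i" "\<lambda>i. u * \<mu> i + \<mu>' i" _ "u * \<theta> + \<theta>'"])
      fix i assume i: "i < n"
      have "u * a i \<le> u * (l * c i + \<delta> i + \<mu> i - \<theta>)" using 1(2)[OF i] u by (intro mult_left_mono) auto
      then show "0 \<le> u * \<delta> i + \<delta>' i \<and> 0 \<le> u * \<mu> i + \<mu>' i \<and> u * a i + a' i \<le>
          (u * l + l') * c i + (u * \<delta> i + \<delta>' i) + (u * \<mu> i + \<mu>' i) - (u * \<theta> + \<theta>')"
        using 1(2)[OF i] 2(2)[OF i] u by (simp add: algebra_simps)
    next
      fix j assume j: "j < K"
      have "u * a (n + j) \<le> u * (l * \<Gamma> j - (\<Sum>i\<in>U j. \<delta> i))" using 1(3)[OF j] u by (intro mult_left_mono) auto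
      then show "u * a (n + j) + a' (n + j) \<le> (u * l + l') * \<Gamma> j - (\<Sum>i\<in>U j. u * \<delta> i + \<delta>' i)"
        using 2(3)[OF j] by (simp add: algebra_simps sum.distrib sum_distrib_left)
    next
      have "u * b \<ge> u * (l * v + (\<Sum>i<n. \<mu> i * r i) - \<theta> * m)" using 1(4) u by (intro mult_left_mono) auto
      then show "(u * l + l') * v + (\<Sum>i<n. (u * \<mu> i + \<mu>' i) * r i) - (u * \<theta> + \<theta>') * m \<le> u * b + b'"
        using 2(4) by (simp add: algebra_simps sum.distrib sum_distrib_left)
    qed (use 1 2 u in auto)
  qed
  then obtain l \<delta> \<mu> \<theta> where l: "l \<ge> 0"
    and \<delta>: "\<And>i. i < n \<Longrightarrow> \<delta> i \<ge> 0"
    and \<mu>: "\<And>i. i < n \<Longrightarrow> \<mu> i \<ge> 0"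
    and ge: "\<And>i. i < n \<Longrightarrow> 0 \<le> l * c i + \<delta> i + \<mu> i - \<theta>"
    and G: "\<And>j. j < K \<Longrightarrow> (\<Sum>i\<in>U j. \<delta> i) \<le> l * \<Gamma> j"
    and gap: "l * v + (\<Sum>i<n. \<mu> i * r i) - \<theta> * m < 0"
  proof -
    from \<open>Q a b\<close> obtain l \<delta> \<mu> \<theta> where q: "l \<ge> 0"
      "\<And>i. i < n \<Longrightarrow> \<delta> i \<ge> 0 \<and> \<mu> i \<ge> 0 \<and> a i \<le> l * c i + \<delta> i + \<mu> i - \<theta>"
      "\<And>j. j < K \<Longrightarrow> a (n + j) \<le> l * \<Gamma> j - (\<Sum>i\<in>U j. \<delta> i)"
      "b \<ge> l * v + (\<Sum>i<n. \<mu> i * r i) - \<theta> * m"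
      unfolding Q_def by blast
    show thesis
    proof (rule that[of l \<delta> \<mu> \<theta>])
      show "0 \<le> l * c i + \<delta> i + \<mu> i - \<theta>" if "i < n" for i using q(2)[OF that] ab(2) that by simp
      show "(\<Sum>i\<in>U j. \<delta> i) \<le> l * \<Gamma> j" if "j < K" for j using q(3)[OF that] ab(2) that by simp
    qed (use q ab(3) in auto)
  qed
  \<comment> \<open>Weak duality, multiplied by \<open>l\<close> so that it also covers
    \<open>l = 0\<close>.\<close>
  have low: "(\<Sum>i<n. (l * c i + \<delta> i) * y i) > l * v" if y: "y \<in> Y" for y
  proof -
    have "(l * c i + \<delta> i) * y i \<ge> \<theta> * y i - \<mu> i * r i" if i: "i < n" for i
    proof -
      have "(l * c i + \<delta> i) * y i \<ge> (\<theta> - \<mu> i) * y i"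
        using ge[OF i] Y(1)[OF y i] by (intro mult_right_mono) auto
      moreover have "\<mu> i * y i \<le> \<mu> i * r i"
        using \<mu>[OF i] Y(1)[OF y i] by (intro mult_left_mono) auto
      ultimately show ?thesis by (simp add: algebra_simps)
    qed
    then have "(\<Sum>i<n. \<theta> * y i - \<mu> i * r i) \<le> (\<Sum>i<n. (l * c i + \<delta> i) * y i)"
      by (intro sum_mono) auto
    then have "\<theta> * (\<Sum>i<n. y i) - (\<Sum>i<n. \<mu> i * r i) \<le> (\<Sum>i<n. (l * c i + \<delta> i) * y i)"
      by (simp add: sum_subtractf sum_distrib_left)
    with gap Y(2)[OF y] show ?thesis by simp
  qed
  show False
  proof (cases "l = 0")
    case False
    then have "l > 0" using l by simp
    have "\<exists>y\<in>Y. (\<Sum>i<n. (c i + \<delta> i / l) * y i) \<le> v"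
      by (rule v) (use \<open>l > 0\<close> \<delta> G in \<open>auto simp: sum_divide_distrib[symmetric] field_simps\<close>)
    then obtain y where y: "y \<in> Y" "(\<Sum>i<n. (c i + \<delta> i / l) * y i) \<le> v" by blast
    from y(2) have "l * (\<Sum>i<n. (c i + \<delta> i / l) * y i) \<le> l * v" using l by (rule mult_left_mono)
    moreover have "l * (\<Sum>i<n. (c i + \<delta> i / l) * y i) = (\<Sum>i<n. (l * c i + \<delta> i) * y i)"
      unfolding sum_distrib_left by (rule sum.cong) (use \<open>l > 0\<close> in \<open>auto simp: field_simps\<close>)
    ultimately show False using low[OF y(1)] by simp
  next
    case True
    define g where "g = \<theta> * m - (\<Sum>i<n. \<mu> i * r i)"
    \<comment> \<open>For \<open>l = 0\<close> the vector \<open>\<delta>\<close> has sum at most 0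
      on every budget set, so all its nonnegative multiples are admissible. Along it the cost of
      every \<open>y\<close> in \<open>Y\<close> grows at rate at least \<open>g > 0\<close>, and
      \<open>t * g = \<bar>v\<bar> + 1\<close> exceeds \<open>v\<close>.\<close>
    define t where "t = (\<bar>v\<bar> + 1) / g"
    have g: "g > 0" using gap True unfolding g_def by simp
    have t: "t > 0" unfolding t_def using g by (simp add: add_nonneg_pos)
    have "\<exists>y\<in>Y. (\<Sum>i<n. (c i + t * \<delta> i) * y i) \<le> v"
    proof (rule v)
      fix j assume j: "j < K"
      have "t * (\<Sum>i\<in>U j. \<delta> i) \<le> 0" using G[OF j] True t by (simp add: mult_le_0_iff)
      then show "(\<Sum>i\<in>U j. t * \<delta> i) \<le> \<Gamma> j" using \<Gamma>[OF j] by (simp add: sum_distrib_left)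
    qed (use t \<delta> in simp)
    then obtain y where y: "y \<in> Y" "(\<Sum>i<n. (c i + t * \<delta> i) * y i) \<le> v" by blast
    have "(\<Sum>i<n. (c i + t * \<delta> i) * y i) = (\<Sum>i<n. c i * y i) + t * (\<Sum>i<n. \<delta> i * y i)"
      by (simp add: sum.distrib sum_distrib_left algebra_simps)
    moreover have "(\<Sum>i<n. c i * y i) \<ge> 0" using c Y(1)[OF y(1)] by (intro sum_nonneg) auto
    ultimately have 1: "t * (\<Sum>i<n. \<delta> i * y i) \<le> v" using y(2) by simp
    have "(\<theta> * y i - \<mu> i * r i) \<le> \<delta> i * y i" if i: "i < n" for i
    proof -
      have "\<delta> i * y i \<ge> (\<theta> - \<mu> i) * y i"
        using ge[OF i] Y(1)[OF y(1) i] True by (intro mult_right_mono) auto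
      moreover have "\<mu> i * y i \<le> \<mu> i * r i"
        using \<mu>[OF i] Y(1)[OF y(1) i] by (intro mult_left_mono) auto
      ultimately show ?thesis by (simp add: algebra_simps)
    qed
    then have "(\<Sum>i<n. \<theta> * y i - \<mu> i * r i) \<le> (\<Sum>i<n. \<delta> i * y i)"
      by (intro sum_mono) auto
    then have "g \<le> (\<Sum>i<n. \<delta> i * y i)"
      unfolding g_def using Y(2)[OF y(1)] by (simp add: sum_subtractf sum_distrib_left[symmetric])
    with t have "t * g \<le> t * (\<Sum>i<n. \<delta> i * y i)" by simp
    with 1 have "t * g \<le> v" by simp
    then show False unfolding t_def using g by simp
  qed
qed

text \<open>Integrality of the selection polytope by exchange. In a cheapest \<open>m\<close>-subset
  \<open>T\<close> no element is dearer than one outside, so a threshold \<open>t\<close> separates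
  the weights. The mass \<open>1 - y i\<close> missing inside \<open>T\<close> equals the mass
  \<open>y i\<close> outside; moving it inside costs at most \<open>t\<close> per unit and saves at
  least \<open>t\<close> per unit.\<close>

lemma selection_rounding:
  fixes w y :: "nat \<Rightarrow> real"
  assumes A: "finite A" and y: "\<And>i. i \<in> A \<Longrightarrow> 0 \<le> y i \<and> y i \<le> 1" and m: "(\<Sum>i\<in>A. y i) = real m"
  obtains T where "T \<subseteq> A" "card T = m" "(\<Sum>i\<in>T. w i) \<le> (\<Sum>i\<in>A. w i * y i)"
proof -
  have "real m \<le> real (card A)"
    using sum_bounded_above[of A y 1] y m by simp
  then obtain T0 where T0: "T0 \<subseteq> A" "card T0 = m" by (meson obtain_subset_with_card_n of_nat_le_iff)
  let ?F = "{T. T \<subseteq> A \<and> card T = m}"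
  have fin: "finite ?F" using A by simp
  obtain T where T: "T \<subseteq> A" "card T = m" and min: "\<And>T'. T' \<subseteq> A \<Longrightarrow> card T' = m \<Longrightarrow> sum w T \<le> sum w T'"
  proof -
    have ne: "?F \<noteq> {}" using T0 by blast
    define T where "T = arg_min_on (sum w) ?F"
    have "T \<in> ?F" unfolding T_def using fin ne by (rule arg_min_if_finite(1))
    moreover have "sum w T \<le> sum w T'" if "T' \<subseteq> A" "card T' = m" for T'
      unfolding T_def by (rule arg_min_least[OF fin ne]) (use that in simp)
    ultimately show thesis using that by blast
  qed
  have finT: "finite T" using T(1) A by (rule finite_subset)
  have le: "w i \<le> w k" if i: "i \<in> T" and k: "k \<in> A - T" for i k
  proof -
    let ?T = "insert k (T - {i})"
    have "card ?T = Suc (card (T - {i}))" using finT k by simp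
    then have "card ?T = m" using finT i T(2) by (simp only: card_Suc_Diff1)
    then have "sum w T \<le> sum w ?T" using min[of ?T] T(1) k by blast
    also have "sum w ?T = w k + (sum w T - w i)" using finT i k by (simp add: sum_diff1)
    finally show ?thesis by simp
  qed
  obtain t where t: "\<And>x. x \<in> w ` T \<Longrightarrow> x \<le> t" "\<And>x. x \<in> w ` (A - T) \<Longrightarrow> t \<le> x"
    by (rule finite_between[of "w ` T" "w ` (A - T)"]) (use finT A le in auto)
  have split: "(\<Sum>i\<in>A. g i) = (\<Sum>i\<in>T. g i) + (\<Sum>i\<in>A - T. g i)" for g :: "nat \<Rightarrow> real"
    using sum.subset_diff[OF T(1) A, of g] by simp
  have "(\<Sum>i\<in>T. w i * (1 - y i)) \<le> (\<Sum>i\<in>T. t * (1 - y i))"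
    using t(1) y T(1) by (intro sum_mono mult_right_mono) auto
  moreover have "(\<Sum>i\<in>A - T. t * y i) \<le> (\<Sum>i\<in>A - T. w i * y i)"
    using t(2) y by (intro sum_mono mult_right_mono) auto
  moreover have "(\<Sum>i\<in>T. t * (1 - y i)) = (\<Sum>i\<in>A - T. t * y i)"
    using m T(2) unfolding split by (simp add: sum_distrib_left[symmetric] sum_subtractf)
  ultimately have "(\<Sum>i\<in>T. w i) \<le> (\<Sum>i\<in>A. w i * y i)"
    unfolding split by (simp add: algebra_simps sum_subtractf)
  with T show ?thesis using that by blast
qed

section \<open>Rounding to a grid\<close>

lemma decrease_sum:
  fixes y :: "nat \<Rightarrow> nat"
  assumes "s \<le> (\<Sum>i<n. y i)"
  shows "\<exists>y'. (\<forall>i. y' i \<le> y i) \<and> (\<Sum>i<n. y' i) = s"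
  using assms
proof (induction n arbitrary: s)
  case 0
  then show ?case by auto
next
  case (Suc n)
  have "s - y n \<le> (\<Sum>i<n. y i)" using Suc.prems by simp
  then obtain y' where y': "\<forall>i. y' i \<le> y i" "(\<Sum>i<n. y' i) = s - y n" using Suc.IH by blast
  let ?y = "y'(n := min (y n) s)"
  have "(\<Sum>i<Suc n. ?y i) = s" using y'(2) by simp
  moreover have "\<forall>i. ?y i \<le> y i" using y'(1) by simp
  ultimately show ?case by blast
qed

text \<open>
  After scaling by \<open>1 + 1 / N\<close> and rounding down to multiples of \<open>1 / M\<close>, an entry loses at most
  \<open>(K + 1) / M\<close> or reaches \<open>1\<close>.  If \<open>q\<close> units remain for the entries that do not reach \<open>1\<close>, then
  either \<open>q \<le> 0\<close> or \<open>q \<ge> 1\<close>, since \<open>m\<close> is an integer; in the latter case the scaling gains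
  \<open>q / N\<close>, which outweighs the loss.
\<close>

lemma grid_rounding:
  fixes y \<alpha> :: "nat \<Rightarrow> real" and U :: "nat \<Rightarrow> nat set" and n K N m :: nat
  assumes N: "N \<ge> 1" and M: "M = (n + 1) * (K + 1) * N"
    and y: "\<And>i. i < n \<Longrightarrow> 0 \<le> y i \<and> y i \<le> 1 \<and> y i \<le> (\<Sum>j | j < K \<and> i \<in> U j. \<alpha> j)"
    and \<alpha>: "\<And>j. j < K \<Longrightarrow> \<alpha> j \<ge> 0" and m: "(\<Sum>i<n. y i) = real m"
  obtains y' \<alpha>' :: "nat \<Rightarrow> nat" where
    "\<And>i. i < n \<Longrightarrow> y' i \<le> M \<and> y' i \<le> (\<Sum>j | j < K \<and> i \<in> U j. \<alpha>' j)"
    "\<And>j. j < K \<Longrightarrow> \<alpha>' j \<le> M" "(\<Sum>i<n. y' i) = m * M"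
    "\<And>i. i < n \<Longrightarrow> real (y' i) \<le> (1 + 1 / N) * M * y i"
    "\<And>j. j < K \<Longrightarrow> real (\<alpha>' j) \<le> (1 + 1 / N) * M * \<alpha> j"
proof -
  \<comment> \<open>Since \<open>M / N = (n + 1) * (K + 1)\<close>, scaling gains this many grid
    units per unit of demand, while at most \<open>n\<close> entries lose at most
    \<open>K + 1\<close> units each.\<close>
  define \<rho> where "\<rho> = (1 + 1 / real N) * real M"
  have \<rho>: "\<rho> = M + (n + 1) * (K + 1)"
    using N unfolding \<rho>_def M by (simp add: field_simps)
  have \<rho>0: "\<rho> \<ge> 0" unfolding \<rho> by simp
  \<comment> \<open>Capping at \<open>M\<close> is harmless, as no \<open>y' i\<close> exceeds
    \<open>M\<close>, and it confines \<open>\<alpha>'\<close> to the finite grid.\<close>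
  define \<alpha>' where "\<alpha>' j = min M (nat \<lfloor>\<rho> * \<alpha> j\<rfloor>)" for j
  define a where "a i = (\<Sum>j | j < K \<and> i \<in> U j. \<alpha>' j)" for i
  define y0 where "y0 i = min (nat \<lfloor>\<rho> * y i\<rfloor>) (min M (a i))" for i
  have fl: "real (nat \<lfloor>x\<rfloor>) \<le> x" "real (nat \<lfloor>x\<rfloor>) \<ge> x - 1" if "x \<ge> 0" for x :: real
    using that by linarith+
  have \<alpha>'1: "real (\<alpha>' j) \<le> \<rho> * \<alpha> j" if "j < K" for j
  proof -
    have "\<rho> * \<alpha> j \<ge> 0" using \<rho>0 \<alpha>[OF that] by simp
    from fl(1)[OF this] show ?thesis unfolding \<alpha>'_def by (simp add: min_def)
  qed
  have y01: "real (y0 i) \<le> \<rho> * y i" if "i < n" for i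
  proof -
    have "\<rho> * y i \<ge> 0" using \<rho>0 y[OF that] by simp
    from fl(1)[OF this] show ?thesis unfolding y0_def by (simp add: min_def)
  qed
  have big: "real (y0 i) \<ge> \<rho> * y i - (K + 1)" if i: "i < n" and no: "y0 i \<noteq> M" for i
  proof -
    have "\<rho> * y i \<ge> 0" using \<rho>0 y[OF i] by simp
    note f = fl(2)[OF this]
    consider "y0 i = nat \<lfloor>\<rho> * y i\<rfloor>" | "y0 i = a i" "a i < M"
      using no unfolding y0_def min_def by (auto split: if_splits)
    then show ?thesis
    proof cases
      case 1
      with f show ?thesis by simp
    next
      case 2
      have "real (\<alpha>' j) \<ge> \<rho> * \<alpha> j - 1" if j: "j < K" "i \<in> U j" for j
      proof -
        \<comment> \<open>Here \<open>a i < M\<close>, so no summand reached the cap, and each lost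
          at most one unit to the floor.\<close>
        have "\<alpha>' j \<le> a i" unfolding a_def using j by (intro member_le_sum) auto
        then have "\<alpha>' j = nat \<lfloor>\<rho> * \<alpha> j\<rfloor>" using 2 unfolding \<alpha>'_def by (simp add: min_def split: if_splits)
        moreover have "\<rho> * \<alpha> j \<ge> 0" using \<rho>0 \<alpha>[OF j(1)] by simp
        ultimately show ?thesis using fl(2) by simp
      qed
      then have "(\<Sum>j | j < K \<and> i \<in> U j. \<rho> * \<alpha> j - 1) \<le> real (a i)"
        unfolding a_def of_nat_sum by (intro sum_mono) auto
      moreover have "(\<Sum>j | j < K \<and> i \<in> U j. \<rho> * \<alpha> j - 1) =
          \<rho> * (\<Sum>j | j < K \<and> i \<in> U j. \<alpha> j) - card {j. j < K \<and> i \<in> U j}"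
        by (simp add: sum_subtractf sum_distrib_left)
      moreover have "card {j. j < K \<and> i \<in> U j} \<le> K"
        using card_mono[of "{..<K}" "{j. j < K \<and> i \<in> U j}"] by auto
      moreover have "\<rho> * y i \<le> \<rho> * (\<Sum>j | j < K \<and> i \<in> U j. \<alpha> j)"
        using y[OF i] \<rho>0 by (intro mult_left_mono) auto
      ultimately show ?thesis using 2 by simp
    qed
  qed
  have tot: "m * M \<le> (\<Sum>i<n. y0 i)"
  proof -
    define F where "F = {i. i < n \<and> y0 i = M}"
    define R where "R = {i. i < n \<and> y0 i \<noteq> M}"
    have fin: "finite F" "finite R" unfolding F_def R_def by auto
    have FR: "{..<n} = F \<union> R" "F \<inter> R = {}" unfolding F_def R_def by auto
    have split: "(\<Sum>i<n. g i) = (\<Sum>i\<in>F. g i) + (\<Sum>i\<in>R. g i)" for g :: "nat \<Rightarrow> real"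
      unfolding FR(1) by (rule sum.union_disjoint) (use fin FR in auto)
    have sF: "(\<Sum>i\<in>F. real (y0 i)) = card F * M" unfolding F_def by simp
    show ?thesis
    proof (cases "m \<le> card F")
      case True
      then have "real (m * M) \<le> card F * M" by (simp add: mult_right_mono)
      also have "\<dots> \<le> (\<Sum>i<n. real (y0 i))" unfolding split sF by (simp add: sum_nonneg)
      finally show ?thesis by (simp only: of_nat_sum[symmetric] of_nat_le_iff)
    next
      case False
      define q where "q = m - card F"
      have q: "q \<ge> 1" "m = card F + q" using False unfolding q_def by auto
      have "(\<Sum>i\<in>F. y i) \<le> card F" using sum_bounded_above[of F y 1] y unfolding F_def by simp
      with m q(2) have yR: "(\<Sum>i\<in>R. y i) \<ge> q" unfolding split by simp
      have cR: "card R \<le> n" using card_mono[of "{..<n}" R] unfolding R_def by auto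
      have "(\<Sum>i\<in>R. \<rho> * y i - (K + 1)) \<le> (\<Sum>i\<in>R. real (y0 i))"
        using big unfolding R_def by (intro sum_mono) auto
      moreover have "(\<Sum>i\<in>R. \<rho> * y i - (K + 1)) = \<rho> * (\<Sum>i\<in>R. y i) - card R * (K + 1)"
        by (simp add: sum_subtractf sum_distrib_left[symmetric] algebra_simps)
      ultimately have "(\<Sum>i\<in>R. real (y0 i)) \<ge> \<rho> * (\<Sum>i\<in>R. y i) - card R * (K + 1)"
        by simp
      moreover have "\<rho> * (\<Sum>i\<in>R. y i) \<ge> \<rho> * q" using yR \<rho>0 by (rule mult_left_mono)
      moreover have "card R * (K + 1) \<le> n * (K + 1)" using cR by (rule mult_right_mono) simp
      then have "real (card R * (K + 1)) \<le> real (n * (K + 1))" by (simp only: of_nat_le_iff)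
      moreover have "\<rho> * q \<ge> M * q + real (n * (K + 1))"
      proof -
        have "(n + 1) * (K + 1) * 1 \<le> (n + 1) * (K + 1) * q" using q(1) by (intro mult_left_mono) auto
        then have "n * (K + 1) \<le> (n + 1) * (K + 1) * q" by simp
        then have "real (n * (K + 1)) \<le> real ((n + 1) * (K + 1) * q)" by (simp only: of_nat_le_iff)
        then show ?thesis unfolding \<rho> by (simp add: algebra_simps)
      qed
      ultimately have "real (m * M) \<le> (\<Sum>i<n. real (y0 i))"
        unfolding split sF q(2) by (simp add: algebra_simps)
      then show ?thesis by (simp only: of_nat_sum[symmetric] of_nat_le_iff)
    qed
  qed
  \<comment> \<open>The total may overshoot the demand; lowering entries preserves all their upper
    bounds.\<close>
  then obtain y' where y': "\<forall>i. y' i \<le> y0 i" "(\<Sum>i<n. y' i) = m * M" using decrease_sum by blast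
  show ?thesis
  proof (rule that[of y' \<alpha>'])
    fix i assume i: "i < n"
    have "y0 i \<le> M" "y0 i \<le> a i" unfolding y0_def by auto
    then show "y' i \<le> M \<and> y' i \<le> (\<Sum>j | j < K \<and> i \<in> U j. \<alpha>' j)"
      using y'(1) unfolding a_def by (meson le_trans)
    have "real (y' i) \<le> real (y0 i)" using y'(1) by simp
    with y01[OF i] show "real (y' i) \<le> (1 + 1 / N) * M * y i" unfolding \<rho>_def by linarith
  next
    fix j assume j: "j < K"
    show "\<alpha>' j \<le> M" unfolding \<alpha>'_def by simp
    show "real (\<alpha>' j) \<le> (1 + 1 / N) * M * \<alpha> j" using \<alpha>'1[OF j] unfolding \<rho>_def .
  qed (rule y'(2))
qed

section \<open>Grid points and the robust value\<close>

lemma finite_binary_vectors: "finite (binary_vectors n)"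
proof -
  have "x = (\<lambda>i. of_bool (i \<in> {i. i < n \<and> x i = 1}))" if "x \<in> binary_vectors n" for x
  proof
    show "x i = of_bool (i \<in> {i. i < n \<and> x i = 1})" for i
      using that unfolding binary_vectors_def by (cases "i < n") auto
  qed
  then have "binary_vectors n \<subseteq> (\<lambda>A i. of_bool (i \<in> A)) ` Pow {..<n}" by blast
  then show ?thesis by (rule finite_subset) simp
qed

lemma recourse_selection_iff:
  assumes x: "x \<in> binary_vectors n"
  shows "y \<in> recourse n (selection n p) x \<longleftrightarrow>
    y \<in> binary_vectors n \<and> (\<forall>i<n. x i = 1 \<longrightarrow> y i = 0) \<and> (\<Sum>i<n. x i) + (\<Sum>i<n. y i) = p"
proof -
  have "(\<lambda>i. x i + y i) \<in> binary_vectors n \<longleftrightarrow> (\<forall>i<n. x i = 1 \<longrightarrow> y i = 0)" if y: "y \<in> binary_vectors n"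
  proof -
    have "x i + y i \<in> {0, 1} \<longleftrightarrow> (x i = 1 \<longrightarrow> y i = 0)" if "i < n" for i
    proof -
      have "x i = 0 \<or> x i = 1" "y i = 0 \<or> y i = 1"
        using x y that unfolding binary_vectors_def by auto
      then show ?thesis by auto
    qed
    moreover have "x i + y i = 0" if "i \<ge> n" for i using x y that unfolding binary_vectors_def by auto
    ultimately show ?thesis unfolding binary_vectors_def by blast
  qed
  then show ?thesis unfolding recourse_def selection_def by (auto simp: sum.distrib)
qed

text \<open>\<open>y\<close> and \<open>\<alpha>\<close> are measured in units of
  \<open>1 / M\<close>; \<open>x\<close> stays binary, whence the factor \<open>M\<close> in the
  demand equation.\<close>

definition grid_solution ::
  "sel_instance \<Rightarrow> nat \<Rightarrow> (nat \<Rightarrow> nat) \<Rightarrow> (nat \<Rightarrow> nat) \<Rightarrow> (nat \<Rightarrow> nat) \<Rightarrow> bool" where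
  "grid_solution I M x y \<alpha> \<longleftrightarrow> x \<in> binary_vectors (num_items I) \<and>
    (\<forall>i<num_items I. y i \<le> M \<and> y i \<le> (\<Sum>j | j < num_budgets I \<and> i \<in> budget_set I j. \<alpha> j) \<and>
      (x i = 1 \<longrightarrow> y i = 0)) \<and>
    (\<forall>j<num_budgets I. \<alpha> j \<le> M) \<and>
    M * (\<Sum>i<num_items I. x i) + (\<Sum>i<num_items I. y i) = num_selected I * M"

text \<open>The dual objective at \<open>x\<close>, \<open>y / M\<close> and
  \<open>\<alpha> / M\<close>, multiplied by \<open>M\<close>.\<close>

definition grid_cost ::
  "sel_instance \<Rightarrow> nat \<Rightarrow> (nat \<Rightarrow> nat) \<Rightarrow> (nat \<Rightarrow> nat) \<Rightarrow> (nat \<Rightarrow> nat) \<Rightarrow> real" where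
  "grid_cost I M x y \<alpha> = M * (\<Sum>i<num_items I. of_rat (first_cost I i) * x i) +
    (\<Sum>i<num_items I. of_rat (base_cost I i) * y i) + (\<Sum>j<num_budgets I. of_rat (budget I j) * \<alpha> j)"

text \<open>Weak duality in each scenario: through the coupling, the sum of
  \<open>\<delta> i * y i\<close> is bounded by the budgets weighted with \<open>\<alpha>\<close>,
  so the fractional answer \<open>y / M\<close> costs at most the dual objective. Rounding with the
  scenario itself as weights then yields a binary answer that is no dearer.\<close>

lemma grid_solution_value:
  assumes I: "valid_instance I" and M: "M > 0" and g: "grid_solution I M x y \<alpha>"
  shows "x \<in> sel_feasible I" "sel_value I x \<le> ereal (grid_cost I M x y \<alpha> / M)"
proof -
  define n where "n = num_items I"
  define p where "p = num_selected I"
  define K where "K = num_budgets I"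
  define U where "U = budget_set I"
  define C c \<Gamma> :: "nat \<Rightarrow> real" where "C i = of_rat (first_cost I i)" and "c i = of_rat (base_cost I i)"
    and "\<Gamma> i = of_rat (budget I i)" for i
  note defs = n_def p_def K_def U_def C_def c_def \<Gamma>_def
  have x: "x \<in> binary_vectors n" and y: "\<And>i. i < n \<Longrightarrow> y i \<le> M"
    "\<And>i. i < n \<Longrightarrow> y i \<le> (\<Sum>j | j < K \<and> i \<in> U j. \<alpha> j)" "\<And>i. i < n \<Longrightarrow> x i = 1 \<Longrightarrow> y i = 0"
    and sum: "M * (\<Sum>i<n. x i) + (\<Sum>i<n. y i) = p * M"
    using g unfolding grid_solution_def defs by auto
  have U: "\<And>j. j < K \<Longrightarrow> U j \<subseteq> {..<n}" using I unfolding valid_instance_def defs by auto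
  define A where "A = {i. i < n \<and> x i = 0}"
  have A: "finite A" "A \<subseteq> {..<n}" unfolding A_def by auto
  have x01: "x i = 0 \<or> x i = 1" if "i < n" for i using x that unfolding binary_vectors_def by auto
  have onA: "(\<Sum>i<n. g i * y i) = (\<Sum>i\<in>A. g i * y i)" for g :: "nat \<Rightarrow> real"
  proof (rule sum.mono_neutral_right)
    show "\<forall>i\<in>{..<n} - A. g i * y i = 0" using x01 y(3) unfolding A_def by fastforce
  qed (use A in auto)
  have le: "M * (\<Sum>i<n. x i) \<le> p * M" using sum by linarith
  then have "(\<Sum>i<n. x i) \<le> p" using M by (simp add: mult.commute)
  then obtain m where m: "p = (\<Sum>i<n. x i) + m" using le_Suc_ex by blast
  have sy: "(\<Sum>i<n. y i) = m * M" using sum unfolding m by (simp add: algebra_simps)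
  have step: "\<exists>y'\<in>recourse n (selection n p) x. (\<Sum>i<n. w i * y' i) \<le> (\<Sum>i<n. w i * y i) / M"
    for w :: "nat \<Rightarrow> real"
  proof -
    have "(\<Sum>i\<in>A. y i / M) = real m"
    proof -
      have "(\<Sum>i\<in>A. real (y i)) = (\<Sum>i<n. real (y i))" using onA[of "\<lambda>_. 1"] by simp
      also have "\<dots> = real m * M" unfolding of_nat_sum[symmetric] sy by simp
      finally show ?thesis using M by (simp add: sum_divide_distrib[symmetric])
    qed
    moreover have "0 \<le> y i / M \<and> y i / M \<le> 1" if "i \<in> A" for i
      using y(1)[of i] that M unfolding A_def by simp
    ultimately obtain T where T: "T \<subseteq> A" "card T = m" "(\<Sum>i\<in>T. w i) \<le> (\<Sum>i\<in>A. w i * (y i / M))"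
      using selection_rounding[OF A(1), of "\<lambda>i. y i / M" m w] by blast
    define y' :: "nat \<Rightarrow> nat" where "y' i = of_bool (i \<in> T)" for i
    have Tn: "T \<subseteq> {..<n}" using T(1) A(2) by blast
    have "(\<Sum>i<n. y' i) = m"
    proof -
      have "(\<Sum>i<n. y' i) = (\<Sum>i\<in>T. 1)"
        unfolding y'_def by (rule sum.mono_neutral_cong_right) (use Tn in auto)
      then show ?thesis using T(2) by simp
    qed
    then have "y' \<in> recourse n (selection n p) x"
      unfolding recourse_selection_iff[OF x] m
      using Tn T(1) by (auto simp: y'_def binary_vectors_def A_def)
    moreover have "(\<Sum>i<n. w i * y' i) = (\<Sum>i\<in>T. w i)"
      unfolding y'_def by (rule sum.mono_neutral_cong_right) (use Tn in auto)
    moreover have "(\<Sum>i\<in>A. w i * (y i / M)) = (\<Sum>i<n. w i * y i) / M"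
      unfolding onA by (simp add: sum_divide_distrib)
    ultimately show ?thesis using T(3) by (intro bexI[of _ y']) simp_all
  qed
  \<comment> \<open>Any weights do here: only the existence of a binary recourse matters.\<close>
  from step[of "\<lambda>_. 0"] show "x \<in> sel_feasible I"
    using x unfolding sel_feasible_def first_stage_def defs by auto
  have cost: "(INF y'\<in>recourse n (selection n p) x. ereal ((\<Sum>i<n. C i * x i) + (\<Sum>i<n. d i * y' i)))
      \<le> ereal (grid_cost I M x y \<alpha> / M)" if d: "d \<in> budgeted_set n K c U \<Gamma>" for d :: "nat \<Rightarrow> real"
  proof -
    obtain \<delta> where de: "d = (\<lambda>i. c i + \<delta> i)" and \<delta>: "\<And>i. i < n \<Longrightarrow> \<delta> i \<ge> 0"
      "\<And>j. j < K \<Longrightarrow> (\<Sum>i\<in>U j. \<delta> i) \<le> \<Gamma> j"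
      using d unfolding budgeted_set_def by auto
    obtain y' where y': "y' \<in> recourse n (selection n p) x" "(\<Sum>i<n. d i * y' i) \<le> (\<Sum>i<n. d i * y i) / M"
      using step[of d] by (rule bexE)
    have "(\<Sum>i<n. \<delta> i * y i) \<le> (\<Sum>i<n. \<delta> i * (\<Sum>j | j < K \<and> i \<in> U j. real (\<alpha> j)))"
    proof (rule sum_mono)
      fix i assume "i \<in> {..<n}"
      then have i: "i < n" by simp
      have "real (y i) \<le> real (\<Sum>j | j < K \<and> i \<in> U j. \<alpha> j)" using y(2)[OF i] by (simp only: of_nat_le_iff)
      then show "\<delta> i * y i \<le> \<delta> i * (\<Sum>j | j < K \<and> i \<in> U j. real (\<alpha> j))"
        using \<delta>(1)[OF i] by (intro mult_left_mono) auto
    qed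
    also have "\<dots> = (\<Sum>i<n. \<Sum>j<K. if i \<in> U j then \<delta> i * \<alpha> j else 0)"
    proof (rule sum.cong[OF refl])
      fix i
      show "\<delta> i * (\<Sum>j | j < K \<and> i \<in> U j. real (\<alpha> j)) = (\<Sum>j<K. if i \<in> U j then \<delta> i * \<alpha> j else 0)"
        unfolding sum_distrib_left by (rule sum.mono_neutral_cong_left) auto
    qed
    also have "\<dots> = (\<Sum>j<K. \<Sum>i<n. if i \<in> U j then \<delta> i * \<alpha> j else 0)" by (rule sum.swap)
    also have "\<dots> = (\<Sum>j<K. (\<Sum>i\<in>U j. \<delta> i) * \<alpha> j)"
    proof (rule sum.cong[OF refl])
      fix j assume "j \<in> {..<K}"
      then have "U j \<subseteq> {..<n}" using U by simp
      then show "(\<Sum>i<n. if i \<in> U j then \<delta> i * \<alpha> j else 0) = (\<Sum>i\<in>U j. \<delta> i) * \<alpha> j"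
        unfolding sum_distrib_right by (intro sum.mono_neutral_cong_right) auto
    qed
    also have "\<dots> \<le> (\<Sum>j<K. \<Gamma> j * \<alpha> j)" using \<delta>(2) by (intro sum_mono mult_right_mono) auto
    finally have "(\<Sum>i<n. d i * y i) \<le> (\<Sum>i<n. c i * y i) + (\<Sum>j<K. \<Gamma> j * \<alpha> j)"
      unfolding de by (simp add: distrib_right sum.distrib)
    then have "(\<Sum>i<n. d i * y i) / M \<le> ((\<Sum>i<n. c i * y i) + (\<Sum>j<K. \<Gamma> j * \<alpha> j)) / M"
      by (rule divide_right_mono) simp
    with y'(2) have "(\<Sum>i<n. C i * x i) + (\<Sum>i<n. d i * y' i) \<le>
        (\<Sum>i<n. C i * x i) + ((\<Sum>i<n. c i * y i) + (\<Sum>j<K. \<Gamma> j * \<alpha> j)) / M"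
      by linarith
    also have "\<dots> = grid_cost I M x y \<alpha> / M"
      using M unfolding grid_cost_def defs by (simp add: add_divide_distrib)
    finally show ?thesis using y'(1) by (intro INF_lower2[of y']) auto
  qed
  have U1: "K = num_budgets I" "n = num_items I" by (simp_all add: defs)
  show "sel_value I x \<le> ereal (grid_cost I M x y \<alpha> / M)"
    unfolding sel_value_def robust_value_def
    using cost unfolding defs by (intro SUP_least) (simp add: C_def[abs_def])
qed

text \<open>Duality supplies fractional \<open>y\<close> and \<open>\<alpha>\<close> that together
  with \<open>z\<close> cost at most \<open>v\<close>, and these are rounded to the grid. The upper
  bound \<open>1 - z i\<close> makes \<open>y i\<close> vanish on items already bought; rounding
  keeps these zeros, because \<open>y' i\<close> is at most a multiple of
  \<open>y i\<close>.\<close>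

lemma grid_solution_exists:
  assumes I: "valid_instance I" and N: "N \<ge> 1"
    and M: "M = (num_items I + 1) * (num_budgets I + 1) * N"
    and z: "z \<in> sel_feasible I" and v: "sel_value I z \<le> ereal v"
  shows "\<exists>y \<alpha>. grid_solution I M z y \<alpha> \<and> grid_cost I M z y \<alpha> \<le> (1 + 1 / N) * M * v"
proof -
  define n where "n = num_items I"
  define p where "p = num_selected I"
  define K where "K = num_budgets I"
  define U where "U = budget_set I"
  define C c \<Gamma> :: "nat \<Rightarrow> real" where "C = (\<lambda>i. of_rat (first_cost I i))" and "c = (\<lambda>i. of_rat (base_cost I i))"
    and "\<Gamma> = (\<lambda>i. of_rat (budget I i))"
  note defs = n_def p_def K_def U_def C_def c_def \<Gamma>_def
  have U: "\<And>j. j < K \<Longrightarrow> U j \<subseteq> {..<n}" and \<Gamma>: "\<And>j. j < K \<Longrightarrow> \<Gamma> j \<ge> 0"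
    and c: "\<And>i. i < n \<Longrightarrow> c i \<ge> 0" "\<And>i. i < n \<Longrightarrow> C i \<ge> 0"
    using I unfolding valid_instance_def defs by auto
  have zb: "z \<in> binary_vectors n" and ne: "recourse n (selection n p) z \<noteq> {}"
    using z unfolding sel_feasible_def first_stage_def defs by auto
  define m where "m = p - (\<Sum>i<n. z i)"
  have m: "p = (\<Sum>i<n. z i) + m"
  proof -
    obtain y where "y \<in> recourse n (selection n p) z" using ne by blast
    then show ?thesis unfolding recourse_selection_iff[OF zb] m_def by simp
  qed
  have z01: "z i = 0 \<or> z i = 1" if "i < n" for i using zb that unfolding binary_vectors_def by auto
  have fin: "finite (recourse n (selection n p) z)"
    by (rule finite_subset[OF _ finite_binary_vectors[of n]]) (auto simp: recourse_def)
  define Y where "Y = (\<lambda>y i. real (y i)) ` recourse n (selection n p) z"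
  have "\<exists>y \<alpha>. (\<forall>i<n. 0 \<le> y i \<and> y i \<le> 1 - real (z i) \<and> y i \<le> (\<Sum>j | j < K \<and> i \<in> U j. \<alpha> j)) \<and>
    (\<forall>j<K. \<alpha> j \<ge> 0) \<and> (\<Sum>i<n. y i) = real m \<and>
    (\<Sum>i<n. c i * y i) + (\<Sum>j<K. \<Gamma> j * \<alpha> j) \<le> v - (\<Sum>i<n. C i * z i)"
  proof (rule two_stage_duality[where Y = Y and U = U and \<Gamma> = \<Gamma> and c = c and n = n and r = "\<lambda>i. 1 - real (z i)"])
    fix y i assume "y \<in> Y" "i < n"
    then obtain y' where y': "y = (\<lambda>i. real (y' i))" "y' i = 0 \<or> y' i = 1" "z i = 1 \<longrightarrow> y' i = 0"
      unfolding Y_def using recourse_selection_iff[OF zb] unfolding binary_vectors_def by auto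
    then show "0 \<le> y i \<and> y i \<le> 1 - real (z i)"
      using z01[OF \<open>i < n\<close>] by auto
  next
    fix y assume "y \<in> Y"
    then obtain y' where "y = (\<lambda>i. real (y' i))" "(\<Sum>i<n. y' i) = m"
      unfolding Y_def using recourse_selection_iff[OF zb] m by auto
    then show "(\<Sum>i<n. y i) = real m" by (simp flip: of_nat_sum)
  next
    fix \<delta> :: "nat \<Rightarrow> real"
    assume "\<And>i. i < n \<Longrightarrow> \<delta> i \<ge> 0" "\<And>j. j < K \<Longrightarrow> (\<Sum>i\<in>U j. \<delta> i) \<le> \<Gamma> j"
    then have mem: "(\<lambda>i. c i + \<delta> i) \<in> budgeted_set n K c U \<Gamma>" unfolding budgeted_set_def by blast
    define R where "R = recourse n (selection n p) z"
    define f where "f y = (\<Sum>i<n. C i * z i) + (\<Sum>i<n. (c i + \<delta> i) * real (y i))" for y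
    have "finite R" "R \<noteq> {}" using fin ne unfolding R_def by auto
    \<comment> \<open>Over a finite nonempty set of recourse vectors the infimum is attained, so the
      bound on the supremum over scenarios yields a concrete answer in each scenario.\<close>
    then have "Inf ((\<lambda>y. ereal (f y)) ` R) \<in> (\<lambda>y. ereal (f y)) ` R"
      using Min_in[of "(\<lambda>y. ereal (f y)) ` R"] Min_Inf[of "(\<lambda>y. ereal (f y)) ` R"] by simp
    then obtain y where y: "y \<in> R" "(INF y\<in>R. ereal (f y)) = ereal (f y)" by auto
    have "(INF y\<in>R. ereal (f y)) \<le> sel_value I z"
      unfolding sel_value_def robust_value_def R_def f_def
      using SUP_upper[OF mem, of "\<lambda>c. INF y\<in>R. ereal ((\<Sum>i<n. C i * z i) + (\<Sum>i<n. c i * y i))"]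
      unfolding R_def defs by simp
    with v y(2) have "ereal (f y) \<le> ereal v" by (simp only:)
    with y(1) show "\<exists>y\<in>Y. (\<Sum>i<n. (c i + \<delta> i) * y i) \<le> v - (\<Sum>i<n. C i * z i)"
      unfolding Y_def R_def f_def by (intro bexI[of _ "\<lambda>i. real (y i)"]) auto
  qed (use U \<Gamma> c in simp_all)
  then obtain y \<alpha> where y: "\<And>i. i < n \<Longrightarrow> 0 \<le> y i \<and> y i \<le> 1 - real (z i) \<and> y i \<le> (\<Sum>j | j < K \<and> i \<in> U j. \<alpha> j)"
    and \<alpha>: "\<And>j. j < K \<Longrightarrow> \<alpha> j \<ge> 0" and sy: "(\<Sum>i<n. y i) = real m"
    and cost: "(\<Sum>i<n. c i * y i) + (\<Sum>j<K. \<Gamma> j * \<alpha> j) \<le> v - (\<Sum>i<n. C i * z i)" by blast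
  have "\<And>i. i < n \<Longrightarrow> 0 \<le> y i \<and> y i \<le> 1 \<and> y i \<le> (\<Sum>j | j < K \<and> i \<in> U j. \<alpha> j)"
    using y by force
  then obtain y' \<alpha>' :: "nat \<Rightarrow> nat" where
    y': "\<And>i. i < n \<Longrightarrow> y' i \<le> M \<and> y' i \<le> (\<Sum>j | j < K \<and> i \<in> U j. \<alpha>' j)"
    and \<alpha>': "\<And>j. j < K \<Longrightarrow> \<alpha>' j \<le> M" and sy': "(\<Sum>i<n. y' i) = m * M"
    and ry: "\<And>i. i < n \<Longrightarrow> real (y' i) \<le> (1 + 1 / N) * M * y i"
    and ra: "\<And>j. j < K \<Longrightarrow> real (\<alpha>' j) \<le> (1 + 1 / N) * M * \<alpha> j"
    by (rule grid_rounding[OF N M[folded n_def K_def] _ \<alpha> sy, where U = U]) (assumption | rule that)+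
  define \<rho> where "\<rho> = (1 + 1 / real N) * M"
  have \<rho>: "\<rho> \<ge> M" "\<rho> \<ge> 0" unfolding \<rho>_def by (simp_all add: distrib_right)
  have "y' i = 0" if "i < n" "z i = 1" for i
  proof -
    have "y i = 0" using y[OF that(1)] that(2) by auto
    with ry[OF that(1)] show ?thesis by simp
  qed
  then have "grid_solution I M z y' \<alpha>'"
    unfolding grid_solution_def using zb y' \<alpha>' sy' m unfolding defs by (simp add: algebra_simps)
  moreover have "grid_cost I M z y' \<alpha>' \<le> \<rho> * v"
  proof -
    have "(\<Sum>i<n. c i * y' i) \<le> (\<Sum>i<n. c i * (\<rho> * y i))"
      using ry c unfolding \<rho>_def by (intro sum_mono mult_left_mono) auto
    moreover have "(\<Sum>j<K. \<Gamma> j * \<alpha>' j) \<le> (\<Sum>j<K. \<Gamma> j * (\<rho> * \<alpha> j))"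
      using ra \<Gamma> unfolding \<rho>_def by (intro sum_mono mult_left_mono) auto
    moreover have "M * (\<Sum>i<n. C i * z i) \<le> \<rho> * (\<Sum>i<n. C i * z i)"
      using \<rho> c by (intro mult_right_mono sum_nonneg) auto
    moreover have "\<rho> * ((\<Sum>i<n. C i * z i) + (\<Sum>i<n. c i * y i) + (\<Sum>j<K. \<Gamma> j * \<alpha> j)) \<le> \<rho> * v"
      using \<rho> cost by (intro mult_left_mono) auto
    ultimately show ?thesis unfolding grid_cost_def defs
      by (simp add: algebra_simps sum_distrib_left)
  qed
  ultimately show ?thesis unfolding \<rho>_def by blast
qed

section \<open>Reasoning about running times\<close>

text \<open>Chosen so that \<open>2 ^ (asize e * L)\<close> bounds the value of \<open>e\<close>
  when all cells are at most \<open>2 ^ L\<close> in absolute value: a constant counts with its bit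
  length, and a product adds exponents.\<close>

fun asize :: "aexp \<Rightarrow> nat" where
  "asize (Const z) = isize z"
| "asize (Elem a e) = asize e + 1"
| "asize (Plus e f) = asize e + asize f + 1"
| "asize (Minus e f) = asize e + asize f + 1"
| "asize (Times e f) = asize e + asize f + 1"
| "asize (Div e f) = asize e + asize f + 1"

fun bsize :: "bexp \<Rightarrow> nat" where
  "bsize (Less e f) = asize e + asize f"
| "bsize (Neg b) = bsize b + 1"
| "bsize (And b b') = bsize b + bsize b' + 1"

fun csize :: "com \<Rightarrow> nat" where
  "csize Skip = 1"
| "csize (Store a e f) = asize e + asize f"
| "csize (Seq c d) = csize c + csize d"
| "csize (Cond b c d) = bsize b + csize c + csize d"
| "csize (While b c) = bsize b + csize c"

text \<open>Opaque, so that the simplifier does not move bounds on integers to natural numbers.\<close>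

definition cell_bound :: "nat \<Rightarrow> int" where
  "cell_bound L = 2 ^ L"

definition bounded :: "nat \<Rightarrow> state \<Rightarrow> bool" where
  "bounded L s \<longleftrightarrow> (\<forall>a i. \<bar>s a i\<bar> \<le> 2 ^ L)"

text \<open>An expression of size \<open>k\<close> has at most \<open>k\<close> nodes, and each is
  charged at most \<open>k * L + 2\<close>, since all values in it are at most
  \<open>2 ^ (k * L)\<close>. The form is superadditive in \<open>k\<close>, so the costs of parts
  add up to at most the cost of the whole.\<close>

definition unit_cost :: "nat \<Rightarrow> nat \<Rightarrow> nat" where
  "unit_cost L k = k * (k * L + 2)"

lemma isize_le:
  assumes "\<bar>z\<bar> \<le> 2 ^ m"
  shows "isize z \<le> m + 2"
proof -
  have "floorlog 2 (nat \<bar>z\<bar>) \<le> floorlog 2 (nat (2 ^ m))"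
    using assms by (intro floorlog_mono) auto
  also have "nat (2 ^ m) = 2 ^ m" by (simp add: nat_power_eq)
  also have "floorlog 2 ((2::nat) ^ m) \<le> m + 1" by (simp add: floorlog_def)
  finally show ?thesis unfolding isize_def by simp
qed

lemma abs_lt_isize: "\<bar>z\<bar> < 2 ^ (isize z - 1)"
proof -
  have "nat \<bar>z\<bar> < 2 ^ floorlog 2 (nat \<bar>z\<bar>)"
    using floorlog_bounds[of "nat \<bar>z\<bar>" 2] by (cases "z = 0") (auto simp: floorlog_def)
  then have "int (nat \<bar>z\<bar>) < int (2 ^ floorlog 2 (nat \<bar>z\<bar>))" by (simp only: of_nat_less_iff)
  then show ?thesis by (simp add: isize_def)
qed

lemma abs_le_isize: "\<bar>z\<bar> \<le> 2 ^ isize z"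
proof -
  have "(2::int) ^ (isize z - 1) \<le> 2 ^ isize z" by (rule power_increasing) auto
  with abs_lt_isize[of z] show ?thesis by linarith
qed

text \<open>Division rounds towards minus infinity, so \<open>(- 1) div 2\<close> has absolute value
  1. Even so, a negative quotient by a positive divisor never drops below \<open>x\<close>; negative
  divisors are reduced to positive ones by changing both signs.\<close>

lemma abs_div_le:
  fixes x y :: int
  shows "\<bar>x div y\<bar> \<le> \<bar>x\<bar>"
proof -
  have pos: "\<bar>x div y\<bar> \<le> \<bar>x\<bar>" if "y > 0" for x y :: int
  proof (cases "x \<ge> 0")
    case True
    have "x div y \<le> x div 1" using True that by (intro zdiv_mono2) auto
    with True that show ?thesis by (simp add: pos_imp_zdiv_nonneg_iff)
  next
    case False
    have "x div y * y \<ge> x - (y - 1)" using that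
      by (smt (verit) mult_div_mod_eq mult.commute pos_mod_bound)
    have "x div y < 0" using False that by (simp add: pos_imp_zdiv_neg_iff)
    moreover have "x div y \<ge> x"
    proof (rule ccontr)
      assume "\<not> x div y \<ge> x"
      then have "x div y * y \<le> (x - 1) * y" using that by (intro mult_right_mono) auto
      also have "\<dots> \<le> (x - 1) * 1 - (y - 1)"
      proof -
        have "(x - 1) * (y - 1) \<le> - 1 * (y - 1)" using False that by (intro mult_right_mono) auto
        then show ?thesis by (simp add: algebra_simps)
      qed
      finally show False using \<open>x div y * y \<ge> x - (y - 1)\<close> by simp
    qed
    ultimately show ?thesis by simp
  qed
  consider "y > 0" | "y = 0" | "y < 0" by linarith
  then show ?thesis
  proof cases
    case 3
    then have "\<bar>(- x) div (- y)\<bar> \<le> \<bar>- x\<bar>" by (intro pos) simp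
    then show ?thesis by simp
  qed (use pos in auto)
qed

lemma aval_bounded:
  assumes "bounded L s" "L \<ge> 1"
  shows "\<bar>aval e s\<bar> \<le> 2 ^ (asize e * L)"
proof (induction e)
  case (Const z)
  have "(2::int) ^ isize z \<le> 2 ^ (isize z * L)" using assms(2) by (intro power_increasing) auto
  then show ?case unfolding aval.simps asize.simps using abs_le_isize[of z] by (rule order_trans[rotated])
next
  case (Elem a e)
  have "(2::int) ^ L \<le> 2 ^ ((asize e + 1) * L)" by (intro power_increasing) auto
  moreover have "\<bar>s a (aval e s)\<bar> \<le> 2 ^ L" using assms(1) unfolding bounded_def by blast
  ultimately show ?case unfolding aval.simps asize.simps by (rule order_trans[rotated])
next
  have sum: "\<bar>x\<bar> + \<bar>y\<bar> \<le> 2 ^ ((k + l + 1) * L)"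
    if "\<bar>x\<bar> \<le> 2 ^ (k * L)" "\<bar>y\<bar> \<le> 2 ^ (l * L)" for x y :: int and k l
  proof -
    have "(2::int) ^ (k * L) \<le> 2 ^ ((k + l) * L)" "(2::int) ^ (l * L) \<le> 2 ^ ((k + l) * L)"
      by (intro power_increasing; simp)+
    then have "\<bar>x\<bar> + \<bar>y\<bar> \<le> 2 * 2 ^ ((k + l) * L)" using that by linarith
    also have "\<dots> = 2 ^ ((k + l) * L + 1)" by simp
    also have "\<dots> \<le> 2 ^ ((k + l + 1) * L)" using assms(2) by (intro power_increasing) (auto simp: distrib_right)
    finally show ?thesis .
  qed
  {
    case (Plus e f)
    from sum[OF this] show ?case by simp
  next
    case (Minus e f)
    from sum[OF this] show ?case by simp
  next
    case (Times e f)
    have "\<bar>aval e s\<bar> * \<bar>aval f s\<bar> \<le> 2 ^ (asize e * L) * 2 ^ (asize f * L)"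
      using Times by (intro mult_mono) auto
    also have "\<dots> = 2 ^ (asize e * L + asize f * L)" by (simp add: power_add)
    also have "\<dots> \<le> 2 ^ ((asize e + asize f + 1) * L)" by (intro power_increasing) (auto simp: distrib_right)
    finally show ?case by (simp add: abs_mult)
  next
    case (Div e f)
    have "\<bar>aval e s div aval f s\<bar> \<le> \<bar>aval e s\<bar>" by (rule abs_div_le)
    also have "\<dots> \<le> 2 ^ (asize e * L)" by (rule Div(1))
    also have "\<dots> \<le> 2 ^ ((asize e + asize f + 1) * L)" by (intro power_increasing) (auto simp: distrib_right)
    finally show ?case by simp
  }
qed

lemma acost_le:
  assumes "bounded L s" "L \<ge> 1"
  shows "acost e s \<le> unit_cost L (asize e)"
proof (induction e)
  case (Const z)
  have "isize z * 1 \<le> isize z * (isize z * L + 2)" by (rule mult_left_mono) auto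
  then show ?case unfolding unit_cost_def by simp
next
  case (Elem a e)
  have "isize (s a (aval e s)) \<le> L + 2" using assms(1) unfolding bounded_def by (intro isize_le) blast
  with Elem show ?case unfolding unit_cost_def by (simp add: algebra_simps)
next
  have op: "acost e s + acost f s + isize (aval g s) \<le> unit_cost L (asize g)"
    if "acost e s \<le> unit_cost L (asize e)" "acost f s \<le> unit_cost L (asize f)" "asize g = asize e + asize f + 1"
    for e f g
  proof -
    have "isize (aval g s) \<le> asize g * L + 2" using aval_bounded[OF assms] by (rule isize_le)
    with that show ?thesis unfolding unit_cost_def that(3) by (simp add: algebra_simps)
  qed
  {
    case (Plus e f)
    then show ?case using op[of e f "Plus e f"] by simp
  next
    case (Minus e f)
    then show ?case using op[of e f "Minus e f"] by simp
  next
    case (Times e f)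
    then show ?case using op[of e f "Times e f"] by simp
  next
    case (Div e f)
    then show ?case using op[of e f "Div e f"] by simp
  }
qed

lemma unit_cost_add: "unit_cost L k + unit_cost L l \<le> unit_cost L (k + l)"
  unfolding unit_cost_def by (simp add: algebra_simps)

lemma unit_cost_mono: "k \<le> l \<Longrightarrow> unit_cost L k \<le> unit_cost L l"
  unfolding unit_cost_def by (intro mult_mono add_mono) auto

lemma unit_cost_ge: "k \<le> unit_cost L k"
  unfolding unit_cost_def by (cases k) auto

lemma bcost_le:
  assumes "bounded L s" "L \<ge> 1"
  shows "bcost b s \<le> unit_cost L (bsize b)"
proof (induction b)
  case (Less e f)
  then show ?case
    using acost_le[OF assms, of e] acost_le[OF assms, of f] unit_cost_add[of L "asize e" "asize f"] by simp
next
  case (Neg b)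
  then show ?case using unit_cost_add[of L "bsize b" 1] unit_cost_ge[of 1 L] by simp
next
  case (And b b')
  then show ?case
    using unit_cost_add[of L "bsize b" "bsize b'"] unit_cost_add[of L "bsize b + bsize b'" 1] unit_cost_ge[of 1 L]
    by simp
qed

text \<open>
  Every assignment and every evaluation of a guard is one step, which costs at most a unit that
  depends only on the program and on the bit length \<open>L\<close> of the cells.
\<close>

definition runs :: "nat \<Rightarrow> com \<Rightarrow> state \<Rightarrow> nat \<Rightarrow> (state \<Rightarrow> bool) \<Rightarrow> bool" where
  "runs L c s T Q \<longleftrightarrow> (bounded L s \<and> L \<ge> 1 \<longrightarrow>
    (\<exists>t s'. exec c s t s' \<and> t \<le> T * unit_cost L (csize c) \<and> bounded L s' \<and> Q s'))"

section \<open>Rules for counting the steps of structured programs\<close>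

lemma runs_weaken:
  assumes "runs L c s T P" "T \<le> T'" "\<And>s'. P s' \<Longrightarrow> Q s'"
  shows "runs L c s T' Q"
proof -
  have "T * unit_cost L (csize c) \<le> T' * unit_cost L (csize c)" using assms(2) by (rule mult_right_mono) simp
  then show ?thesis using assms(1,3) unfolding runs_def by (meson le_trans)
qed

lemma runs_Skip: "Q s \<Longrightarrow> runs L Skip s 1 Q"
  unfolding runs_def using exec.Skip unit_cost_ge[of 1 L] by fastforce

text \<open>Only the stored value must fit into a cell. Index and intermediate values are bounded in
  terms of the size of the expressions, which the unit cost already takes into account.\<close>

lemma runs_Store:
  assumes "\<bar>aval f s\<bar> \<le> cell_bound L" "Q (s(a := (s a)(aval e s := aval f s)))"
  shows "runs L (Store a e f) s 1 Q"
  unfolding runs_def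
proof (intro impI)
  assume b: "bounded L s \<and> 1 \<le> L"
  have "acost e s + acost f s \<le> unit_cost L (asize e + asize f)"
    using acost_le[of L s e] acost_le[of L s f] unit_cost_add[of L "asize e" "asize f"] b by simp
  moreover have "bounded L (s(a := (s a)(aval e s := aval f s)))"
    using b assms(1) unfolding bounded_def cell_bound_def by simp
  ultimately show "\<exists>t s'. exec (Store a e f) s t s' \<and> t \<le> 1 * unit_cost L (csize (Store a e f)) \<and>
      bounded L s' \<and> Q s'"
    using exec.Store[of a e f s] assms(2) by (metis csize.simps(2) mult_1)
qed

lemma runs_Seq:
  assumes "runs L c s T P" "\<And>s'. P s' \<Longrightarrow> runs L d s' T' Q"
  shows "runs L (Seq c d) s (T + T') Q"
  unfolding runs_def
proof (intro impI)
  assume b: "bounded L s \<and> 1 \<le> L"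
  then obtain t s' where 1: "exec c s t s'" "t \<le> T * unit_cost L (csize c)" "bounded L s'" "P s'"
    using assms(1) unfolding runs_def by blast
  then obtain t' s'' where 2: "exec d s' t' s''" "t' \<le> T' * unit_cost L (csize d)" "bounded L s''" "Q s''"
    using assms(2)[of s'] b unfolding runs_def by blast
  have "T * unit_cost L (csize c) \<le> T * unit_cost L (csize (Seq c d))"
    "T' * unit_cost L (csize d) \<le> T' * unit_cost L (csize (Seq c d))"
    by (intro mult_left_mono unit_cost_mono; simp)+
  with 1(2) 2(2) have "t + t' \<le> (T + T') * unit_cost L (csize (Seq c d))" unfolding distrib_right by linarith
  then show "\<exists>t s'. exec (Seq c d) s t s' \<and> t \<le> (T + T') * unit_cost L (csize (Seq c d)) \<and>
      bounded L s' \<and> Q s'"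
    using exec.Seq[OF 1(1) 2(1)] 2 by blast
qed

lemma runs_Cond:
  assumes "bval b s \<Longrightarrow> runs L c s T Q" "\<not> bval b s \<Longrightarrow> runs L d s T Q"
  shows "runs L (Cond b c d) s (T + 1) Q"
  unfolding runs_def
proof (intro impI)
  let ?c = "Cond b c d"
  assume B: "bounded L s \<and> 1 \<le> L"
  have bc: "bcost b s \<le> unit_cost L (csize ?c)"
    using bcost_le[of L s b] B unit_cost_mono[of "bsize b" "csize ?c" L] by simp
  have mono: "T * unit_cost L (csize c) \<le> T * unit_cost L (csize ?c)"
    "T * unit_cost L (csize d) \<le> T * unit_cost L (csize ?c)"
    by (intro mult_left_mono unit_cost_mono; simp)+
  show "\<exists>t s'. exec ?c s t s' \<and> t \<le> (T + 1) * unit_cost L (csize ?c) \<and> bounded L s' \<and> Q s'"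
  proof (cases "bval b s")
    case True
    then obtain t s' where 1: "exec c s t s'" "t \<le> T * unit_cost L (csize c)" "bounded L s'" "Q s'"
      using assms(1) B unfolding runs_def by blast
    then have "bcost b s + t \<le> (T + 1) * unit_cost L (csize ?c)" using bc mono unfolding distrib_right by linarith
    with 1 exec.CondTrue[OF True 1(1)] show ?thesis by blast
  next
    case False
    then obtain t s' where 1: "exec d s t s'" "t \<le> T * unit_cost L (csize d)" "bounded L s'" "Q s'"
      using assms(2) B unfolding runs_def by blast
    then have "bcost b s + t \<le> (T + 1) * unit_cost L (csize ?c)" using bc mono unfolding distrib_right by linarith
    with 1 exec.CondFalse[OF False 1(1)] show ?thesis by blast
  qed
qed

lemma runs_While:
  assumes "I i s" "i \<le> N"
    and step: "\<And>i s. I i s \<Longrightarrow> i < N \<Longrightarrow> bval b s \<and> runs L c s T (I (Suc i))"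
    and stop: "\<And>s. I N s \<Longrightarrow> \<not> bval b s"
  shows "runs L (While b c) s ((N - i) * (T + 1) + 1) (I N)"
  using assms(1,2)
proof (induction "N - i" arbitrary: i s)
  let ?u = "unit_cost L (csize (While b c))"
  have bc: "bcost b s \<le> ?u" if "bounded L s" "L \<ge> 1" for s
    using bcost_le[of L s b] that unit_cost_mono[of "bsize b" "csize (While b c)" L] by simp
  {
    case 0
    then have "i = N" by simp
    with 0 stop have "\<not> bval b s" by blast
    from exec.WhileFalse[OF this] bc 0 \<open>i = N\<close> show ?case unfolding runs_def by fastforce
  next
    case (Suc m)
    then have i: "i < N" "N - Suc i = m" by auto
    note st = step[OF Suc.prems(1) i(1)]
    show ?case unfolding runs_def
    proof (intro impI)
      assume B: "bounded L s \<and> 1 \<le> L"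
      then obtain t s' where 1: "exec c s t s'" "t \<le> T * unit_cost L (csize c)" "bounded L s'" "I (Suc i) s'"
        using st unfolding runs_def by blast
      obtain t' s'' where 2: "exec (While b c) s' t' s''" "t' \<le> (m * (T + 1) + 1) * ?u" "bounded L s''" "I N s''"
        using Suc.hyps(1)[of "Suc i" s'] 1 i B unfolding runs_def by auto
      have "T * unit_cost L (csize c) \<le> T * ?u" by (intro mult_left_mono unit_cost_mono) simp_all
      then have "bcost b s + t + t' \<le> ?u + T * ?u + (m * (T + 1) + 1) * ?u" using bc[of s] B 1(2) 2(2) by linarith
      also have "\<dots> = ((N - i) * (T + 1) + 1) * ?u" unfolding Suc.hyps(2)[symmetric] by (simp add: algebra_simps)
      finally show "\<exists>t s'. exec (While b c) s t s' \<and> t \<le> ((N - i) * (T + 1) + 1) * ?u \<and>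
          bounded L s' \<and> I N s'"
        using exec.WhileTrue[of b s c t s' t' s''] st 1 2 by blast
    qed
  }
qed

definition For :: "name \<Rightarrow> aexp \<Rightarrow> com \<Rightarrow> com" where
  "For x e c = Seq (Assign x (Const 0))
    (While (Less (Var x) e) (Seq c (Assign x (Plus (Var x) (Const 1)))))"

text \<open>Each round pays for the body, the increment and the guard; the final 2 covers the
  initialisation and the last guard. The invariant is asserted after the counter has been
  overwritten, so that frame conditions treating the counter as writable fit in. The limit
  \<open>e\<close> is evaluated anew in each round, hence the assumption that the invariant
  determines it.\<close>

lemma runs_For:
  assumes init: "I 0 (s(x := (s x)(0 := 0)))"
    and bound: "\<And>i s. I i s \<Longrightarrow> aval e s = int N"
    and N: "int N \<le> cell_bound L"
    and step: "\<And>i s. I i s \<Longrightarrow> i < N \<Longrightarrow> s x 0 = int i \<Longrightarrow>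
      runs L c s T (\<lambda>s'. s' x 0 = int i \<and> I (Suc i) (s'(x := (s' x)(0 := int (Suc i)))))"
    and post: "\<And>s. I N s \<Longrightarrow> Q s"
  shows "runs L (For x e c) s (N * (T + 2) + 2) Q"
proof -
  let ?J = "\<lambda>i s. I i s \<and> s x 0 = int i"
  have w: "runs L (While (Less (Var x) e) (Seq c (Assign x (Plus (Var x) (Const 1))))) s' (N * (T + 2) + 1) Q"
    if s': "s' = s(x := (s x)(0 := 0))" for s'
  proof -
    have "runs L (While (Less (Var x) e) (Seq c (Assign x (Plus (Var x) (Const 1))))) s'
       ((N - 0) * ((T + 1) + 1) + 1) (?J N)"
    proof (rule runs_While)
      show "?J 0 s'" using init s' by simp
    next
      fix i s assume J: "?J i s" "i < N"
      have "runs L (Seq c (Assign x (Plus (Var x) (Const 1)))) s (T + 1) (?J (Suc i))"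
      proof (rule runs_Seq[OF step])
        fix s' assume s': "s' x 0 = int i \<and> I (Suc i) (s'(x := (s' x)(0 := int (Suc i))))"
        show "runs L (Assign x (Plus (Var x) (Const 1))) s' 1 (?J (Suc i))"
        proof (rule runs_Store)
          have "int (Suc i) \<le> cell_bound L" using J(2) N by linarith
          then show "\<bar>aval (Plus (Var x) (Const 1)) s'\<bar> \<le> cell_bound L" using s' by simp
        qed (use s' in \<open>simp add: add.commute\<close>)
      qed (use J in auto)
      then show "bval (Less (Var x) e) s \<and>
          runs L (Seq c (Assign x (Plus (Var x) (Const 1)))) s (T + 1) (?J (Suc i))"
        using J bound[of i s] by simp
    qed (use bound in auto)
    then show ?thesis by (rule runs_weaken) (use post in \<open>auto simp: algebra_simps\<close>)
  qed
  have "runs L (For x e c) s (1 + (N * (T + 2) + 1)) Q"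
    unfolding For_def
    by (rule runs_Seq[where P = "\<lambda>s'. s' = s(x := (s x)(0 := 0))", OF runs_Store]) (use w in \<open>auto simp: cell_bound_def\<close>)
  then show ?thesis by simp
qed

section \<open>The knapsack problem for fixed dual variables\<close>

text \<open>The minimum over \<open>v < N\<close> with \<open>v \<le> w\<close>, written as the
  successive lowering of one cell that starts with \<open>g w\<close>. This is the loop of
  \<open>relax_prog\<close>; its round \<open>v = 0\<close> only confirms the start value.\<close>

primrec relax :: "(nat \<Rightarrow> int) \<Rightarrow> int \<Rightarrow> nat \<Rightarrow> nat \<Rightarrow> int" where
  "relax g b w 0 = g w"
| "relax g b w (Suc v) =
    (if v \<le> w then min (relax g b w v) (g (w - v) + int v * b) else relax g b w v)"

lemma relax_le:
  assumes "v < N" "v \<le> w"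
  shows "relax g b w N \<le> g (w - v) + int v * b"
  using assms by (induction N) (auto simp: less_Suc_eq min_def)

text \<open>Subtraction is truncated, so \<open>N = 0\<close> and \<open>N = 1\<close> both allow
  only \<open>v = 0\<close>.\<close>

lemma relax_attained: "\<exists>v\<le>N - 1. v \<le> w \<and> relax g b w N = g (w - v) + int v * b"
proof (induction N)
  case (Suc N)
  then obtain v where "v \<le> N - 1" "v \<le> w" "relax g b w N = g (w - v) + int v * b" by blast
  then show ?case by (cases "N \<le> w \<and> g (w - N) + int N * b < relax g b w N")
      (auto intro: exI[of _ N] exI[of _ v] simp: min_def)
qed simp

text \<open>
  \<open>table G M e b u i w\<close> is the least cost of covering a demand \<open>w\<close> by the first \<open>i\<close> items, where
  item \<open>k\<close> covers \<open>M\<close> units at cost \<open>e k\<close> or up to \<open>u k\<close> units at cost \<open>b k\<close> each; a nonzero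
  uncovered rest costs \<open>G\<close>.
\<close>

primrec table :: "int \<Rightarrow> nat \<Rightarrow> (nat \<Rightarrow> int) \<Rightarrow> (nat \<Rightarrow> int) \<Rightarrow> (nat \<Rightarrow> nat) \<Rightarrow> nat \<Rightarrow> nat \<Rightarrow> int" where
  "table G M e b u 0 = (\<lambda>w. if w = 0 then 0 else G)"
| "table G M e b u (Suc i) = (\<lambda>w.
    let m = relax (table G M e b u i) (b i) w (Suc (u i))
    in if M \<le> w then min m (table G M e b u i (w - M) + e i) else m)"

definition choice :: "(nat \<Rightarrow> nat) \<Rightarrow> nat \<Rightarrow> (nat \<Rightarrow> nat) \<Rightarrow> (nat \<Rightarrow> nat) \<Rightarrow> bool" where
  "choice u i x y \<longleftrightarrow> (\<forall>k<i. (x k = 0 \<or> x k = 1) \<and> y k \<le> u k \<and> (x k = 1 \<longrightarrow> y k = 0))"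

text \<open>The last summand is row 0 at the uncovered rest, hence 0 or \<open>G\<close>. Keeping it
  as a table entry treats exact and partial covers alike, so the induction can pass to any smaller
  demand.\<close>

lemma table_le:
  assumes "choice u i x y" "M * (\<Sum>k<i. x k) + (\<Sum>k<i. y k) \<le> w"
  shows "table G M e b u i w \<le> (\<Sum>k<i. e k * int (x k) + b k * int (y k)) +
    table G M e b u 0 (w - (M * (\<Sum>k<i. x k) + (\<Sum>k<i. y k)))"
  using assms
proof (induction i arbitrary: w)
  case 0
  then show ?case by simp
next
  case (Suc i)
  let ?t = "table G M e b u"
  define a where "a = M * (\<Sum>k<i. x k) + (\<Sum>k<i. y k)"
  define W where "W = (\<Sum>k<i. e k * int (x k) + b k * int (y k))"
  have c: "choice u i x y" using Suc.prems(1) unfolding choice_def by simp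
  have IH: "?t i w \<le> W + ?t 0 (w - a)" if "a \<le> w" for w
    using Suc.IH[OF c] that unfolding a_def W_def by blast
  have w: "a + (M * x i + y i) \<le> w" using Suc.prems(2) unfolding a_def by (simp add: algebra_simps)
  have sums: "M * (\<Sum>k<Suc i. x k) + (\<Sum>k<Suc i. y k) = a + (M * x i + y i)"
    "(\<Sum>k<Suc i. e k * int (x k) + b k * int (y k)) = W + (e i * int (x i) + b i * int (y i))"
    unfolding a_def W_def by (simp_all add: algebra_simps)
  have xy: "x i = 0 \<and> y i \<le> u i \<or> x i = 1 \<and> y i = 0" using Suc.prems(1) unfolding choice_def by auto
  then show ?case
  proof
    assume x: "x i = 0 \<and> y i \<le> u i"
    have "?t (Suc i) w \<le> relax (?t i) (b i) w (Suc (u i))"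
      unfolding table.simps Let_def by (simp del: relax.simps)
    also have "\<dots> \<le> ?t i (w - y i) + int (y i) * b i"
      by (rule relax_le) (use x w in auto)
    also have "?t i (w - y i) \<le> W + ?t 0 (w - y i - a)" by (rule IH) (use x w in auto)
    finally show ?thesis unfolding sums using x by (simp add: algebra_simps)
  next
    assume x: "x i = 1 \<and> y i = 0"
    then have "M \<le> w" using w by simp
    then have "?t (Suc i) w \<le> ?t i (w - M) + e i" by (simp add: Let_def)
    also have "?t i (w - M) \<le> W + ?t 0 (w - M - a)" by (rule IH) (use x w in auto)
    finally show ?thesis unfolding sums using x by (simp add: algebra_simps)
  qed
qed

lemma table_attained:
  "\<exists>x y. choice u i x y \<and> M * (\<Sum>k<i. x k) + (\<Sum>k<i. y k) \<le> w \<and>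
    table G M e b u i w = (\<Sum>k<i. e k * int (x k) + b k * int (y k)) +
      table G M e b u 0 (w - (M * (\<Sum>k<i. x k) + (\<Sum>k<i. y k)))"
proof (induction i arbitrary: w)
  case 0
  then show ?case by (simp add: choice_def)
next
  case (Suc i)
  let ?t = "table G M e b u"
  have extend: ?case if xv: "(xi = 0 \<and> v \<le> u i) \<or> (xi = 1 \<and> v = 0)" and le: "M * xi + v \<le> w"
    and t: "?t (Suc i) w = ?t i (w - (M * xi + v)) + (e i * int xi + b i * int v)" for xi v
  proof -
    obtain x y where xy: "choice u i x y" "M * (\<Sum>k<i. x k) + (\<Sum>k<i. y k) \<le> w - (M * xi + v)"
      "?t i (w - (M * xi + v)) = (\<Sum>k<i. e k * int (x k) + b k * int (y k)) +
        ?t 0 (w - (M * xi + v) - (M * (\<Sum>k<i. x k) + (\<Sum>k<i. y k)))"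
      using Suc.IH[of "w - (M * xi + v)"] by blast
    let ?x = "x(i := xi)" and ?y = "y(i := v)"
    have "choice u (Suc i) ?x ?y" using xy(1) xv unfolding choice_def by (auto simp: less_Suc_eq)
    moreover have "M * (\<Sum>k<Suc i. ?x k) + (\<Sum>k<Suc i. ?y k) =
        (M * xi + v) + (M * (\<Sum>k<i. x k) + (\<Sum>k<i. y k))"
      by (simp add: algebra_simps)
    moreover have "(\<Sum>k<Suc i. e k * int (?x k) + b k * int (?y k)) =
        (\<Sum>k<i. e k * int (x k) + b k * int (y k)) + (e i * int xi + b i * int v)"
      by simp
    moreover have "(M * xi + v) + (M * (\<Sum>k<i. x k) + (\<Sum>k<i. y k)) \<le> w" using xy(2) le by linarith
    ultimately show ?thesis
      unfolding t xy(3) diff_diff_left by (intro exI[of _ ?x] exI[of _ ?y]) (simp only:, simp)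
  qed
  define m where "m = relax (?t i) (b i) w (Suc (u i))"
  have cs: "?t (Suc i) w = m \<or> M \<le> w \<and> ?t (Suc i) w = ?t i (w - M) + e i"
    unfolding m_def by (simp add: Let_def min_def)
  obtain v where v: "v \<le> u i" "v \<le> w" "m = ?t i (w - v) + int v * b i"
    unfolding m_def using relax_attained[of "Suc (u i)" w "?t i" "b i"] by auto
  from cs show ?case
  proof
    assume "?t (Suc i) w = m"
    then show ?case using v by (intro extend[of 0 v]) (auto simp: algebra_simps)
  next
    assume "M \<le> w \<and> ?t (Suc i) w = ?t i (w - M) + e i"
    then show ?case by (intro extend[of 1 0]) auto
  qed
qed

lemma relax_bounds:
  assumes "\<And>w. 0 \<le> g w \<and> g w \<le> G" "b \<ge> 0"
  shows "0 \<le> relax g b w v \<and> relax g b w v \<le> G"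
  using assms by (induction v) (auto simp: min_def)

text \<open>An entry of a new row starts from the old entry in the same column and is only lowered,
  so \<open>G\<close> remains a ceiling through all rows. This is what lets the table entries fit
  into cells.\<close>

lemma table_bounds:
  assumes "G \<ge> 0" "\<And>k. k < i \<Longrightarrow> e k \<ge> 0" "\<And>k. k < i \<Longrightarrow> b k \<ge> 0"
  shows "0 \<le> table G M e b u i w \<and> table G M e b u i w \<le> G"
  using assms
proof (induction i arbitrary: w)
  case (Suc i)
  have IH: "0 \<le> table G M e b u i w \<and> table G M e b u i w \<le> G" for w
    using Suc.IH Suc.prems by simp
  have r: "0 \<le> relax (table G M e b u i) (b i) w v \<and> relax (table G M e b u i) (b i) w v \<le> G" for w v
    by (rule relax_bounds) (use IH Suc.prems in auto)
  have "0 \<le> table G M e b u i (w - M) + e i" using IH[of "w - M"] Suc.prems(2)[of i] by simp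
  with r[of w "Suc (u i)"] show ?case unfolding table.simps Let_def min_def by (simp del: relax.simps)
qed simp

lemma mask_bounds:
  fixes x :: "nat \<Rightarrow> nat"
  assumes "\<And>k. k < n \<Longrightarrow> x k \<le> 1"
  shows "0 \<le> (\<Sum>k<n. 2 ^ k * int (x k))" "(\<Sum>k<n. 2 ^ k * int (x k)) < 2 ^ n"
proof -
  show "0 \<le> (\<Sum>k<n. 2 ^ k * int (x k))" by (simp add: sum_nonneg)
  show "(\<Sum>k<n. 2 ^ k * int (x k)) < 2 ^ n" using assms
  proof (induction n)
    case (Suc n)
    have "2 ^ n * int (x n) \<le> 2 ^ n * 1" using Suc.prems[of n] by (intro mult_left_mono) auto
    moreover have "(\<Sum>k<n. 2 ^ k * int (x k)) < 2 ^ n" using Suc by simp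
    ultimately show ?case unfolding sum.lessThan_Suc power_Suc by linarith
  qed simp
qed

text \<open>In the induction the top bit \<open>x n\<close> moves into the multiple of
  \<open>2 ^ n\<close>, which is why the claim is made for all \<open>q\<close>.\<close>

lemma mask_digit:
  fixes x :: "nat \<Rightarrow> nat"
  assumes "\<And>k. k < n \<Longrightarrow> x k \<le> 1" "i < n"
  shows "(2 ^ n * q + (\<Sum>k<n. 2 ^ k * int (x k))) div 2 ^ i mod 2 = int (x i)"
  using assms
proof (induction n arbitrary: q)
  case (Suc n)
  have eq: "2 ^ Suc n * q + (\<Sum>k<Suc n. 2 ^ k * int (x k)) =
      2 ^ n * (int (x n) + 2 * q) + (\<Sum>k<n. 2 ^ k * int (x k))"
    by (simp add: algebra_simps)
  show ?case
  proof (cases "i = n")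
    case True
    have "(2 ^ n * (int (x n) + 2 * q) + (\<Sum>k<n. 2 ^ k * int (x k))) div 2 ^ n =
        int (x n) + 2 * q + (\<Sum>k<n. 2 ^ k * int (x k)) div 2 ^ n"
      by simp
    also have "(\<Sum>k<n. 2 ^ k * int (x k)) div 2 ^ n = 0"
      using mask_bounds[of n x] Suc.prems by (intro div_pos_pos_trivial) auto
    finally show ?thesis using Suc.prems(1)[of n] unfolding eq True by simp
  next
    case False
    then show ?thesis unfolding eq using Suc by simp
  qed
qed simp

lemma digits_exist:
  fixes a :: "nat \<Rightarrow> nat"
  assumes "\<And>j. j < k \<Longrightarrow> a j < B"
  shows "\<exists>c < B ^ k. \<forall>j<k. c div B ^ j mod B = a j"
  using assms
proof (induction k)
  case (Suc k)
  then obtain c where c: "c < B ^ k" "\<forall>j<k. c div B ^ j mod B = a j" by auto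
  have B: "B > 0" using Suc.prems[of k] by simp
  let ?c = "c + B ^ k * a k"
  have "?c < B ^ k * (a k + 1)" using c(1) by simp
  also have "\<dots> \<le> B ^ k * B" using Suc.prems[of k] by (intro mult_left_mono) auto
  finally have "?c < B ^ Suc k" by (simp add: mult.commute)
  moreover have "?c div B ^ j mod B = a j" if "j < Suc k" for j
  proof (cases "j = k")
    case True
    have "?c div B ^ k = a k" using c(1) B by simp
    then show ?thesis using Suc.prems[of k] True by simp
  next
    case False
    then have j: "j < k" using that by simp
    then have "B ^ k = B ^ j * (B * B ^ (k - Suc j))"
      by (simp flip: power_Suc power_add)
    then have "?c = c + B ^ j * (B * (B ^ (k - Suc j) * a k))" by simp
    moreover have "(c + B ^ j * r) div B ^ j = c div B ^ j + r" for r using B by simp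
    ultimately have "?c div B ^ j = c div B ^ j + B * (B ^ (k - Suc j) * a k)" by (simp only:)
    then show ?thesis using c(2) j by simp
  qed
  ultimately show ?case by blast
qed simp

section \<open>The search over the dual grid with packed integer values\<close>

locale selection_data =
  fixes n p k N :: nat and num den :: "nat \<Rightarrow> int" and inc :: "nat \<Rightarrow> nat \<Rightarrow> nat"
  assumes N: "N \<ge> 1" and p: "p \<le> n"
    and num: "i < 2 * n + k \<Longrightarrow> num i \<ge> 0" and den: "i < 2 * n + k \<Longrightarrow> den i > 0"
    and inc: "inc j i \<le> 1"
begin

definition "M = (n + 1) * (k + 1) * N"
text \<open>A single loop computes this product, and its bit length is at most the total of those of
  the denominators. Each \<open>den i\<close> divides it, so \<open>q i\<close> is the cost
  \<open>num i / den i\<close> times \<open>D\<close>.\<close>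

definition "D = (\<Prod>i<2 * n + k. den i)"
definition "q i = num i * (D div den i)"
definition "S = (\<Sum>i<2 * n + k. q i)"
definition "E = (2 ^ n :: int)"
text \<open>Buying \<open>p\<close> items in the first stage costs at most \<open>int M * S\<close>
  after scaling, and the mask adds less than \<open>E\<close>. So \<open>G\<close> exceeds the
  packed value of an actual solution and can serve as infinity.\<close>

definition "G = E * (int M * S + 1)"
definition "dig c j = c div (M + 1) ^ j mod (M + 1)"
definition "budget_cost c = (\<Sum>j<k. int (dig c j) * q (2 * n + j))"
definition "cap c i = min M (\<Sum>j<k. dig c j * inc j i)"
text \<open>Bit \<open>i\<close> is added exactly when item \<open>i\<close> is bought in the first
  stage; all other amounts are multiples of \<open>E\<close>, above the mask. The factor
  \<open>int M\<close> pays for the \<open>M\<close> units that such a purchase covers.\<close>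

definition "tab c = table G M (\<lambda>i. E * int M * q i + 2 ^ i) (\<lambda>i. E * q (n + i)) (cap c)"
definition "val c = tab c n (p * M) + E * budget_cost c"

primrec best :: "nat \<Rightarrow> int" where
  "best 0 = G"
| "best (Suc c) = min (best c) (val c)"

definition "grid x y \<alpha> \<longleftrightarrow>
  (\<forall>i<n. x i \<le> 1 \<and> y i \<le> M \<and> y i \<le> (\<Sum>j<k. \<alpha> j * inc j i) \<and> (x i = 1 \<longrightarrow> y i = 0)) \<and>
  (\<forall>j<k. \<alpha> j \<le> M) \<and> M * (\<Sum>i<n. x i) + (\<Sum>i<n. y i) = p * M"
  for x y \<alpha> :: "nat \<Rightarrow> nat"

definition "cost x y \<alpha> = int M * (\<Sum>i<n. q i * int (x i)) + (\<Sum>i<n. q (n + i) * int (y i)) +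
  (\<Sum>j<k. q (2 * n + j) * int (\<alpha> j))"
  for x y \<alpha> :: "nat \<Rightarrow> nat"

lemma M_pos: "M > 0"
  unfolding M_def using N by simp

lemma E_pos: "E > 0"
  unfolding E_def by simp

lemma D_pos: "D > 0"
  unfolding D_def using den by (intro prod_pos) auto

lemma q_nonneg: "i < 2 * n + k \<Longrightarrow> q i \<ge> 0"
  unfolding q_def using num den D_pos by (simp add: pos_imp_zdiv_nonneg_iff)

lemma S_nonneg: "S \<ge> 0"
  unfolding S_def using q_nonneg by (intro sum_nonneg) auto

lemma G_pos: "G > 0"
  unfolding G_def using E_pos S_nonneg by (intro mult_pos_pos) (auto simp: add_nonneg_pos)

lemma budget_cost_nonneg: "budget_cost c \<ge> 0"
  unfolding budget_cost_def using q_nonneg by (intro sum_nonneg mult_nonneg_nonneg) auto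

lemma tab_bounds: "i \<le> n \<Longrightarrow> 0 \<le> tab c i w \<and> tab c i w \<le> G"
  unfolding tab_def using G_pos E_pos q_nonneg by (intro table_bounds) auto

lemma dig_le: "dig c j \<le> M"
  unfolding dig_def by (metis Suc_eq_plus1 less_Suc_eq_le mod_less_divisor zero_less_Suc)

lemma packed_cost:
  "(\<Sum>i<n. (E * int M * q i + 2 ^ i) * int (x i) + E * q (n + i) * int (y i)) +
     E * (\<Sum>j<k. int (\<alpha> j) * q (2 * n + j)) =
   E * cost x y \<alpha> + (\<Sum>i<n. 2 ^ i * int (x i))"
  unfolding cost_def by (simp add: algebra_simps sum.distrib sum_distrib_left)

lemma best_le: "c < R \<Longrightarrow> best R \<le> val c"
  by (induction R) (auto simp: less_Suc_eq)

lemma best_attained: "best R = G \<or> (\<exists>c<R. best R = val c)"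
  by (induction R) (auto simp: min_def less_Suc_eq)

lemma best_bounds: "0 \<le> best R \<and> best R \<le> G"
proof (induction R)
  case (Suc R)
  have "val R \<ge> 0" unfolding val_def using tab_bounds[of n R "p * M"] budget_cost_nonneg[of R] E_pos by simp
  with Suc show ?case by (auto simp: min_def)
qed (use G_pos in simp)

text \<open>The counter runs through all digit vectors, so some \<open>c\<close> has the digits
  \<open>\<alpha>\<close>; for this \<open>c\<close> the grid conditions become those of
  \<open>choice\<close> with the capacities \<open>cap c\<close>.\<close>

lemma best_le_cost:
  assumes g: "grid x y \<alpha>"
  shows "best ((M + 1) ^ k) \<le> E * cost x y \<alpha> + (\<Sum>i<n. 2 ^ i * int (x i))"
proof -
  have "\<forall>j<k. \<alpha> j < M + 1" using g unfolding grid_def by auto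
  then obtain c where c: "c < (M + 1) ^ k" "\<forall>j<k. dig c j = \<alpha> j"
    unfolding dig_def using digits_exist[of k \<alpha> "M + 1"] by blast
  have a: "M * (\<Sum>i<n. x i) + (\<Sum>i<n. y i) = p * M" using g unfolding grid_def by blast
  have "choice (cap c) n x y"
    using g c(2) unfolding choice_def cap_def grid_def by (auto simp: le_Suc_eq)
  from table_le[OF this, of M "p * M"] a
  have "tab c n (p * M) \<le> (\<Sum>i<n. (E * int M * q i + 2 ^ i) * int (x i) + E * q (n + i) * int (y i))"
    unfolding tab_def by simp
  moreover have "budget_cost c = (\<Sum>j<k. int (\<alpha> j) * q (2 * n + j))"
    unfolding budget_cost_def using c(2) by simp
  ultimately have "val c \<le> E * cost x y \<alpha> + (\<Sum>i<n. 2 ^ i * int (x i))"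
    unfolding val_def packed_cost[symmetric] by simp
  with best_le[OF c(1)] show ?thesis by simp
qed

lemma best_less: "best ((M + 1) ^ k) < G"
proof -
  \<comment> \<open>The solution behind the choice of \<open>G\<close>: the first \<open>p\<close>
    items bought at once, no recourse, zero dual variables.\<close>
  let ?x = "\<lambda>i. of_bool (i < p) :: nat" and ?o = "\<lambda>_. 0 :: nat"
  have "(\<Sum>i<n. ?x i) = p"
  proof -
    have "(\<Sum>i<n. ?x i) = (\<Sum>i<p. 1)" by (rule sum.mono_neutral_cong_right) (use p in auto)
    then show ?thesis by simp
  qed
  then have "grid ?x ?o ?o" unfolding grid_def by (simp add: mult.commute)
  from best_le_cost[OF this]
  have "best ((M + 1) ^ k) \<le> E * cost ?x ?o ?o + (\<Sum>i<n. 2 ^ i * int (?x i))" .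
  also have "\<dots> < E * cost ?x ?o ?o + E"
    using mask_bounds(2)[of n ?x] unfolding E_def by simp
  also have "cost ?x ?o ?o \<le> int M * S"
  proof -
    have "(\<Sum>i<n. q i * int (?x i)) \<le> (\<Sum>i<n. q i)"
      using q_nonneg by (intro sum_mono) (auto simp: of_bool_def)
    also have "\<dots> \<le> S" unfolding S_def using q_nonneg by (intro sum_mono2) auto
    finally show ?thesis unfolding cost_def by (simp add: mult_left_mono)
  qed
  then have "E * cost ?x ?o ?o + E \<le> G"
    unfolding G_def using E_pos by (simp add: distrib_left mult_left_mono)
  finally show ?thesis .
qed

text \<open>A value below \<open>G\<close> leaves no uncovered rest, so the optimum comes from a
  grid point. Masks lie between 0 and \<open>E - 1\<close>, hence comparing packed values compares
  the integer costs first, and the mask merely breaks ties.\<close>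

lemma best_packed:
  obtains x y \<alpha> where "grid x y \<alpha>" "\<And>i. i \<ge> n \<Longrightarrow> x i = 0"
    "best ((M + 1) ^ k) = E * cost x y \<alpha> + (\<Sum>i<n. 2 ^ i * int (x i))"
    "\<And>x' y' \<alpha>'. grid x' y' \<alpha>' \<Longrightarrow> cost x y \<alpha> \<le> cost x' y' \<alpha>'"
proof -
  let ?R = "(M + 1) ^ k"
  obtain c where c: "c < ?R" "best ?R = val c" using best_attained[of ?R] best_less by auto
  obtain x0 y where xy: "choice (cap c) n x0 y" "M * (\<Sum>i<n. x0 i) + (\<Sum>i<n. y i) \<le> p * M"
    and t: "tab c n (p * M) = (\<Sum>i<n. (E * int M * q i + 2 ^ i) * int (x0 i) + E * q (n + i) * int (y i)) +
      (if p * M - (M * (\<Sum>i<n. x0 i) + (\<Sum>i<n. y i)) = 0 then 0 else G)"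
    using table_attained[of "cap c" n M "p * M" G "\<lambda>i. E * int M * q i + 2 ^ i" "\<lambda>i. E * q (n + i)"]
    unfolding tab_def by auto
  \<comment> \<open>\<open>choice\<close> says nothing beyond \<open>n\<close>, whereas a binary
    vector must vanish there.\<close>
  define x where "x i = (if i < n then x0 i else 0)" for i
  have sx: "(\<Sum>i<n. x i) = (\<Sum>i<n. x0 i)" unfolding x_def by simp
  have "(\<Sum>i<n. (E * int M * q i + 2 ^ i) * int (x0 i) + E * q (n + i) * int (y i)) \<ge> 0"
    using E_pos q_nonneg by (intro sum_nonneg) auto
  moreover have "tab c n (p * M) < G"
    using c(2) best_less budget_cost_nonneg[of c] E_pos unfolding val_def by (smt (verit) mult_nonneg_nonneg)
  ultimately have full: "M * (\<Sum>i<n. x0 i) + (\<Sum>i<n. y i) = p * M"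
    using t xy(2) by (auto split: if_splits)
  have g: "grid x y (dig c)"
    unfolding grid_def sx using xy(1) full dig_le unfolding choice_def cap_def x_def by auto
  have "val c = E * cost x0 y (dig c) + (\<Sum>i<n. 2 ^ i * int (x0 i))"
    unfolding val_def packed_cost[symmetric] t using full by (simp add: budget_cost_def)
  also have "\<dots> = E * cost x y (dig c) + (\<Sum>i<n. 2 ^ i * int (x i))"
    unfolding cost_def x_def by simp
  finally have b: "best ?R = E * cost x y (dig c) + (\<Sum>i<n. 2 ^ i * int (x i))" using c(2) by simp
  show ?thesis
  proof (rule that[OF g _ b])
    fix x' y' \<alpha>' assume g': "grid x' y' \<alpha>'"
    have "(\<Sum>i<n. 2 ^ i * int (x' i)) < E"
      unfolding E_def by (rule mask_bounds(2)) (use g' in \<open>auto simp: grid_def\<close>)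
    moreover have "(\<Sum>i<n. 2 ^ i * int (x i)) \<ge> 0" by (rule sum_nonneg) simp
    ultimately have "E * cost x y (dig c) < E * (cost x' y' \<alpha>' + 1)"
      using best_le_cost[OF g'] unfolding b by (simp add: distrib_left)
    then show "cost x y (dig c) \<le> cost x' y' \<alpha>'" using E_pos by simp
  qed (simp add: x_def)
qed

end

text \<open>A frame condition: names outside \<open>A\<close> keep their whole array. Loop
  invariants carry it along, so whatever a loop does not write is recovered with
  \<open>same_get\<close>.\<close>

definition same :: "name set \<Rightarrow> state \<Rightarrow> state \<Rightarrow> bool" where
  "same A s s' \<longleftrightarrow> (\<forall>a. a \<notin> A \<longrightarrow> s' a = s a)"

lemma same_refl [simp]: "same A s s"
  unfolding same_def by simp

lemma same_update [simp]: "a \<in> A \<Longrightarrow> same A s (s'(a := v)) = same A s s'"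
  unfolding same_def by auto

lemma same_update_left [simp]: "a \<in> A \<Longrightarrow> same A (s(a := v)) s' = same A s s'"
  unfolding same_def by (metis fun_upd_other)

lemma same_get: "same A s s' \<Longrightarrow> a \<notin> A \<Longrightarrow> s' a = s a"
  unfolding same_def by blast

lemma same_trans: "same A s s' \<Longrightarrow> same B s' s'' \<Longrightarrow> A \<subseteq> C \<Longrightarrow> B \<subseteq> C \<Longrightarrow> same C s s''"
  unfolding same_def by (metis subsetD)

lemma runs_Store_Seq:
  assumes "\<bar>aval f s\<bar> \<le> cell_bound L" "runs L d (s(a := (s a)(aval e s := aval f s))) T Q"
  shows "runs L (Seq (Store a e f) d) s (1 + T) Q"
  by (rule runs_Seq[where P = "\<lambda>s'. s' = s(a := (s a)(aval e s := aval f s))", OF runs_Store])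
    (use assms in auto)

section \<open>The program\<close>

text \<open>
  Cells: \<open>W = p M\<close> is the demand and \<open>D\<close> a common denominator; \<open>q\<close> holds the \<open>m = 2 n + k\<close> costs
  multiplied by \<open>D\<close> (first-stage costs, base costs, budgets), \<open>S\<close> their sum; \<open>E = 2 ^ n\<close>;
  \<open>R = (M + 1) ^ k\<close> counts the grid vectors; \<open>G\<close> exceeds the cost of some solution.  The digits of
  the counter \<open>c\<close> in base \<open>M + 1\<close> are stored in \<open>a\<close>, the cost of the budgets in \<open>g\<close>, the row of the
  knapsack table in \<open>f\<close>, the capacity of the current item in \<open>u\<close>, and the best value in \<open>b\<close>.
\<close>

definition setup_prog :: com where
  "setup_prog =
    Seq (Assign ''n'' (Elem ''in'' (Const 1)))
    (Seq (Assign ''p'' (Elem ''in'' (Const 2)))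
    (Seq (Assign ''k'' (Elem ''in'' (Const 3)))
    (Seq (Assign ''m'' (Plus (Times (Const 2) (Var ''n'')) (Var ''k'')))
    (Seq (Assign ''M'' (Times (Times (Plus (Var ''n'') (Const 1)) (Plus (Var ''k'') (Const 1)))
      (Elem ''in'' (Const 0))))
    (Assign ''W'' (Times (Var ''p'') (Var ''M'')))))))"

text \<open>The accuracy, \<open>n\<close>, \<open>p\<close> and \<open>k\<close> occupy the input
  cells 0 to 3; behind them numerator \<open>i\<close> is in cell \<open>4 + 2 * i\<close> and
  denominator \<open>i\<close> in cell \<open>5 + 2 * i\<close>.\<close>

definition denominator_prog :: com where
  "denominator_prog =
    Seq (Assign ''D'' (Const 1))
    (For ''i'' (Var ''m'') (Assign ''D'' (Times (Var ''D'')
      (Elem ''in'' (Plus (Const 5) (Times (Const 2) (Var ''i'')))))))"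

definition cost_prog :: com where
  "cost_prog =
    Seq (Assign ''S'' (Const 0))
    (For ''i'' (Var ''m'')
      (Seq (Store ''q'' (Var ''i'') (Times (Elem ''in'' (Plus (Const 4) (Times (Const 2) (Var ''i''))))
        (Div (Var ''D'') (Elem ''in'' (Plus (Const 5) (Times (Const 2) (Var ''i'')))))))
      (Assign ''S'' (Plus (Var ''S'') (Elem ''q'' (Var ''i''))))))"

definition power_prog :: com where
  "power_prog =
    Seq (Assign ''E'' (Const 1))
    (Seq (For ''i'' (Var ''n'') (Assign ''E'' (Plus (Var ''E'') (Var ''E''))))
    (Seq (Assign ''R'' (Const 1))
    (Seq (For ''j'' (Var ''k'') (Assign ''R'' (Times (Var ''R'') (Plus (Var ''M'') (Const 1)))))
    (Seq (Assign ''G'' (Times (Var ''E'') (Plus (Times (Var ''M'') (Var ''S'')) (Const 1))))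
    (Assign ''b'' (Var ''G''))))))"

text \<open>The remainder modulo \<open>M + 1\<close> has to be expressed by division,
  multiplication and subtraction.\<close>

definition digit_prog :: com where
  "digit_prog =
    Seq (Assign ''t'' (Var ''c''))
    (Seq (Assign ''g'' (Const 0))
    (For ''j'' (Var ''k'')
      (Seq (Store ''a'' (Var ''j'') (Minus (Var ''t'')
        (Times (Div (Var ''t'') (Plus (Var ''M'') (Const 1))) (Plus (Var ''M'') (Const 1)))))
      (Seq (Assign ''t'' (Div (Var ''t'') (Plus (Var ''M'') (Const 1))))
      (Assign ''g'' (Plus (Var ''g'') (Times (Elem ''a'' (Var ''j''))
        (Elem ''q'' (Plus (Times (Const 2) (Var ''n'')) (Var ''j''))))))))))"

definition reset_prog :: com where
  "reset_prog =
    Seq (For ''w'' (Plus (Var ''W'') (Const 1)) (Store ''f'' (Var ''w'') (Var ''G'')))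
    (Store ''f'' (Const 0) (Const 0))"

text \<open>The incidence matrix begins at input cell \<open>4 + 2 * m\<close> and is stored in rows
  of length \<open>n\<close>, one for each budget set.\<close>

definition cap_prog :: com where
  "cap_prog =
    Seq (Assign ''u'' (Const 0))
    (Seq (For ''j'' (Var ''k'') (Assign ''u'' (Plus (Var ''u'') (Times (Elem ''a'' (Var ''j''))
      (Elem ''in'' (Plus (Plus (Const 4) (Times (Const 2) (Var ''m'')))
        (Plus (Times (Var ''j'') (Var ''n'')) (Var ''i''))))))))
    (Cond (Less (Var ''M'') (Var ''u'')) (Assign ''u'' (Var ''M'')) Skip))"

text \<open>\<open>And\<close> is charged for both operands, so for \<open>w < x\<close> the cell
  with the negative index \<open>w - x\<close> is read. Its content does not matter, since the first
  operand already makes the guard false.\<close>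

definition lower_prog :: "aexp \<Rightarrow> aexp \<Rightarrow> com" where
  "lower_prog x e =
    Cond (And (Less x (Plus (Var ''w'') (Const 1)))
        (Less (Plus (Elem ''f'' (Minus (Var ''w'') x)) e) (Elem ''f'' (Var ''w''))))
      (Store ''f'' (Var ''w'') (Plus (Elem ''f'' (Minus (Var ''w'') x)) e)) Skip"

definition relax_prog :: com where
  "relax_prog =
    For ''v'' (Plus (Var ''u'') (Const 1))
      (lower_prog (Var ''v'') (Times (Var ''v'')
        (Times (Var ''E'') (Elem ''q'' (Plus (Var ''n'') (Var ''i''))))))"

definition cell_prog :: com where
  "cell_prog = Seq relax_prog (lower_prog (Var ''M'')
    (Plus (Times (Times (Var ''E'') (Var ''M'')) (Elem ''q'' (Var ''i''))) (Var ''P'')))"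

text \<open>The row of item \<open>i\<close> overwrites the row before it from right to left.\<close>

definition row_prog :: com where
  "row_prog =
    Seq (Assign ''w'' (Var ''W''))
    (For ''r'' (Plus (Var ''W'') (Const 1))
      (Seq cell_prog (Assign ''w'' (Minus (Var ''w'') (Const 1)))))"

definition table_prog :: com where
  "table_prog =
    Seq (Assign ''P'' (Const 1))
    (For ''i'' (Var ''n'')
      (Seq cap_prog (Seq row_prog (Assign ''P'' (Plus (Var ''P'') (Var ''P''))))))"

definition update_prog :: com where
  "update_prog =
    Cond (Less (Plus (Elem ''f'' (Var ''W'')) (Times (Var ''E'') (Var ''g''))) (Var ''b''))
      (Assign ''b'' (Plus (Elem ''f'' (Var ''W'')) (Times (Var ''E'') (Var ''g'')))) Skip"

definition search_prog :: com where
  "search_prog =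
    For ''c'' (Var ''R'') (Seq digit_prog (Seq reset_prog (Seq table_prog update_prog)))"

definition output_prog :: com where
  "output_prog =
    For ''i'' (Var ''n'')
      (Seq (Store ''out'' (Var ''i'') (Minus (Var ''b'') (Times (Div (Var ''b'') (Const 2)) (Const 2))))
      (Assign ''b'' (Div (Var ''b'') (Const 2))))"

definition selection_prog :: com where
  "selection_prog =
    Seq setup_prog (Seq denominator_prog (Seq cost_prog (Seq power_prog (Seq search_prog output_prog))))"

text \<open>Each bound belongs to one kind of cell content: \<open>D\<close> to the partial
  denominators, \<open>G\<close> to costs and table entries, \<open>(M + 1) ^ k\<close> to the
  counter and its limit, \<open>p M + 1\<close> to the column loop, \<open>(k + 1) (M + 1)\<close>
  to capacities before they are cut at \<open>M\<close>, and the last one to \<open>n\<close>,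
  \<open>p\<close>, \<open>k\<close> and \<open>m\<close>.\<close>

locale selection_run = selection_data +
  fixes L :: nat
  assumes bounds: "D \<le> cell_bound L" "G \<le> cell_bound L" "int ((M + 1) ^ k) \<le> cell_bound L" "int p * int M + 1 \<le> cell_bound L"
    "(int k + 1) * (int M + 1) \<le> cell_bound L" "2 * int n + int k + 1 \<le> cell_bound L"
begin

definition input :: "state \<Rightarrow> bool" where
  "input s \<longleftrightarrow> s ''in'' 0 = int N \<and> s ''in'' 1 = int n \<and> s ''in'' 2 = int p \<and> s ''in'' 3 = int k \<and>
    (\<forall>i<2 * n + k. s ''in'' (4 + 2 * int i) = num i \<and> s ''in'' (5 + 2 * int i) = den i) \<and>
    (\<forall>j<k. \<forall>i<n. s ''in'' (4 + 2 * int (2 * n + k) + (int j * int n + int i)) = int (inc j i))"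

text \<open>\<open>env\<close> holds after \<open>setup_prog\<close>, and \<open>env'\<close> after
  all preprocessing. Both mention only names that later code does not write, so frame conditions
  preserve them.\<close>

definition env :: "state \<Rightarrow> bool" where
  "env s \<longleftrightarrow> input s \<and> s ''n'' 0 = int n \<and> s ''p'' 0 = int p \<and> s ''k'' 0 = int k \<and>
    s ''m'' 0 = int (2 * n + k) \<and> s ''M'' 0 = int M \<and> s ''W'' 0 = int (p * M)"

definition env' :: "state \<Rightarrow> bool" where
  "env' s \<longleftrightarrow> env s \<and> (\<forall>i<2 * n + k. s ''q'' (int i) = q i) \<and> s ''E'' 0 = E \<and> s ''G'' 0 = G \<and>
    s ''R'' 0 = int ((M + 1) ^ k)"

section \<open>Correctness and step counts of the parts of the program\<close>

lemma env_same:
  assumes "env s" "same A s s'" "\<forall>a\<in>{''in'', ''n'', ''p'', ''k'', ''m'', ''M'', ''W''}. a \<notin> A"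
  shows "env s'"
proof -
  have "s' ''in'' = s ''in''" "s' ''n'' = s ''n''" "s' ''p'' = s ''p''" "s' ''k'' = s ''k''"
    "s' ''m'' = s ''m''" "s' ''M'' = s ''M''" "s' ''W'' = s ''W''"
    by (rule same_get[OF assms(2)]; use assms(3) in simp)+
  then show ?thesis using assms(1) unfolding env_def input_def by simp
qed

lemma env'_same:
  assumes "env' s" "same A s s'"
    "\<forall>a\<in>{''in'', ''n'', ''p'', ''k'', ''m'', ''M'', ''W'', ''q'', ''E'', ''G'', ''R''}. a \<notin> A"
  shows "env' s'"
proof -
  have "env s'" by (rule env_same[OF _ assms(2)]) (use assms(1,3) in \<open>simp_all add: env'_def\<close>)
  moreover have "s' ''q'' = s ''q''" "s' ''E'' = s ''E''" "s' ''G'' = s ''G''" "s' ''R'' = s ''R''"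
    by (rule same_get[OF assms(2)]; use assms(3) in simp)+
  ultimately show ?thesis using assms(1) unfolding env'_def by simp
qed

lemma M_bound: "int M + 1 \<le> cell_bound L"
proof -
  have "1 * (int M + 1) \<le> (int k + 1) * (int M + 1)" by (rule mult_right_mono) auto
  from order_trans[OF this bounds(5)] show ?thesis by simp
qed

lemma nk_bound: "int n \<le> cell_bound L" "int k \<le> cell_bound L" "int p \<le> cell_bound L" "int (2 * n + k) \<le> cell_bound L" "1 \<le> cell_bound L"
  using bounds(6) p by auto

lemma MS_le: "E \<le> G" "int M * S \<le> G"
proof -
  have MS: "int M * S \<ge> 0" using S_nonneg by simp
  have "E * 1 \<le> E * (int M * S + 1)" "1 * (int M * S + 1) \<le> E * (int M * S + 1)"
    using E_pos MS by (intro mult_mono; simp)+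
  then show "E \<le> G" "int M * S \<le> G" unfolding G_def by auto
qed

lemma S_le: "S \<le> G"
proof -
  have "1 * S \<le> int M * S" using M_pos S_nonneg by (intro mult_right_mono) auto
  then show ?thesis using MS_le by simp
qed

lemma q_le: "i < 2 * n + k \<Longrightarrow> q i \<le> S"
  unfolding S_def using q_nonneg by (intro member_le_sum) auto

lemma run_setup:
  assumes "input s"
  shows "runs L setup_prog s 6 env"
proof -
  have 1: "int p * int M \<le> cell_bound L" "int M \<le> cell_bound L"
    using bounds M_bound by auto
  have M': "(1 + int n) * (1 + int k) * int N = int M" unfolding M_def by (simp add: algebra_simps)
  have "runs L setup_prog s (1 + (1 + (1 + (1 + (1 + 1))))) env"
    unfolding setup_prog_def
    by (intro runs_Store_Seq runs_Store)
      (use assms 1 nk_bound M' in \<open>simp_all add: input_def env_def add.commute\<close>)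
  then show ?thesis by (rule runs_weaken) simp_all
qed

lemma run_denominator:
  assumes "env s"
  shows "runs L denominator_prog s (1 + ((2 * n + k) * (1 + 2) + 2))
    (\<lambda>s'. same {''D'', ''i''} s s' \<and> s' ''D'' 0 = D)"
  unfolding denominator_prog_def
proof (rule runs_Store_Seq)
  show "\<bar>aval (Const 1) s\<bar> \<le> cell_bound L" using nk_bound by simp
  let ?I = "\<lambda>i s'. same {''D'', ''i''} s s' \<and> s' ''D'' 0 = (\<Prod>j<i. den j)"
  let ?s = "s(''D'' := (s ''D'')(aval (Const 0) s := aval (Const 1) s))"
  show "runs L (For ''i'' (Var ''m'') (Assign ''D'' (Times (Var ''D'')
      (Elem ''in'' (Plus (Const 5) (Times (Const 2) (Var ''i''))))))) ?s ((2 * n + k) * (1 + 2) + 2)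
    (\<lambda>s'. same {''D'', ''i''} s s' \<and> s' ''D'' 0 = D)"
  proof (rule runs_For[where I = ?I])
    fix i s' assume I: "?I i s'"
    then have "env s'" by (intro env_same[OF assms, where A = "{''D'', ''i''}"]) simp_all
    then show "aval (Var ''m'') s' = int (2 * n + k)" by (simp add: env_def)
  next
    fix i s' assume I: "?I i s'" and i: "i < 2 * n + k" "s' ''i'' 0 = int i"
    from I have "env s'" by (intro env_same[OF assms, where A = "{''D'', ''i''}"]) simp_all
    then have d: "s' ''in'' (5 + 2 * int i) = den i" using i by (simp add: env_def input_def)
    \<comment> \<open>All denominators are at least 1, so no partial product exceeds
      \<open>D\<close>.\<close>
    have "(\<Prod>j<Suc i. den j) \<le> (\<Prod>j<2 * n + k. den j)"
      using i den by (intro prod_mono2) (auto simp: int_one_le_iff_zero_less less_imp_le)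
    then have "(\<Prod>j<i. den j) * den i \<le> cell_bound L" using bounds(1) unfolding D_def by simp
    moreover have "(\<Prod>j<Suc i. den j) > 0" using i den by (intro prod_pos) auto
    ultimately have b: "\<bar>(\<Prod>j<i. den j) * den i\<bar> \<le> cell_bound L" by simp
    show "runs L (Assign ''D'' (Times (Var ''D'') (Elem ''in'' (Plus (Const 5) (Times (Const 2) (Var ''i''))))))
        s' 1 (\<lambda>s''. s'' ''i'' 0 = int i \<and> ?I (Suc i) (s''(''i'' := (s'' ''i'')(0 := int (Suc i)))))"
      by (rule runs_Store) (use I i d b in simp_all)
  qed (use nk_bound in \<open>simp_all add: D_def\<close>)
qed

lemma run_cost:
  assumes "env s" "s ''D'' 0 = D"
  shows "runs L cost_prog s (1 + ((2 * n + k) * ((1 + 1) + 2) + 2))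
    (\<lambda>s'. same {''S'', ''q'', ''i''} s s' \<and> s' ''S'' 0 = S \<and> (\<forall>i<2 * n + k. s' ''q'' (int i) = q i))"
  unfolding cost_prog_def
proof (rule runs_Store_Seq)
  show "\<bar>aval (Const 0) s\<bar> \<le> cell_bound L" using nk_bound by simp
  let ?A = "{''S'', ''q'', ''i''}"
  let ?I = "\<lambda>i s'. same ?A s s' \<and> s' ''S'' 0 = (\<Sum>j<i. q j) \<and> (\<forall>j<i. s' ''q'' (int j) = q j)"
  let ?s = "s(''S'' := (s ''S'')(aval (Const 0) s := aval (Const 0) s))"
  let ?f = "Times (Elem ''in'' (Plus (Const 4) (Times (Const 2) (Var ''i''))))
        (Div (Var ''D'') (Elem ''in'' (Plus (Const 5) (Times (Const 2) (Var ''i'')))))"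
  show "runs L (For ''i'' (Var ''m'')
      (Seq (Store ''q'' (Var ''i'') ?f)
      (Assign ''S'' (Plus (Var ''S'') (Elem ''q'' (Var ''i'')))))) ?s ((2 * n + k) * ((1 + 1) + 2) + 2)
    (\<lambda>s'. same ?A s s' \<and> s' ''S'' 0 = S \<and> (\<forall>i<2 * n + k. s' ''q'' (int i) = q i))"
  proof (rule runs_For[where I = ?I])
    fix i s' assume I: "?I i s'"
    then have "env s'" by (intro env_same[OF assms(1), where A = ?A]) simp_all
    then show "aval (Var ''m'') s' = int (2 * n + k)" by (simp add: env_def)
  next
    fix i s' assume I: "?I i s'" and i: "i < 2 * n + k" "s' ''i'' 0 = int i"
    from I have "env s'" by (intro env_same[OF assms(1), where A = ?A]) simp_all
    then have d: "s' ''in'' (5 + 2 * int i) = den i" "s' ''in'' (4 + 2 * int i) = num i"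
      using i by (simp_all add: env_def input_def)
    have "s' ''D'' = s ''D''" using I by (intro same_get[of ?A]) simp_all
    then have q: "aval ?f s' = q i" using d i(2) assms(2) by (simp add: q_def)
    have b1: "\<bar>q i\<bar> \<le> cell_bound L" using q_nonneg[OF i(1)] q_le[OF i(1)] S_le bounds(2) by simp
    have "(\<Sum>j<Suc i. q j) \<le> S"
      unfolding S_def using i q_nonneg by (intro sum_mono2) auto
    moreover have "(\<Sum>j<Suc i. q j) \<ge> 0" using i q_nonneg by (intro sum_nonneg) auto
    ultimately have b2: "\<bar>(\<Sum>j<i. q j) + q i\<bar> \<le> cell_bound L" using S_le bounds(2) by simp
    show "runs L (Seq (Store ''q'' (Var ''i'') ?f) (Assign ''S'' (Plus (Var ''S'') (Elem ''q'' (Var ''i'')))))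
        s' (1 + 1) (\<lambda>s''. s'' ''i'' 0 = int i \<and> ?I (Suc i) (s''(''i'' := (s'' ''i'')(0 := int (Suc i)))))"
    proof (intro runs_Store_Seq runs_Store)
      show "\<bar>aval ?f s'\<bar> \<le> cell_bound L" unfolding q by (rule b1)
    qed (unfold q, use I i b2 in \<open>auto simp: less_Suc_eq\<close>)
  qed (use nk_bound in \<open>simp_all add: S_def\<close>)
qed

end

lemma sum_lessThan_add:
  fixes g :: "nat \<Rightarrow> 'a::comm_monoid_add"
  shows "(\<Sum>i<a + b. g i) = (\<Sum>i<a. g i) + (\<Sum>i<b. g (a + i))"
  by (induction b) (simp_all add: add.assoc)

context selection_run
begin

lemma pow2_le: "i \<le> n \<Longrightarrow> (2::int) ^ i \<le> cell_bound L"
proof -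
  assume "i \<le> n"
  then have "(2::int) ^ i \<le> E" unfolding E_def by (intro power_increasing) auto
  then show ?thesis using MS_le(1) bounds(2) by linarith
qed

lemma run_pow2:
  assumes "env s" "s ''E'' 0 = 1"
  shows "runs L (For ''i'' (Var ''n'') (Assign ''E'' (Plus (Var ''E'') (Var ''E'')))) s (n * (1 + 2) + 2)
    (\<lambda>s'. same {''E'', ''i''} s s' \<and> s' ''E'' 0 = E)"
proof (rule runs_For[where I = "\<lambda>i s'. same {''E'', ''i''} s s' \<and> s' ''E'' 0 = 2 ^ i"])
  let ?I = "\<lambda>i s'. same {''E'', ''i''} s s' \<and> s' ''E'' 0 = 2 ^ i"
  fix i s' assume I: "?I i s'"
  then have "env s'" by (intro env_same[OF assms(1), where A = "{''E'', ''i''}"]) simp_all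
  then show "aval (Var ''n'') s' = int n" by (simp add: env_def)
next
  let ?I = "\<lambda>i s'. same {''E'', ''i''} s s' \<and> s' ''E'' 0 = 2 ^ i"
  fix i s' assume I: "?I i s'" and i: "i < n" "s' ''i'' 0 = int i"
  show "runs L (Assign ''E'' (Plus (Var ''E'') (Var ''E''))) s' 1
      (\<lambda>s''. s'' ''i'' 0 = int i \<and> ?I (Suc i) (s''(''i'' := (s'' ''i'')(0 := int (Suc i)))))"
    by (rule runs_Store) (use I i pow2_le[of "Suc i"] in simp_all)
qed (use assms nk_bound in \<open>simp_all add: E_def\<close>)

lemma run_combinations:
  assumes "env s" "s ''R'' 0 = 1"
  shows "runs L (For ''j'' (Var ''k'') (Assign ''R'' (Times (Var ''R'') (Plus (Var ''M'') (Const 1))))) s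
    (k * (1 + 2) + 2) (\<lambda>s'. same {''R'', ''j''} s s' \<and> s' ''R'' 0 = int ((M + 1) ^ k))"
proof (rule runs_For[where I = "\<lambda>j s'. same {''R'', ''j''} s s' \<and> s' ''R'' 0 = (int M + 1) ^ j"])
  let ?I = "\<lambda>j s'. same {''R'', ''j''} s s' \<and> s' ''R'' 0 = (int M + 1) ^ j"
  fix i s' assume I: "?I i s'"
  then have "env s'" by (intro env_same[OF assms(1), where A = "{''R'', ''j''}"]) simp_all
  then show "aval (Var ''k'') s' = int k" by (simp add: env_def)
next
  let ?I = "\<lambda>j s'. same {''R'', ''j''} s s' \<and> s' ''R'' 0 = (int M + 1) ^ j"
  fix j s' assume I: "?I j s'" and j: "j < k" "s' ''j'' 0 = int j"
  from I have "env s'" by (intro env_same[OF assms(1), where A = "{''R'', ''j''}"]) simp_all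
  then have M: "s' ''M'' 0 = int M" by (simp add: env_def)
  have "(int M + 1) ^ Suc j \<le> (int M + 1) ^ k" using j by (intro power_increasing) auto
  also have "\<dots> \<le> cell_bound L" using bounds(3) by (simp add: add.commute)
  finally have "(int M + 1) ^ Suc j \<le> cell_bound L" .
  then have "\<bar>(int M + 1) ^ j * (int M + 1)\<bar> \<le> cell_bound L" by (simp add: mult.commute)
  then show "runs L (Assign ''R'' (Times (Var ''R'') (Plus (Var ''M'') (Const 1)))) s' 1
      (\<lambda>s''. s'' ''j'' 0 = int j \<and> ?I (Suc j) (s''(''j'' := (s'' ''j'')(0 := int (Suc j)))))"
    by (intro runs_Store) (use I j M in \<open>simp_all add: mult.commute\<close>)
qed (use assms nk_bound in \<open>simp_all add: add.commute\<close>)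

lemma run_power:
  assumes "env s" "s ''S'' 0 = S"
  shows "runs L power_prog s (1 + ((n * (1 + 2) + 2) + (1 + ((k * (1 + 2) + 2) + (1 + 1)))))
    (\<lambda>s'. same {''E'', ''i'', ''R'', ''j'', ''G'', ''b''} s s' \<and> s' ''E'' 0 = E \<and>
      s' ''R'' 0 = int ((M + 1) ^ k) \<and> s' ''G'' 0 = G \<and> s' ''b'' 0 = G)"
    (is "runs L _ s _ ?Q")
  unfolding power_prog_def
proof (rule runs_Store_Seq)
  let ?s1 = "s(''E'' := (s ''E'')(aval (Const 0) s := aval (Const 1) s))"
  show "\<bar>aval (Const 1) s\<bar> \<le> cell_bound L" using nk_bound by simp
  have e1: "env ?s1" by (rule env_same[OF assms(1), where A = "{''E''}"]) simp_all
  show "runs L (Seq (For ''i'' (Var ''n'') (Assign ''E'' (Plus (Var ''E'') (Var ''E''))))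
    (Seq (Assign ''R'' (Const 1))
    (Seq (For ''j'' (Var ''k'') (Assign ''R'' (Times (Var ''R'') (Plus (Var ''M'') (Const 1)))))
    (Seq (Assign ''G'' (Times (Var ''E'') (Plus (Times (Var ''M'') (Var ''S'')) (Const 1))))
    (Assign ''b'' (Var ''G'')))))) ?s1 ((n * (1 + 2) + 2) + (1 + ((k * (1 + 2) + 2) + (1 + 1)))) ?Q"
  proof (rule runs_Seq[OF run_pow2[OF e1]])
    fix s' assume s': "same {''E'', ''i''} ?s1 s' \<and> s' ''E'' 0 = E"
    let ?s2 = "s'(''R'' := (s' ''R'')(aval (Const 0) s' := aval (Const 1) s'))"
    have "env s'" using s' by (intro env_same[OF e1, where A = "{''E'', ''i''}"]) simp_all
    then have e2: "env ?s2" by (rule env_same[where A = "{''R''}"]) simp_all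
    show "runs L (Seq (Assign ''R'' (Const 1))
      (Seq (For ''j'' (Var ''k'') (Assign ''R'' (Times (Var ''R'') (Plus (Var ''M'') (Const 1)))))
      (Seq (Assign ''G'' (Times (Var ''E'') (Plus (Times (Var ''M'') (Var ''S'')) (Const 1))))
      (Assign ''b'' (Var ''G''))))) s' (1 + ((k * (1 + 2) + 2) + (1 + 1))) ?Q"
    proof (rule runs_Store_Seq[rotated], rule runs_Seq[OF run_combinations[OF e2]])
      fix s'' assume s'': "same {''R'', ''j''} ?s2 s'' \<and> s'' ''R'' 0 = int ((M + 1) ^ k)"
      have "env s''" using s'' by (intro env_same[OF e2, where A = "{''R'', ''j''}"]) simp_all
      then have M: "s'' ''M'' 0 = int M" by (simp add: env_def)
      have S: "s'' ''S'' 0 = S" and E: "s'' ''E'' 0 = E"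
        using s' s'' same_get[of "{''R'', ''j''}" ?s2 s'' "''S''"] same_get[of "{''R'', ''j''}" ?s2 s'' "''E''"]
          same_get[of "{''E'', ''i''}" ?s1 s' "''S''"] assms(2) by simp_all
      have "same {''E'', ''i'', ''R'', ''j''} s s''"
        by (rule same_trans[of "{''E'', ''i''}" s s' "{''R'', ''j''}"]) (use s' s'' in simp_all)
      then have sm: "same {''E'', ''i'', ''R'', ''j'', ''G'', ''b''} s s''"
        by (rule same_trans[of _ s s'' "{}" s'']) simp_all
      have Gb: "\<bar>E * (int M * S + 1)\<bar> \<le> cell_bound L" using G_pos bounds(2) unfolding G_def by simp
      show "runs L (Seq (Assign ''G'' (Times (Var ''E'') (Plus (Times (Var ''M'') (Var ''S'')) (Const 1))))
          (Assign ''b'' (Var ''G''))) s'' (1 + 1) ?Q"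
        by (intro runs_Store_Seq runs_Store) (use Gb sm s'' E M S in \<open>simp_all add: G_def\<close>)
    qed (use nk_bound in simp_all)
  qed simp
qed

lemma budget_sum_le:
  assumes "j \<le> k"
  shows "(\<Sum>i<j. int (dig c i) * q (2 * n + i)) \<le> G"
proof -
  have "(\<Sum>i<j. int (dig c i) * q (2 * n + i)) \<le> (\<Sum>i<k. int (dig c i) * q (2 * n + i))"
    using assms q_nonneg by (intro sum_mono2) auto
  also have "\<dots> \<le> (\<Sum>i<k. int M * q (2 * n + i))"
    using dig_le q_nonneg by (intro sum_mono mult_right_mono) auto
  also have "\<dots> \<le> int M * S"
  proof -
    have "(\<Sum>i<2 * n. q i) \<ge> 0" using q_nonneg by (intro sum_nonneg) auto
    then show ?thesis unfolding S_def sum_lessThan_add sum_distrib_left[symmetric]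
      by (intro mult_left_mono) auto
  qed
  also have "\<dots> \<le> G" by (rule MS_le)
  finally show ?thesis .
qed

lemma run_digit:
  assumes e: "env' s" and c: "s ''c'' 0 = int c" "c < (M + 1) ^ k"
  shows "runs L digit_prog s (1 + (1 + (k * ((1 + (1 + 1)) + 2) + 2)))
    (\<lambda>s'. same {''t'', ''g'', ''a'', ''j''} s s' \<and> (\<forall>j<k. s' ''a'' (int j) = int (dig c j)) \<and>
      s' ''g'' 0 = budget_cost c)"
proof -
  let ?A = "{''t'', ''g'', ''a'', ''j''}"
  let ?I = "\<lambda>j s'. same ?A s s' \<and> s' ''t'' 0 = int (c div (M + 1) ^ j) \<and>
    (\<forall>i<j. s' ''a'' (int i) = int (dig c i)) \<and> s' ''g'' 0 = (\<Sum>i<j. int (dig c i) * q (2 * n + i))"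
  have cb: "int c \<le> cell_bound L" using c(2) bounds(3) by linarith
  have div_b: "\<bar>int (c div d)\<bar> \<le> cell_bound L" for d
    using cb div_le_dividend[of c d] by linarith
  show ?thesis unfolding digit_prog_def
  proof (rule runs_Store_Seq[rotated], rule runs_Store_Seq[rotated], rule runs_For[where I = ?I])
    fix j s' assume I: "?I j s'"
    then have "env' s'" by (intro env'_same[OF e, where A = ?A]) simp_all
    then show "aval (Var ''k'') s' = int k" by (simp add: env'_def env_def)
  next
    fix j s' assume I: "?I j s'" and j: "j < k" "s' ''j'' 0 = int j"
    from I have "env' s'" by (intro env'_same[OF e, where A = ?A]) simp_all
    then have s': "s' ''M'' 0 = int M" "s' ''n'' 0 = int n" "s' ''q'' (2 * int n + int j) = q (2 * n + j)"
      using j by (simp_all add: env'_def env_def) (metis (no_types, lifting) add_less_cancel_left of_nat_add of_nat_mult of_nat_numeral)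
    let ?t = "int (c div (M + 1) ^ j)"
    have d: "?t - ?t div (int M + 1) * (int M + 1) = int (dig c j)"
    proof -
      have "int (dig c j) = ?t mod (int M + 1)" unfolding dig_def by (simp add: zmod_int add.commute)
      then show ?thesis by (simp add: minus_div_mult_eq_mod)
    qed
    have t: "?t div (int M + 1) = int (c div (M + 1) ^ Suc j)"
    proof -
      have "c div (M + 1) ^ Suc j = c div (M + 1) ^ j div (M + 1)"
        by (simp add: div_mult2_eq[symmetric] mult.commute)
      then show ?thesis by (simp add: zdiv_int add.commute)
    qed
    have b1: "\<bar>int (dig c j)\<bar> \<le> cell_bound L" using dig_le[of c j] M_bound by linarith
    have "(\<Sum>i<Suc j. int (dig c i) * q (2 * n + i)) \<ge> 0" using j q_nonneg by (intro sum_nonneg mult_nonneg_nonneg) auto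
    then have b2: "\<bar>(\<Sum>i<j. int (dig c i) * q (2 * n + i)) + int (dig c j) * q (2 * n + j)\<bar> \<le> cell_bound L"
      using budget_sum_le[of "Suc j" c] j bounds(2) by simp
    let ?T = "Minus (Var ''t'') (Times (Div (Var ''t'') (Plus (Var ''M'') (Const 1))) (Plus (Var ''M'') (Const 1)))"
    let ?U = "Div (Var ''t'') (Plus (Var ''M'') (Const 1))"
    have T: "aval ?T s' = int (dig c j)" using I s' d by (simp del: of_nat_power of_nat_add)
    have U: "aval ?U (s'(''a'' := z)) = int (c div (M + 1) ^ Suc j)" for z using I s' t by simp
    show "runs L (Seq (Store ''a'' (Var ''j'') ?T) (Seq (Assign ''t'' ?U)
      (Assign ''g'' (Plus (Var ''g'') (Times (Elem ''a'' (Var ''j''))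
        (Elem ''q'' (Plus (Times (Const 2) (Var ''n'')) (Var ''j''))))))))
      s' (1 + (1 + 1)) (\<lambda>s''. s'' ''j'' 0 = int j \<and> ?I (Suc j) (s''(''j'' := (s'' ''j'')(0 := int (Suc j)))))"
    proof (intro runs_Store_Seq runs_Store)
      show "\<bar>aval ?T s'\<bar> \<le> cell_bound L" unfolding T by (rule b1)
    qed (unfold T U, use I j b2 s' div_b in \<open>simp_all add: less_Suc_eq\<close>)
  qed (use cb c nk_bound in \<open>simp_all add: budget_cost_def\<close>)
qed

lemma run_reset:
  assumes e: "env' s"
  shows "runs L reset_prog s ((Suc (p * M) * (1 + 2) + 2) + 1)
    (\<lambda>s'. same {''f'', ''w''} s s' \<and> (\<forall>w\<le>p * M. s' ''f'' (int w) = (if w = 0 then 0 else G)))"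
proof -
  let ?A = "{''f'', ''w''}"
  let ?I = "\<lambda>v s'. same ?A s s' \<and> (\<forall>w<v. s' ''f'' (int w) = G)"
  have Gb: "\<bar>G\<bar> \<le> cell_bound L" using G_pos bounds(2) by simp
  have "runs L (For ''w'' (Plus (Var ''W'') (Const 1)) (Store ''f'' (Var ''w'') (Var ''G''))) s
      (Suc (p * M) * (1 + 2) + 2) (?I (Suc (p * M)))"
  proof (rule runs_For[where I = ?I])
    fix w s' assume I: "?I w s'"
    then have "env' s'" by (intro env'_same[OF e, where A = ?A]) simp_all
    then show "aval (Plus (Var ''W'') (Const 1)) s' = int (Suc (p * M))" by (simp add: env'_def env_def)
  next
    fix w s' assume I: "?I w s'" and w: "w < Suc (p * M)" "s' ''w'' 0 = int w"
    from I have "env' s'" by (intro env'_same[OF e, where A = ?A]) simp_all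
    then have "s' ''G'' 0 = G" by (simp add: env'_def)
    then show "runs L (Store ''f'' (Var ''w'') (Var ''G'')) s' 1
        (\<lambda>s''. s'' ''w'' 0 = int w \<and> ?I (Suc w) (s''(''w'' := (s'' ''w'')(0 := int (Suc w)))))"
      by (intro runs_Store) (use I w Gb in \<open>simp_all add: less_Suc_eq\<close>)
  qed (use bounds(4) in simp_all)
  then show ?thesis unfolding reset_prog_def
  proof (rule runs_Seq)
    fix s' assume s': "?I (Suc (p * M)) s'"
    show "runs L (Store ''f'' (Const 0) (Const 0)) s' 1
        (\<lambda>s'. same ?A s s' \<and> (\<forall>w\<le>p * M. s' ''f'' (int w) = (if w = 0 then 0 else G)))"
      by (rule runs_Store) (use s' nk_bound in \<open>auto simp: less_Suc_eq_le\<close>)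
  qed
qed

lemma run_cap:
  assumes e: "env' s" and a: "\<forall>j<k. s ''a'' (int j) = int (dig c j)" and i: "s ''i'' 0 = int i" "i < n"
  shows "runs L cap_prog s (1 + ((k * (1 + 2) + 2) + (1 + 1)))
    (\<lambda>s'. same {''u'', ''j''} s s' \<and> s' ''u'' 0 = int (cap c i))"
  unfolding cap_prog_def
proof (rule runs_Store_Seq)
  let ?A = "{''u'', ''j''}"
  let ?I = "\<lambda>j s'. same ?A s s' \<and> s' ''u'' 0 = int (\<Sum>l<j. dig c l * inc l i)"
  let ?s = "s(''u'' := (s ''u'')(aval (Const 0) s := aval (Const 0) s))"
  let ?e = "Plus (Var ''u'') (Times (Elem ''a'' (Var ''j''))
      (Elem ''in'' (Plus (Plus (Const 4) (Times (Const 2) (Var ''m'')))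
        (Plus (Times (Var ''j'') (Var ''n'')) (Var ''i'')))))"
  show "\<bar>aval (Const 0) s\<bar> \<le> cell_bound L" using nk_bound by simp
  have "runs L (For ''j'' (Var ''k'') (Assign ''u'' ?e)) ?s (k * (1 + 2) + 2) (?I k)"
  proof (rule runs_For[where I = ?I])
    fix j s' assume I: "?I j s'"
    then have "env' s'" by (intro env'_same[OF e, where A = ?A]) simp_all
    then show "aval (Var ''k'') s' = int k" by (simp add: env'_def env_def)
  next
    fix j s' assume I: "?I j s'" and j: "j < k" "s' ''j'' 0 = int j"
    from I have "env' s'" by (intro env'_same[OF e, where A = ?A]) simp_all
    then have s': "s' ''n'' 0 = int n" "s' ''m'' 0 = int (2 * n + k)"
      "s' ''in'' (4 + 2 * int (2 * n + k) + (int j * int n + int i)) = int (inc j i)"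
      using i j unfolding env'_def env_def input_def by blast+
    have s'': "s' ''a'' (int j) = int (dig c j)" "s' ''i'' 0 = int i"
      using I a i j same_get[of ?A s s' "''a''"] same_get[of ?A s s' "''i''"] by simp_all
    have v: "aval ?e s' = int (\<Sum>l<Suc j. dig c l * inc l i)"
      using I s' s'' j(2) by (simp del: of_nat_mult of_nat_add of_nat_sum add: of_nat_mult[symmetric] of_nat_add[symmetric])
    have "(\<Sum>l<Suc j. dig c l * inc l i) \<le> (\<Sum>l<Suc j. M)"
      using mult_mono[OF dig_le inc] by (intro sum_mono) auto
    also have "\<dots> = Suc j * M" by simp
    also have "\<dots> \<le> k * M" using j by (intro mult_right_mono) auto
    also have "\<dots> \<le> (k + 1) * (M + 1)" by simp
    finally have "int (\<Sum>l<Suc j. dig c l * inc l i) \<le> int ((k + 1) * (M + 1))" by (simp only: of_nat_le_iff)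
    also have "\<dots> = (int k + 1) * (int M + 1)" by (simp add: algebra_simps)
    also note bounds(5)
    finally have b: "\<bar>int (\<Sum>l<Suc j. dig c l * inc l i)\<bar> \<le> cell_bound L" by (simp only: abs_of_nat)
    show "runs L (Assign ''u'' ?e) s' 1
        (\<lambda>s''. s'' ''j'' 0 = int j \<and> ?I (Suc j) (s''(''j'' := (s'' ''j'')(0 := int (Suc j)))))"
      by (rule runs_Store; unfold v) (use I j b in simp_all)
  qed (use nk_bound in simp_all)
  then show "runs L (Seq (For ''j'' (Var ''k'') (Assign ''u'' ?e))
    (Cond (Less (Var ''M'') (Var ''u'')) (Assign ''u'' (Var ''M'')) Skip)) ?s ((k * (1 + 2) + 2) + (1 + 1))
    (\<lambda>s'. same ?A s s' \<and> s' ''u'' 0 = int (cap c i))"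
  proof (rule runs_Seq)
    fix s' assume I: "?I k s'"
    then have "env' s'" by (intro env'_same[OF e, where A = ?A]) simp_all
    then have M: "s' ''M'' 0 = int M" by (simp add: env'_def env_def)
    show "runs L (Cond (Less (Var ''M'') (Var ''u'')) (Assign ''u'' (Var ''M'')) Skip) s' (1 + 1)
      (\<lambda>s'. same ?A s s' \<and> s' ''u'' 0 = int (cap c i))"
    proof (rule runs_Cond)
      assume "bval (Less (Var ''M'') (Var ''u'')) s'"
      then have "M < (\<Sum>l<k. dig c l * inc l i)" using I M by (simp del: of_nat_sum)
      then have "cap c i = M" unfolding cap_def by simp
      then show "runs L (Assign ''u'' (Var ''M'')) s' 1 (\<lambda>s'. same ?A s s' \<and> s' ''u'' 0 = int (cap c i))"
        by (intro runs_Store) (use I M M_bound in simp_all)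
    next
      assume "\<not> bval (Less (Var ''M'') (Var ''u'')) s'"
      then have "\<not> M < (\<Sum>l<k. dig c l * inc l i)" using I M by (simp del: of_nat_sum)
      then have "cap c i = (\<Sum>l<k. dig c l * inc l i)" unfolding cap_def by simp
      then show "runs L Skip s' 1 (\<lambda>s'. same ?A s s' \<and> s' ''u'' 0 = int (cap c i))"
        by (intro runs_Skip) (use I in simp_all)
    qed
  qed
qed

end

text \<open>The counts are left unsimplified in the shape of the programs, so that
  \<open>runs_Seq\<close> and \<open>runs_For\<close> match them without arithmetic.\<close>

definition row_steps :: "nat \<Rightarrow> nat \<Rightarrow> nat" where
  "row_steps W M = 1 + (Suc W * ((((Suc M * ((1 + 1) + 2) + 2) + (1 + 1)) + 1) + 2) + 2)"

definition table_steps :: "nat \<Rightarrow> nat \<Rightarrow> nat \<Rightarrow> nat \<Rightarrow> nat" where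
  "table_steps n k W M =
    1 + (n * (((1 + ((k * (1 + 2) + 2) + (1 + 1))) + (row_steps W M + 1)) + 2) + 2)"

text \<open>The factor \<open>(M + 1) ^ k\<close> is the only place where \<open>k\<close> enters
  the step count as an exponent; for constant \<open>k\<close> it is polynomial in
  \<open>M\<close>.\<close>

definition search_steps :: "nat \<Rightarrow> nat \<Rightarrow> nat \<Rightarrow> nat \<Rightarrow> nat" where
  "search_steps n k W M = (M + 1) ^ k *
    (((1 + (1 + (k * ((1 + (1 + 1)) + 2) + 2))) +
      (((Suc W * (1 + 2) + 2) + 1) + (table_steps n k W M + (1 + 1)))) + 2) + 2"

definition total_steps :: "nat \<Rightarrow> nat \<Rightarrow> nat \<Rightarrow> nat \<Rightarrow> nat" where
  "total_steps n k W M = (1 + (1 + (1 + (1 + (1 + 1))))) + ((1 + ((2 * n + k) * (1 + 2) + 2)) +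
    ((1 + ((2 * n + k) * ((1 + 1) + 2) + 2)) +
    ((1 + ((n * (1 + 2) + 2) + (1 + ((k * (1 + 2) + 2) + (1 + 1))))) +
    (search_steps n k W M + (n * ((1 + 1) + 2) + 2)))))"

context selection_run
begin

text \<open>A store happens only if it lowers the cell. So the new content lies between 0 and the
  old one, and a rejected candidate may exceed the cell size.\<close>

lemma run_lower:
  assumes x: "aval x s = int v" and y: "aval e s = y" and w: "s ''w'' 0 = int w"
    and f: "0 \<le> s ''f'' (int w)" "s ''f'' (int w) \<le> G" "v \<le> w \<Longrightarrow> 0 \<le> s ''f'' (int (w - v)) + y"
    and Q: "Q (s(''f'' := (s ''f'')(int w :=
      if v \<le> w then min (s ''f'' (int w)) (s ''f'' (int (w - v)) + y) else s ''f'' (int w))))"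
  shows "runs L (lower_prog x e) s (1 + 1) Q"
  unfolding lower_prog_def
proof (rule runs_Cond)
  assume b: "bval (And (Less x (Plus (Var ''w'') (Const 1)))
    (Less (Plus (Elem ''f'' (Minus (Var ''w'') x)) e) (Elem ''f'' (Var ''w'')))) s"
  then have "v \<le> w" using x w by simp
  then have wv: "int w - int v = int (w - v)" by simp
  have lt: "s ''f'' (int (w - v)) + y < s ''f'' (int w)" using b by (simp only: bval.simps aval.simps x y w wv)
  have val: "aval (Plus (Elem ''f'' (Minus (Var ''w'') x)) e) s = s ''f'' (int (w - v)) + y"
    "aval (Var ''w'') s = int w"
    by (simp_all only: aval.simps x y w wv)
  have "min (s ''f'' (int w)) (s ''f'' (int (w - v)) + y) = s ''f'' (int (w - v)) + y"
    using lt by (rule min_absorb2[OF less_imp_le])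
  with Q \<open>v \<le> w\<close> have "Q (s(''f'' := (s ''f'')(int w := s ''f'' (int (w - v)) + y)))" by (simp only: if_True)
  moreover have "\<bar>s ''f'' (int (w - v)) + y\<bar> \<le> cell_bound L" using lt f \<open>v \<le> w\<close> bounds(2) by simp
  ultimately show "runs L (Store ''f'' (Var ''w'') (Plus (Elem ''f'' (Minus (Var ''w'') x)) e)) s 1 Q"
    by (intro runs_Store; unfold val)
next
  assume b: "\<not> bval (And (Less x (Plus (Var ''w'') (Const 1)))
    (Less (Plus (Elem ''f'' (Minus (Var ''w'') x)) e) (Elem ''f'' (Var ''w'')))) s"
  have "(if v \<le> w then min (s ''f'' (int w)) (s ''f'' (int (w - v)) + y) else s ''f'' (int w)) = s ''f'' (int w)"
  proof (cases "v \<le> w")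
    case True
    then have wv: "int w - int v = int (w - v)" by simp
    have "int v < int w + 1" using True by simp
    then have "\<not> s ''f'' (int (w - v)) + y < s ''f'' (int w)"
      using b by (simp only: bval.simps aval.simps x y w wv simp_thms)
    then show ?thesis using True by simp
  qed simp
  then show "runs L Skip s 1 Q" using Q by (intro runs_Skip) simp
qed

lemma run_relax:
  assumes e: "env' s" and u: "s ''u'' 0 = int u" "u \<le> M" and w: "s ''w'' 0 = int w"
    and i: "s ''i'' 0 = int i" "i < n"
    and f: "\<And>z. z \<le> w \<Longrightarrow> s ''f'' (int z) = g z" and g: "\<And>z. 0 \<le> g z \<and> g z \<le> G"
  shows "runs L relax_prog s (Suc u * ((1 + 1) + 2) + 2)
    (\<lambda>s'. same {''f'', ''v''} s s' \<and> s' ''f'' (int w) = relax g (E * q (n + i)) w (Suc u) \<and>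
      (\<forall>z. z \<noteq> int w \<longrightarrow> s' ''f'' z = s ''f'' z))"
  unfolding relax_prog_def
proof -
  let ?A = "{''f'', ''v''}"
  let ?b = "E * q (n + i)"
  let ?I = "\<lambda>v s'. same ?A s s' \<and> s' ''f'' (int w) = relax g ?b w v \<and>
      (\<forall>z. z \<noteq> int w \<longrightarrow> s' ''f'' z = s ''f'' z)"
  have b: "?b \<ge> 0" using E_pos q_nonneg[of "n + i"] i by simp
  have u1: "aval (Plus (Var ''u'') (Const 1)) s' = int (Suc u)" if "same ?A s s'" for s'
    using same_get[OF that, of "''u''"] u by simp
  show "runs L (For ''v'' (Plus (Var ''u'') (Const 1))
      (lower_prog (Var ''v'') (Times (Var ''v'') (Times (Var ''E'') (Elem ''q'' (Plus (Var ''n'') (Var ''i''))))))) s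
    (Suc u * ((1 + 1) + 2) + 2) (?I (Suc u))"
  proof (rule runs_For[where I = ?I])
    fix v s' assume I: "?I v s'" and v: "v < Suc u" "s' ''v'' 0 = int v"
    then have "env' s'" by (intro env'_same[OF e, where A = ?A]) simp_all
    then have s': "s' ''E'' 0 = E" "s' ''n'' 0 = int n" "s' ''q'' (int (n + i)) = q (n + i)"
      using i unfolding env'_def env_def by (simp_all del: of_nat_add)
    have s'': "s' ''i'' 0 = int i" "s' ''w'' 0 = int w"
      using I i w same_get[of ?A s s' "''i''"] same_get[of ?A s s' "''w''"] by simp_all
    \<comment> \<open>For \<open>v > 0\<close> the cell read lies left of \<open>w\<close> and still
      belongs to the old row. For \<open>v = 0\<close> it is \<open>w\<close> itself, which then has
      its initial content \<open>g w\<close>.\<close>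
    have fv: "s' ''f'' (int (w - v)) = g (w - v)" if "v \<le> w"
    proof (cases "v = 0")
      case False
      then have "int (w - v) \<noteq> int w" using that by linarith
      then have "s' ''f'' (int (w - v)) = s ''f'' (int (w - v))" using I by blast
      then show ?thesis using f[of "w - v"] by simp
    qed (use I in simp)
    have e: "aval (Times (Var ''v'') (Times (Var ''E'') (Elem ''q'' (Plus (Var ''n'') (Var ''i''))))) s' = int v * ?b"
      using s' s'' v by simp
    show "runs L (lower_prog (Var ''v'') (Times (Var ''v'') (Times (Var ''E'') (Elem ''q'' (Plus (Var ''n'') (Var ''i''))))))
       s' (1 + 1) (\<lambda>s''. s'' ''v'' 0 = int v \<and> ?I (Suc v) (s''(''v'' := (s'' ''v'')(0 := int (Suc v)))))"
    proof (rule run_lower[OF _ e s''(2)])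
      show "aval (Var ''v'') s' = int v" using v by simp
      show "0 \<le> s' ''f'' (int w)" "s' ''f'' (int w) \<le> G"
        using I relax_bounds[of g G ?b w v] g b by simp_all
      show "0 \<le> s' ''f'' (int (w - v)) + int v * ?b" if "v \<le> w" using fv[OF that] g b by simp
    qed (use I v fv in \<open>simp_all del: of_nat_Suc\<close>)
  next
    have "int (Suc u) \<le> int M + 1" using u(2) by simp
    then show "int (Suc u) \<le> cell_bound L" using M_bound by simp
  qed (use u1 f in \<open>simp_all del: of_nat_Suc relax.simps(2)\<close>)
qed

lemma run_cell:
  assumes e: "env' s" and u: "s ''u'' 0 = int (cap c i)" and w: "s ''w'' 0 = int w"
    and i: "s ''i'' 0 = int i" "i < n" and P: "s ''P'' 0 = 2 ^ i"
    and f: "\<And>z. z \<le> w \<Longrightarrow> s ''f'' (int z) = tab c i z"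
  shows "runs L cell_prog s ((Suc M * ((1 + 1) + 2) + 2) + (1 + 1))
    (\<lambda>s'. same {''f'', ''v''} s s' \<and> s' ''f'' (int w) = tab c (Suc i) w \<and>
      (\<forall>z. z \<noteq> int w \<longrightarrow> s' ''f'' z = s ''f'' z))"
  unfolding cell_prog_def
proof -
  let ?A = "{''f'', ''v''}"
  let ?r = "relax (tab c i) (E * q (n + i)) w (Suc (cap c i))"
  let ?x = "Plus (Times (Times (Var ''E'') (Var ''M'')) (Elem ''q'' (Var ''i''))) (Var ''P'')"
  let ?Q = "\<lambda>s'. same ?A s s' \<and> s' ''f'' (int w) = tab c (Suc i) w \<and> (\<forall>z. z \<noteq> int w \<longrightarrow> s' ''f'' z = s ''f'' z)"
  have cM: "cap c i \<le> M" unfolding cap_def by simp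
  have tb: "0 \<le> tab c i z \<and> tab c i z \<le> G" for z using tab_bounds i by simp
  have "runs L relax_prog s (Suc (cap c i) * ((1 + 1) + 2) + 2)
     (\<lambda>s'. same ?A s s' \<and> s' ''f'' (int w) = ?r \<and> (\<forall>z. z \<noteq> int w \<longrightarrow> s' ''f'' z = s ''f'' z))"
    by (rule run_relax[OF e u cM w i f tb])
  then have "runs L relax_prog s (Suc M * ((1 + 1) + 2) + 2)
     (\<lambda>s'. same ?A s s' \<and> s' ''f'' (int w) = ?r \<and> (\<forall>z. z \<noteq> int w \<longrightarrow> s' ''f'' z = s ''f'' z))"
    by (rule runs_weaken) (use cM in simp_all)
  then show "runs L (Seq relax_prog (lower_prog (Var ''M'') ?x)) s ((Suc M * ((1 + 1) + 2) + 2) + (1 + 1)) ?Q"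
  proof (rule runs_Seq)
    fix s' assume s': "same ?A s s' \<and> s' ''f'' (int w) = ?r \<and> (\<forall>z. z \<noteq> int w \<longrightarrow> s' ''f'' z = s ''f'' z)"
    then have "env' s'" by (intro env'_same[OF e, where A = ?A]) simp_all
    then have v: "s' ''E'' 0 = E" "s' ''M'' 0 = int M" "s' ''q'' (int i) = q i"
      using i unfolding env'_def env_def by simp_all
    have v': "s' ''i'' 0 = int i" "s' ''w'' 0 = int w" "s' ''P'' 0 = 2 ^ i"
      using s' i w P same_get[of ?A s s' "''i''"] same_get[of ?A s s' "''w''"] same_get[of ?A s s' "''P''"] by simp_all
    have x: "aval ?x s' = E * int M * q i + 2 ^ i" using v v' by simp
    have x0: "E * int M * q i + 2 ^ i \<ge> 0" using E_pos q_nonneg[of i] i by simp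
    \<comment> \<open>As \<open>M > 0\<close>, this cell lies strictly left of \<open>w\<close> and
      was not touched by the relaxation.\<close>
    have fM: "s' ''f'' (int (w - M)) = tab c i (w - M)" if "M \<le> w"
    proof -
      have "int (w - M) \<noteq> int w" using that M_pos by linarith
      then have "s' ''f'' (int (w - M)) = s ''f'' (int (w - M))" using s' by blast
      then show ?thesis using f[of "w - M"] by simp
    qed
    have b: "0 \<le> ?r \<and> ?r \<le> G"
      by (rule relax_bounds) (use tb E_pos q_nonneg[of "n + i"] i in simp_all)
    have t: "tab c (Suc i) w = (if M \<le> w then min ?r (tab c i (w - M) + (E * int M * q i + 2 ^ i)) else ?r)"
      unfolding tab_def by (simp add: Let_def del: relax.simps)
    show "runs L (lower_prog (Var ''M'') ?x) s' (1 + 1) ?Q"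
    proof (rule run_lower[OF _ x v'(2)])
      show "0 \<le> s' ''f'' (int w)" "s' ''f'' (int w) \<le> G" using s' b by simp_all
      show "0 \<le> s' ''f'' (int (w - M)) + (E * int M * q i + 2 ^ i)" if "M \<le> w"
        using fM[OF that] tb[of "w - M"] x0 by simp
    qed (use v s' fM in \<open>simp_all add: t del: relax.simps\<close>)
  qed
qed

lemma run_row:
  assumes e: "env' s" and u: "s ''u'' 0 = int (cap c i)"
    and i: "s ''i'' 0 = int i" "i < n" and P: "s ''P'' 0 = 2 ^ i"
    and f: "\<forall>z\<le>p * M. s ''f'' (int z) = tab c i z"
  shows "runs L row_prog s (row_steps (p * M) M)
    (\<lambda>s'. same {''f'', ''v'', ''w'', ''r''} s s' \<and> (\<forall>z\<le>p * M. s' ''f'' (int z) = tab c (Suc i) z))"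
  unfolding row_prog_def row_steps_def
proof (rule runs_Store_Seq)
  let ?W = "p * M"
  let ?A = "{''f'', ''v'', ''w'', ''r''}"
  \<comment> \<open>After \<open>r\<close> rounds the \<open>r\<close> rightmost columns hold the
    new row. The next round works on column \<open>p * M - r\<close> and reads only columns up to
    it, which still hold the old row.\<close>
  let ?I = "\<lambda>r s'. same ?A s s' \<and> s' ''w'' 0 = int ?W - int r \<and>
    (\<forall>z\<le>?W. s' ''f'' (int z) = (if ?W < z + r then tab c (Suc i) z else tab c i z))"
  let ?s = "s(''w'' := (s ''w'')(aval (Const 0) s := aval (Var ''W'') s))"
  have W: "s ''W'' 0 = int ?W" using e unfolding env'_def env_def by simp
  have Wb: "int ?W + 1 \<le> cell_bound L" using bounds(4) by simp
  show "\<bar>aval (Var ''W'') s\<bar> \<le> cell_bound L" using W Wb by (simp del: of_nat_mult)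
  show "runs L (For ''r'' (Plus (Var ''W'') (Const 1)) (Seq cell_prog (Assign ''w'' (Minus (Var ''w'') (Const 1))))) ?s
    (Suc ?W * ((((Suc M * ((1 + 1) + 2) + 2) + (1 + 1)) + 1) + 2) + 2)
    (\<lambda>s'. same ?A s s' \<and> (\<forall>z\<le>?W. s' ''f'' (int z) = tab c (Suc i) z))"
  proof (rule runs_For[where I = ?I])
    show "?I 0 (?s(''r'' := (?s ''r'')(0 := 0)))" using W f by (simp del: of_nat_mult)
  next
    fix r s' assume I: "?I r s'"
    then have "env' s'" by (intro env'_same[OF e, where A = ?A]) simp_all
    then show "aval (Plus (Var ''W'') (Const 1)) s' = int (Suc ?W)" unfolding env'_def env_def by simp
  next
    show "int (Suc ?W) \<le> cell_bound L" using Wb by (simp add: add.commute)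
  next
    fix r s' assume I: "?I r s'" and r: "r < Suc ?W" "s' ''r'' 0 = int r"
    define w where "w = ?W - r"
    have w: "s' ''w'' 0 = int w" using I r unfolding w_def by (simp add: of_nat_diff)
    from I have e': "env' s'" by (intro env'_same[OF e, where A = ?A]) simp_all
    have v: "s' ''i'' 0 = int i" "s' ''u'' 0 = int (cap c i)" "s' ''P'' 0 = 2 ^ i"
      using I i u P same_get[of ?A s s' "''i''"] same_get[of ?A s s' "''u''"] same_get[of ?A s s' "''P''"] by simp_all
    have f': "s' ''f'' (int z) = tab c i z" if "z \<le> w" for z
    proof -
      have "z \<le> ?W" "\<not> ?W < z + r" using that r unfolding w_def by linarith+
      then show ?thesis using I by simp
    qed
    show "runs L (Seq cell_prog (Assign ''w'' (Minus (Var ''w'') (Const 1)))) s'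
       (((Suc M * ((1 + 1) + 2) + 2) + (1 + 1)) + 1)
       (\<lambda>s''. s'' ''r'' 0 = int r \<and> ?I (Suc r) (s''(''r'' := (s'' ''r'')(0 := int (Suc r)))))"
    proof (rule runs_Seq[OF run_cell[OF e' v(2) w v(1) i(2) v(3) f']])
      fix s'' assume s'': "same {''f'', ''v''} s' s'' \<and> s'' ''f'' (int w) = tab c (Suc i) w \<and>
        (\<forall>z. z \<noteq> int w \<longrightarrow> s'' ''f'' z = s' ''f'' z)"
      then have w': "s'' ''w'' 0 = int w" and r': "s'' ''r'' 0 = int r"
        using w r same_get[of "{''f'', ''v''}" s' s'' "''w''"] same_get[of "{''f'', ''v''}" s' s'' "''r''"] by simp_all
      have sm: "same ?A s s''"
        by (rule same_trans[of ?A s s' "{''f'', ''v''}"]) (use I s'' in simp_all)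
      have "s'' ''f'' (int z) = (if ?W < z + Suc r then tab c (Suc i) z else tab c i z)" if "z \<le> ?W" for z
      proof (cases "z = w")
        case True
        then show ?thesis using s'' r unfolding w_def by simp
      next
        case False
        then have "s'' ''f'' (int z) = s' ''f'' (int z)" using s'' by simp
        moreover have "?W < z + Suc r \<longleftrightarrow> ?W < z + r" using False r that unfolding w_def by auto
        ultimately show ?thesis using I that by simp
      qed
      moreover have "int w - 1 = int ?W - int (Suc r)" using r unfolding w_def by (simp add: of_nat_diff)
      \<comment> \<open>In the last round \<open>w\<close> drops from 0 to -1.\<close>
      moreover have "\<bar>int w - 1\<bar> \<le> cell_bound L"
      proof -
        have "int w \<le> int ?W" unfolding w_def by (simp only: of_nat_le_iff diff_le_self)
        then show ?thesis using Wb by linarith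
      qed
      ultimately show "runs L (Assign ''w'' (Minus (Var ''w'') (Const 1))) s'' 1
         (\<lambda>s''. s'' ''r'' 0 = int r \<and> ?I (Suc r) (s''(''r'' := (s'' ''r'')(0 := int (Suc r)))))"
        by (intro runs_Store) (use sm w' r' in \<open>simp_all del: of_nat_mult of_nat_Suc\<close>)
    qed
  qed simp
qed

lemma run_table:
  assumes e: "env' s" and a: "\<forall>j<k. s ''a'' (int j) = int (dig c j)"
    and f: "\<forall>z\<le>p * M. s ''f'' (int z) = (if z = 0 then 0 else G)"
  shows "runs L table_prog s (table_steps n k (p * M) M)
    (\<lambda>s'. same {''P'', ''i'', ''u'', ''j'', ''f'', ''v'', ''w'', ''r''} s s' \<and> s' ''f'' (int (p * M)) = tab c n (p * M))"
  unfolding table_prog_def table_steps_def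
proof (rule runs_Store_Seq)
  let ?A = "{''P'', ''i'', ''u'', ''j'', ''f'', ''v'', ''w'', ''r''}"
  let ?I = "\<lambda>i s'. same ?A s s' \<and> s' ''P'' 0 = 2 ^ i \<and> (\<forall>z\<le>p * M. s' ''f'' (int z) = tab c i z)"
  let ?s = "s(''P'' := (s ''P'')(aval (Const 0) s := aval (Const 1) s))"
  show "\<bar>aval (Const 1) s\<bar> \<le> cell_bound L" using nk_bound by simp
  show "runs L (For ''i'' (Var ''n'') (Seq cap_prog (Seq row_prog (Assign ''P'' (Plus (Var ''P'') (Var ''P'')))))) ?s
    (n * (((1 + ((k * (1 + 2) + 2) + (1 + 1))) + (row_steps (p * M) M + 1)) + 2) + 2)
    (\<lambda>s'. same ?A s s' \<and> s' ''f'' (int (p * M)) = tab c n (p * M))"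
  proof (rule runs_For[where I = ?I])
    show "?I 0 (?s(''i'' := (?s ''i'')(0 := 0)))" using f by (simp add: tab_def)
  next
    fix i s' assume I: "?I i s'"
    then have "env' s'" by (intro env'_same[OF e, where A = ?A]) simp_all
    then show "aval (Var ''n'') s' = int n" unfolding env'_def env_def by simp
  next
    fix i s' assume I: "?I i s'" and i: "i < n" "s' ''i'' 0 = int i"
    from I have e': "env' s'" by (intro env'_same[OF e, where A = ?A]) simp_all
    have a': "\<forall>j<k. s' ''a'' (int j) = int (dig c j)" using I a same_get[of ?A s s' "''a''"] by simp
    show "runs L (Seq cap_prog (Seq row_prog (Assign ''P'' (Plus (Var ''P'') (Var ''P''))))) s'
       ((1 + ((k * (1 + 2) + 2) + (1 + 1))) + (row_steps (p * M) M + 1))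
       (\<lambda>s''. s'' ''i'' 0 = int i \<and> ?I (Suc i) (s''(''i'' := (s'' ''i'')(0 := int (Suc i)))))"
    proof (rule runs_Seq[OF run_cap[OF e' a' i(2,1)]])
      let ?B = "{''u'', ''j''}"
      fix s1 assume s1: "same ?B s' s1 \<and> s1 ''u'' 0 = int (cap c i)"
      then have e1: "env' s1" by (intro env'_same[OF e', where A = ?B]) simp_all
      have v1: "s1 ''i'' 0 = int i" "s1 ''P'' 0 = 2 ^ i" "\<forall>z\<le>p * M. s1 ''f'' (int z) = tab c i z"
        using s1 I i same_get[of ?B s' s1 "''i''"] same_get[of ?B s' s1 "''P''"] same_get[of ?B s' s1 "''f''"] by simp_all
      have sm1: "same ?A s s1" by (rule same_trans[of ?A s s' ?B]) (use I s1 in simp_all)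
      show "runs L (Seq row_prog (Assign ''P'' (Plus (Var ''P'') (Var ''P'')))) s1 (row_steps (p * M) M + 1)
        (\<lambda>s''. s'' ''i'' 0 = int i \<and> ?I (Suc i) (s''(''i'' := (s'' ''i'')(0 := int (Suc i)))))"
      proof (rule runs_Seq[OF run_row[OF e1 _ v1(1) i(1) v1(2,3)]])
        let ?C = "{''f'', ''v'', ''w'', ''r''}"
        show "s1 ''u'' 0 = int (cap c i)" using s1 by simp
        fix s2 assume s2: "same ?C s1 s2 \<and> (\<forall>z\<le>p * M. s2 ''f'' (int z) = tab c (Suc i) z)"
        have v2: "s2 ''i'' 0 = int i" "s2 ''P'' 0 = 2 ^ i"
          using s2 v1 same_get[of ?C s1 s2 "''i''"] same_get[of ?C s1 s2 "''P''"] by simp_all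
        have sm2: "same ?A s s2" by (rule same_trans[of ?A s s1 ?C]) (use sm1 s2 in simp_all)
        show "runs L (Assign ''P'' (Plus (Var ''P'') (Var ''P''))) s2 1
          (\<lambda>s''. s'' ''i'' 0 = int i \<and> ?I (Suc i) (s''(''i'' := (s'' ''i'')(0 := int (Suc i)))))"
          by (rule runs_Store) (use s2 v2 sm2 i pow2_le[of "Suc i"] in simp_all)
      qed
    qed
  next
    fix s' assume "?I n s'"
    then show "same ?A s s' \<and> s' ''f'' (int (p * M)) = tab c n (p * M)" by blast
  qed (use nk_bound in simp)
qed

lemma run_search:
  assumes e: "env' s" and b: "s ''b'' 0 = G"
  shows "runs L search_prog s (search_steps n k (p * M) M)
    (\<lambda>s'. env' s' \<and> s' ''b'' 0 = best ((M + 1) ^ k))"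
  unfolding search_prog_def search_steps_def
proof -
  let ?A = "{''c'', ''t'', ''g'', ''a'', ''b'', ''P'', ''i'', ''u'', ''j'', ''f'', ''v'', ''w'', ''r''}"
  let ?I = "\<lambda>c s'. same ?A s s' \<and> s' ''b'' 0 = best c"
  have env: "env' s'" if "same ?A s s'" for s'
    by (rule env'_same[OF e that]) simp
  show "runs L (For ''c'' (Var ''R'') (Seq digit_prog (Seq reset_prog (Seq table_prog update_prog)))) s
    ((M + 1) ^ k * (((1 + (1 + (k * ((1 + (1 + 1)) + 2) + 2))) +
      (((Suc (p * M) * (1 + 2) + 2) + 1) + (table_steps n k (p * M) M + (1 + 1)))) + 2) + 2)
    (\<lambda>s'. env' s' \<and> s' ''b'' 0 = best ((M + 1) ^ k))"
  proof (rule runs_For[where I = ?I])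
    show "?I 0 (s(''c'' := (s ''c'')(0 := 0)))" using b by simp
  next
    fix c s' assume "?I c s'"
    then have "env' s'" using env by blast
    then show "aval (Var ''R'') s' = int ((M + 1) ^ k)" unfolding env'_def by simp
  next
    fix s' assume "?I ((M + 1) ^ k) s'"
    then show "env' s' \<and> s' ''b'' 0 = best ((M + 1) ^ k)" using env by blast
  next
    fix c s' assume I: "?I c s'" and c: "c < (M + 1) ^ k" "s' ''c'' 0 = int c"
    then have e': "env' s'" using env by blast
    let ?Q = "\<lambda>s''. s'' ''c'' 0 = int c \<and> ?I (Suc c) (s''(''c'' := (s'' ''c'')(0 := int (Suc c))))"
    show "runs L (Seq digit_prog (Seq reset_prog (Seq table_prog update_prog))) s'
      ((1 + (1 + (k * ((1 + (1 + 1)) + 2) + 2))) +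
      (((Suc (p * M) * (1 + 2) + 2) + 1) + (table_steps n k (p * M) M + (1 + 1)))) ?Q"
    proof (rule runs_Seq[OF run_digit[OF e' c(2,1)]])
      let ?B = "{''t'', ''g'', ''a'', ''j''}"
      fix s1 assume s1: "same ?B s' s1 \<and> (\<forall>j<k. s1 ''a'' (int j) = int (dig c j)) \<and> s1 ''g'' 0 = budget_cost c"
      have sm1: "same ?A s s1" by (rule same_trans[of ?A s s' ?B]) (use I s1 in simp_all)
      have v1: "s1 ''c'' 0 = int c" "s1 ''b'' 0 = best c"
        using s1 I c same_get[of ?B s' s1 "''c''"] same_get[of ?B s' s1 "''b''"] by simp_all
      show "runs L (Seq reset_prog (Seq table_prog update_prog)) s1
        (((Suc (p * M) * (1 + 2) + 2) + 1) + (table_steps n k (p * M) M + (1 + 1))) ?Q"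
      proof (rule runs_Seq[OF run_reset[OF env[OF sm1]]])
        let ?C = "{''f'', ''w''}"
        fix s2 assume s2: "same ?C s1 s2 \<and> (\<forall>w\<le>p * M. s2 ''f'' (int w) = (if w = 0 then 0 else G))"
        have sm2: "same ?A s s2" by (rule same_trans[of ?A s s1 ?C]) (use sm1 s2 in simp_all)
        have v2: "s2 ''c'' 0 = int c" "s2 ''b'' 0 = best c" "s2 ''g'' 0 = budget_cost c"
          "\<forall>j<k. s2 ''a'' (int j) = int (dig c j)"
          using s1 s2 v1 same_get[of ?C s1 s2 "''c''"] same_get[of ?C s1 s2 "''b''"]
            same_get[of ?C s1 s2 "''g''"] same_get[of ?C s1 s2 "''a''"] by simp_all
        show "runs L (Seq table_prog update_prog) s2 (table_steps n k (p * M) M + (1 + 1)) ?Q"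
        proof (rule runs_Seq[OF run_table[OF env[OF sm2] v2(4)]])
          show "\<forall>z\<le>p * M. s2 ''f'' (int z) = (if z = 0 then 0 else G)" using s2 by blast
          let ?D = "{''P'', ''i'', ''u'', ''j'', ''f'', ''v'', ''w'', ''r''}"
          fix s3 assume s3: "same ?D s2 s3 \<and> s3 ''f'' (int (p * M)) = tab c n (p * M)"
          have sm3: "same ?A s s3" by (rule same_trans[of ?A s s2 ?D]) (use sm2 s3 in simp_all)
          have v3: "s3 ''c'' 0 = int c" "s3 ''b'' 0 = best c" "s3 ''g'' 0 = budget_cost c"
            using s3 v2 same_get[of ?D s2 s3 "''c''"] same_get[of ?D s2 s3 "''b''"]
              same_get[of ?D s2 s3 "''g''"] by simp_all
          have "s3 ''E'' 0 = E" "s3 ''W'' 0 = int (p * M)"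
            using env[OF sm3] unfolding env'_def env_def by simp_all
          then have val: "aval (Plus (Elem ''f'' (Var ''W'')) (Times (Var ''E'') (Var ''g''))) s3 = val c"
            using s3 v3 unfolding val_def by simp
          have "val c \<ge> 0"
            unfolding val_def using tab_bounds[of n c "p * M"] budget_cost_nonneg[of c] E_pos by simp
          \<comment> \<open>A value is stored only if it improves on \<open>best c\<close>, which
            never exceeds \<open>G\<close>.\<close>
          then have b: "\<bar>val c\<bar> \<le> cell_bound L" if "val c < best c"
            using that best_bounds[of c] bounds(2) by simp
          show "runs L update_prog s3 (1 + 1) ?Q"
            unfolding update_prog_def
          proof (rule runs_Cond)
            assume "bval (Less (Plus (Elem ''f'' (Var ''W'')) (Times (Var ''E'') (Var ''g''))) (Var ''b'')) s3"
            then have lt: "val c < best c" unfolding bval.simps val using v3 by simp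
            show "runs L (Assign ''b'' (Plus (Elem ''f'' (Var ''W'')) (Times (Var ''E'') (Var ''g'')))) s3 1 ?Q"
              by (rule runs_Store; unfold val) (use lt b sm3 v3 in simp_all)
          next
            assume "\<not> bval (Less (Plus (Elem ''f'' (Var ''W'')) (Times (Var ''E'') (Var ''g''))) (Var ''b'')) s3"
            then have "\<not> val c < best c" unfolding bval.simps val using v3 by simp
            then show "runs L Skip s3 1 ?Q"
              by (intro runs_Skip) (use sm3 v3 in simp_all)
          qed
        qed
      qed
    qed
  qed (use bounds(3) in simp)
qed

lemma run_output:
  assumes e: "env' s" and b: "s ''b'' 0 = B" "0 \<le> B" "B \<le> G"
  shows "runs L output_prog s (n * ((1 + 1) + 2) + 2) (\<lambda>s'. \<forall>i<n. s' ''out'' (int i) = B div 2 ^ i mod 2)"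
  unfolding output_prog_def
proof -
  let ?A = "{''out'', ''b'', ''i''}"
  define h where "h l = B div 2 ^ l" for l :: nat
  let ?I = "\<lambda>i s'. same ?A s s' \<and> s' ''b'' 0 = h i \<and> (\<forall>l<i. s' ''out'' (int l) = h l mod 2)"
  show "runs L (For ''i'' (Var ''n'')
      (Seq (Store ''out'' (Var ''i'') (Minus (Var ''b'') (Times (Div (Var ''b'') (Const 2)) (Const 2))))
      (Assign ''b'' (Div (Var ''b'') (Const 2))))) s (n * ((1 + 1) + 2) + 2)
    (\<lambda>s'. \<forall>i<n. s' ''out'' (int i) = B div 2 ^ i mod 2)"
  proof (rule runs_For[where I = ?I])
    fix i s' assume I: "?I i s'"
    then have "env' s'" by (intro env'_same[OF e, where A = ?A]) simp_all
    then show "aval (Var ''n'') s' = int n" unfolding env'_def env_def by simp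
  next
    fix i s' assume I: "?I i s'" and i: "i < n" "s' ''i'' 0 = int i"
    have bd: "\<bar>h l\<bar> \<le> cell_bound L" for l
      using abs_div_le[of B "2 ^ l"] b bounds(2) unfolding h_def by linarith
    have m: "h i - h i div 2 * 2 = h i mod 2" by (simp add: minus_div_mult_eq_mod)
    have m': "\<bar>h i mod 2\<bar> \<le> cell_bound L"
      using nk_bound pos_mod_bound[of 2 "h i"] pos_mod_sign[of 2 "h i"] by linarith
    have d: "h i div 2 = h (Suc i)" unfolding h_def by (simp add: zdiv_zmult2_eq[symmetric] mult.commute)
    show "runs L (Seq (Store ''out'' (Var ''i'') (Minus (Var ''b'') (Times (Div (Var ''b'') (Const 2)) (Const 2))))
      (Assign ''b'' (Div (Var ''b'') (Const 2)))) s' (1 + 1)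
      (\<lambda>s''. s'' ''i'' 0 = int i \<and> ?I (Suc i) (s''(''i'' := (s'' ''i'')(0 := int (Suc i)))))"
      by (intro runs_Store_Seq runs_Store)
        (use I i m m' d bd[of "Suc i"] in \<open>simp_all add: less_Suc_eq\<close>)
  qed (use nk_bound b in \<open>simp_all add: h_def\<close>)
qed

lemma run_selection:
  assumes "input s"
  shows "runs L selection_prog s (total_steps n k (p * M) M)
    (\<lambda>s'. \<forall>i<n. s' ''out'' (int i) = best ((M + 1) ^ k) div 2 ^ i mod 2)"
    (is "runs L _ s _ ?Q")
  unfolding selection_prog_def total_steps_def
proof (rule runs_Seq)
  show "runs L setup_prog s (1 + (1 + (1 + (1 + (1 + 1))))) env"
    by (rule runs_weaken[OF run_setup[OF assms]]) simp_all
  fix s1 assume e1: "env s1"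
  show "runs L (Seq denominator_prog (Seq cost_prog (Seq power_prog (Seq search_prog output_prog)))) s1
    ((1 + ((2 * n + k) * (1 + 2) + 2)) + ((1 + ((2 * n + k) * ((1 + 1) + 2) + 2)) +
    ((1 + ((n * (1 + 2) + 2) + (1 + ((k * (1 + 2) + 2) + (1 + 1))))) + (search_steps n k (p * M) M + (n * ((1 + 1) + 2) + 2))))) ?Q"
  proof (rule runs_Seq[OF run_denominator[OF e1]])
    fix s2 assume s2: "same {''D'', ''i''} s1 s2 \<and> s2 ''D'' 0 = D"
    then have e2: "env s2" by (intro env_same[OF e1, where A = "{''D'', ''i''}"]) simp_all
    show "runs L (Seq cost_prog (Seq power_prog (Seq search_prog output_prog))) s2
      ((1 + ((2 * n + k) * ((1 + 1) + 2) + 2)) +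
      ((1 + ((n * (1 + 2) + 2) + (1 + ((k * (1 + 2) + 2) + (1 + 1))))) + (search_steps n k (p * M) M + (n * ((1 + 1) + 2) + 2)))) ?Q"
    proof (rule runs_Seq[OF run_cost[OF e2 conjunct2[OF s2]]])
      let ?A = "{''S'', ''q'', ''i''}"
      fix s3 assume s3: "same ?A s2 s3 \<and> s3 ''S'' 0 = S \<and> (\<forall>i<2 * n + k. s3 ''q'' (int i) = q i)"
      then have e3: "env s3" by (intro env_same[OF e2, where A = ?A]) simp_all
      show "runs L (Seq power_prog (Seq search_prog output_prog)) s3
        ((1 + ((n * (1 + 2) + 2) + (1 + ((k * (1 + 2) + 2) + (1 + 1))))) + (search_steps n k (p * M) M + (n * ((1 + 1) + 2) + 2))) ?Q"
      proof (rule runs_Seq[OF run_power[OF e3]])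
        let ?B = "{''E'', ''i'', ''R'', ''j'', ''G'', ''b''}"
        show "s3 ''S'' 0 = S" using s3 by blast
        fix s4 assume s4: "same ?B s3 s4 \<and> s4 ''E'' 0 = E \<and>
          s4 ''R'' 0 = int ((M + 1) ^ k) \<and> s4 ''G'' 0 = G \<and> s4 ''b'' 0 = G"
        then have "env s4" by (intro env_same[OF e3, where A = ?B]) simp_all
        moreover have "s4 ''q'' = s3 ''q''" using s4 same_get[of ?B s3 s4 "''q''"] by simp
        ultimately have e4: "env' s4" using s3 s4 unfolding env'_def by simp
        show "runs L (Seq search_prog output_prog) s4 (search_steps n k (p * M) M + (n * ((1 + 1) + 2) + 2)) ?Q"
        proof (rule runs_Seq[OF run_search[OF e4]])
          show "s4 ''b'' 0 = G" using s4 by blast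
          fix s5 assume "env' s5 \<and> s5 ''b'' 0 = best ((M + 1) ^ k)"
          then show "runs L output_prog s5 (n * ((1 + 1) + 2) + 2) ?Q"
            using best_bounds by (intro run_output) auto
        qed
      qed
    qed
  qed
qed

end

section \<open>Sizes and polynomial bounds\<close>

text \<open>First-stage costs, base costs and budgets in one sequence, in the order of the encoding,
  so that a single loop can scale them.\<close>

definition rate :: "sel_instance \<Rightarrow> nat \<Rightarrow> rat" where
  "rate I i = (if i < num_items I then first_cost I i
    else if i < 2 * num_items I then base_cost I (i - num_items I)
    else budget I (i - 2 * num_items I))"

definition rate_num :: "sel_instance \<Rightarrow> nat \<Rightarrow> int" where
  "rate_num I i = fst (quotient_of (rate I i))"

definition rate_den :: "sel_instance \<Rightarrow> nat \<Rightarrow> int" where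
  "rate_den I i = snd (quotient_of (rate I i))"

definition incidence :: "sel_instance \<Rightarrow> nat \<Rightarrow> nat \<Rightarrow> nat" where
  "incidence I j i = of_bool (i \<in> budget_set I j)"

lemma rate_quotient: "(of_rat (rate I i) :: real) = of_int (rate_num I i) / of_int (rate_den I i)"
proof -
  have "rate I i = of_int (rate_num I i) / of_int (rate_den I i)"
    unfolding rate_num_def rate_den_def by (rule quotient_of_div) simp
  then show ?thesis by (metis of_rat_divide of_rat_of_int_eq)
qed

lemma rate_den_pos: "rate_den I i > 0"
  unfolding rate_den_def by (rule quotient_of_denom_pos')

lemma enc_instance_eq:
  "enc_instance I = [int (num_items I), int (num_selected I), int (num_budgets I)] @
    concat (map (\<lambda>i. [rate_num I i, rate_den I i]) [0..<2 * num_items I + num_budgets I]) @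
    concat (map (\<lambda>j. map (\<lambda>i. int (incidence I j i)) [0..<num_items I]) [0..<num_budgets I])"
proof -
  let ?n = "num_items I" and ?K = "num_budgets I"
  let ?e = "\<lambda>i. [rate_num I i, rate_den I i]"
  have "[0..<2 * ?n + ?K] = [0..<?n] @ map (\<lambda>i. i + ?n) [0..<?n] @ map (\<lambda>j. j + 2 * ?n) [0..<?K]"
    using upt_add_eq_append[of 0 "2 * ?n" ?K] upt_add_eq_append[of 0 ?n ?n]
    unfolding map_add_upt by (simp add: mult_2 add.commute)
  then have "concat (map ?e [0..<2 * ?n + ?K]) = concat (map (\<lambda>i. enc_rat (first_cost I i)) [0..<?n]) @
      concat (map (\<lambda>i. enc_rat (base_cost I i)) [0..<?n]) @ concat (map (\<lambda>j. enc_rat (budget I j)) [0..<?K])"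
  proof -
    have "map ?e [0..<?n] = map (\<lambda>i. enc_rat (first_cost I i)) [0..<?n]"
      "map (\<lambda>i. ?e (i + ?n)) [0..<?n] = map (\<lambda>i. enc_rat (base_cost I i)) [0..<?n]"
      "map (\<lambda>j. ?e (j + 2 * ?n)) [0..<?K] = map (\<lambda>j. enc_rat (budget I j)) [0..<?K]"
      by (auto simp: enc_rat_def rate_num_def rate_den_def rate_def)
    then show ?thesis
      unfolding \<open>[0..<2 * ?n + ?K] = _\<close> map_append map_map concat_append o_def by (simp only:)
  qed
  then show ?thesis unfolding enc_instance_def incidence_def of_nat_of_bool by (simp add: of_bool_def)
qed

lemma nth_concat_pairs:
  assumes "i < m"
  shows "concat (map (\<lambda>i. [f i, g i]) [0..<m]) ! (2 * i) = f i"
    "concat (map (\<lambda>i. [f i, g i]) [0..<m]) ! (2 * i + 1) = g i"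
proof -
  have len: "length (concat (map (\<lambda>i. [f i, g i]) [0..<m])) = 2 * m" for m by (induction m) auto
  show "concat (map (\<lambda>i. [f i, g i]) [0..<m]) ! (2 * i) = f i"
    "concat (map (\<lambda>i. [f i, g i]) [0..<m]) ! (2 * i + 1) = g i"
    using assms by (induction m) (auto simp: nth_append len less_Suc_eq)
qed

lemma nth_concat_rows:
  assumes "j < m" "i < n"
  shows "concat (map (\<lambda>j. map (h j) [0..<n]) [0..<m]) ! (j * n + i) = h j i"
proof -
  have len: "length (concat (map (\<lambda>j. map (h j) [0..<n]) [0..<m])) = m * n" for m by (induction m) auto
  show ?thesis using assms(1)
  proof (induction m)
    case (Suc m)
    have *: "j * n + i < m * n" if "j < m"
    proof -
      have "j * n + i < Suc j * n" using assms(2) by simp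
      also have "\<dots> \<le> m * n" using that by (intro mult_right_mono) auto
      finally show ?thesis .
    qed
    show ?case
    proof (cases "j < m")
      case True
      with Suc * show ?thesis by (simp add: nth_append len)
    next
      case False
      with Suc.prems have "j = m" by simp
      then show ?thesis using assms(2) by (simp add: nth_append len)
    qed
  qed simp
qed

lemma input_size_append: "input_size (xs @ ys) = input_size xs + input_size ys"
  unfolding input_size_def by simp

lemma input_size_concat_map: "input_size (concat (map f [0..<m])) = (\<Sum>i<m. input_size (f i))"
proof (induction m)
  case 0
  show ?case by (simp add: input_size_def)
qed (simp add: input_size_append)

lemma isize_pos: "isize z \<ge> 1"
  unfolding isize_def by simp

lemma length_le_input_size: "length zs \<le> input_size zs"
proof (induction zs)
  case (Cons z zs)
  then show ?case using isize_pos[of z] unfolding input_size_def by simp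
qed (simp add: input_size_def)

lemma isize_le_input_size: "z \<in> set zs \<Longrightarrow> isize z \<le> input_size zs"
  unfolding input_size_def by (intro member_le_sum_list) auto

lemma valid_selection_data:
  assumes "valid_instance I" "N \<ge> 1"
  shows "selection_data (num_items I) (num_selected I) (num_budgets I) N (rate_num I) (rate_den I) (incidence I)"
proof
  fix i assume i: "i < 2 * num_items I + num_budgets I"
  have "rate I i \<ge> 0" using assms(1) i unfolding valid_instance_def rate_def by auto
  then have "(of_rat (rate I i) :: real) \<ge> 0" by simp
  then show "rate_num I i \<ge> 0"
    unfolding rate_quotient using rate_den_pos[of I i] by (simp add: zero_le_divide_iff)
qed (use assms rate_den_pos in \<open>auto simp: valid_instance_def incidence_def\<close>)

lemma less_power2: "(x::int) \<le> int m \<Longrightarrow> x \<le> 2 ^ m"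
proof -
  assume "x \<le> int m"
  also have "int m < 2 ^ m" by simp
  finally show ?thesis by simp
qed

text \<open>In the bound for \<open>G\<close>, the factor \<open>2 ^ n\<close>, the number of costs,
  a numerator and a quotient of \<open>D\<close> are at most \<open>2 ^ z\<close> each, and the
  factor \<open>M + 1\<close> is at most \<open>2 ^ M\<close>. The summand \<open>M * k\<close>
  covers \<open>(M + 1) ^ k\<close>, and \<open>k + 1\<close> the capacity sums. Spending
  \<open>M\<close> bits where its bit length would do is affordable, because \<open>M\<close> itself
  is polynomial in the size and \<open>1 / \<epsilon>\<close>.\<close>

definition cell_bits :: "nat \<Rightarrow> nat \<Rightarrow> nat \<Rightarrow> nat" where
  "cell_bits k M z = 4 * z + M + M * k + k + 1"

context selection_data
begin

lemma selection_run_bounds: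
  assumes z: "2 * n + k + 1 \<le> z"
    and num_z: "\<And>i. i < 2 * n + k \<Longrightarrow> isize (num i) \<le> z"
    and den_z: "(\<Sum>i<2 * n + k. isize (den i)) \<le> z"
  shows "selection_run n p k N num den inc (cell_bits k M z)"
proof
  have mono: "(2::int) ^ a \<le> cell_bound (cell_bits k M z)" if "a \<le> cell_bits k M z" for a
    unfolding cell_bound_def using that by (intro power_increasing) auto
  have M1: "int M + 1 \<le> 2 ^ M"
    using M_pos by (metis Suc_leI add.commute less_exp of_nat_Suc of_nat_le_iff of_nat_numeral of_nat_power)
  have "D \<le> (\<Prod>i<2 * n + k. 2 ^ isize (den i))"
  proof -
    have "den i \<le> 2 ^ isize (den i)" for i using abs_le_isize[of "den i"] by linarith
    then show ?thesis unfolding D_def using den by (intro prod_mono) (auto simp: less_imp_le)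
  qed
  also have "\<dots> = 2 ^ (\<Sum>i<2 * n + k. isize (den i))" by (simp add: power_sum)
  also have "\<dots> \<le> 2 ^ z" using den_z by (intro power_increasing) auto
  finally have D: "D \<le> 2 ^ z" .
  also have "(2::int) ^ z \<le> cell_bound (cell_bits k M z)" by (rule mono) (simp add: cell_bits_def)
  finally show "D \<le> cell_bound (cell_bits k M z)" .
  have q: "q i \<le> 2 ^ z * 2 ^ z" if i: "i < 2 * n + k" for i
  proof -
    have "num i \<le> 2 ^ isize (num i)" using abs_le_isize[of "num i"] by linarith
    also have "\<dots> \<le> 2 ^ z" using num_z[OF i] by (intro power_increasing) auto
    finally have "num i \<le> 2 ^ z" .
    moreover have "D div den i \<le> 2 ^ z" "D div den i \<ge> 0"
      using abs_div_le[of D "den i"] D D_pos den[OF i] by (auto simp: pos_imp_zdiv_nonneg_iff)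
    ultimately show ?thesis unfolding q_def using num[OF i] by (intro mult_mono) auto
  qed
  have "S \<le> int (2 * n + k) * (2 ^ z * 2 ^ z)"
    unfolding S_def using sum_bounded_above[of "{..<2 * n + k}" q] q by simp
  also have "\<dots> \<le> 2 ^ z * (2 ^ z * 2 ^ z)"
    using z by (intro mult_right_mono less_power2) auto
  finally have S: "S \<le> 2 ^ z * (2 ^ z * 2 ^ z)" .
  have "int M * S + 1 \<le> int M * (2 ^ z * (2 ^ z * 2 ^ z)) + 1 * (2 ^ z * (2 ^ z * 2 ^ z))"
  proof (intro add_mono mult_left_mono S)
    have "(1::int) \<le> 2 ^ (z + (z + z))" by simp
    then show "1 \<le> 1 * ((2::int) ^ z * (2 ^ z * 2 ^ z))" by (simp only: power_add mult_1)
  qed simp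
  also have "\<dots> = (int M + 1) * (2 ^ z * (2 ^ z * 2 ^ z))" by (simp add: distrib_right)
  also have "\<dots> \<le> 2 ^ M * (2 ^ z * (2 ^ z * 2 ^ z))" using M1 by (intro mult_right_mono) auto
  finally have MS: "int M * S + 1 \<le> 2 ^ M * (2 ^ z * (2 ^ z * 2 ^ z))" .
  have "G \<le> 2 ^ z * (2 ^ M * (2 ^ z * (2 ^ z * 2 ^ z)))"
    unfolding G_def E_def using MS z S_nonneg by (intro mult_mono power_increasing) auto
  also have "\<dots> = 2 ^ (4 * z + M)" by (simp flip: power_add) 
  also have "\<dots> \<le> cell_bound (cell_bits k M z)" by (rule mono) (simp add: cell_bits_def)
  finally show "G \<le> cell_bound (cell_bits k M z)" .
  have "int ((M + 1) ^ k) = (int M + 1) ^ k" by (simp add: add.commute)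
  also have "\<dots> \<le> (2 ^ M) ^ k" using M1 by (intro power_mono) auto
  also have "\<dots> = 2 ^ (M * k)" by (simp add: power_mult)
  also have "\<dots> \<le> cell_bound (cell_bits k M z)" by (rule mono) (simp add: cell_bits_def)
  finally show "int ((M + 1) ^ k) \<le> cell_bound (cell_bits k M z)" .
  have "int p * int M + 1 \<le> (int p + 1) * (int M + 1)" by (simp add: algebra_simps)
  also have "\<dots> \<le> 2 ^ z * 2 ^ M"
  proof (rule mult_mono[OF _ M1])
    show "int p + 1 \<le> 2 ^ z" using p z by (intro less_power2) linarith
  qed auto
  also have "\<dots> = 2 ^ (z + M)" by (simp add: power_add)
  also have "\<dots> \<le> cell_bound (cell_bits k M z)" by (rule mono) (simp add: cell_bits_def)
  finally show "int p * int M + 1 \<le> cell_bound (cell_bits k M z)" .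
  have "(int k + 1) * (int M + 1) \<le> 2 ^ (k + 1) * 2 ^ M"
    by (rule mult_mono[OF less_power2 M1]) auto
  also have "\<dots> = 2 ^ (k + 1 + M)" by (simp only: power_add)
  also have "\<dots> \<le> cell_bound (cell_bits k M z)" by (rule mono) (simp add: cell_bits_def)
  finally show "(int k + 1) * (int M + 1) \<le> cell_bound (cell_bits k M z)" .
  have "2 * int n + int k + 1 \<le> 2 ^ z" using z by (intro less_power2) auto
  also have "(2::int) ^ z \<le> cell_bound (cell_bits k M z)" by (rule mono) (simp add: cell_bits_def)
  finally show "2 * int n + int k + 1 \<le> cell_bound (cell_bits k M z)" .
qed

end

text \<open>The outer variable of \<open>q\<close> stands for \<open>1 / \<epsilon>\<close>:
  evaluation at a constant polynomial leaves a polynomial in the size. Step counts are then bounded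
  by closure rules instead of an explicit polynomial.\<close>

definition poly_bounded :: "sel_instance set \<Rightarrow> (sel_instance \<Rightarrow> real \<Rightarrow> nat) \<Rightarrow> bool" where
  "poly_bounded A f \<longleftrightarrow> (\<exists>q :: real poly poly. \<forall>I\<in>A. \<forall>\<epsilon>>0.
    real (f I \<epsilon>) \<le> poly (poly q [:1 / \<epsilon>:]) (real (input_size (enc_instance I))))"

lemma poly_bounded_const: "poly_bounded A (\<lambda>I \<epsilon>. c)"
  unfolding poly_bounded_def by (rule exI[of _ "[:[:real c:]:]"]) simp

lemma poly_bounded_size: "poly_bounded A (\<lambda>I \<epsilon>. input_size (enc_instance I))"
  unfolding poly_bounded_def by (rule exI[of _ "[:[:0, 1:]:]"]) simp

lemma poly_bounded_inverse: "poly_bounded A (\<lambda>I \<epsilon>. nat \<lceil>1 / \<epsilon>\<rceil>)"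
  unfolding poly_bounded_def
proof (rule exI[of _ "[:1, 1:]"], intro ballI allI impI)
  fix I and \<epsilon> :: real assume "\<epsilon> > 0"
  then have "real (nat \<lceil>1 / \<epsilon>\<rceil>) \<le> 1 / \<epsilon> + 1"
    by (metis add.commute divide_nonneg_pos ceiling_correct diff_le_eq less_eq_real_def of_nat_nat ceiling_le_iff zero_le_one le_of_int_ceiling order_trans of_int_0_le_iff)
  then show "real (nat \<lceil>1 / \<epsilon>\<rceil>) \<le> poly (poly [:1, 1:] [:1 / \<epsilon>:]) (real (input_size (enc_instance I)))"
    by (simp add: add.commute)
qed

lemma poly_bounded_add:
  assumes "poly_bounded A f" "poly_bounded A g"
  shows "poly_bounded A (\<lambda>I \<epsilon>. f I \<epsilon> + g I \<epsilon>)"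
proof -
  obtain q r where q: "\<forall>I\<in>A. \<forall>\<epsilon>>0. real (f I \<epsilon>) \<le> poly (poly q [:1 / \<epsilon>:]) (real (input_size (enc_instance I)))"
    and r: "\<forall>I\<in>A. \<forall>\<epsilon>>0. real (g I \<epsilon>) \<le> poly (poly r [:1 / \<epsilon>:]) (real (input_size (enc_instance I)))"
    using assms unfolding poly_bounded_def by blast
  show ?thesis unfolding poly_bounded_def
    by (rule exI[of _ "q + r"]) (use q r in \<open>auto intro: add_mono\<close>)
qed

lemma poly_bounded_mult:
  assumes "poly_bounded A f" "poly_bounded A g"
  shows "poly_bounded A (\<lambda>I \<epsilon>. f I \<epsilon> * g I \<epsilon>)"
proof -
  obtain q r where q: "\<And>I \<epsilon>. I \<in> A \<Longrightarrow> \<epsilon> > 0 \<Longrightarrow> real (f I \<epsilon>) \<le> poly (poly q [:1 / \<epsilon>:]) (real (input_size (enc_instance I)))"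
    and r: "\<And>I \<epsilon>. I \<in> A \<Longrightarrow> \<epsilon> > 0 \<Longrightarrow> real (g I \<epsilon>) \<le> poly (poly r [:1 / \<epsilon>:]) (real (input_size (enc_instance I)))"
    using assms unfolding poly_bounded_def by blast
  show ?thesis unfolding poly_bounded_def
  proof (rule exI[of _ "q * r"], intro ballI allI impI)
    fix I and \<epsilon> :: real assume "I \<in> A" "\<epsilon> > 0"
    from q[OF this] r[OF this]
    show "real (f I \<epsilon> * g I \<epsilon>) \<le> poly (poly (q * r) [:1 / \<epsilon>:]) (real (input_size (enc_instance I)))"
      by (auto intro!: mult_mono intro: order_trans[OF of_nat_0_le_iff])
  qed
qed

lemma poly_bounded_power: "poly_bounded A f \<Longrightarrow> poly_bounded A (\<lambda>I \<epsilon>. f I \<epsilon> ^ m)"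
  by (induction m) (simp_all add: poly_bounded_const poly_bounded_mult)

lemmas poly_bounded_intros = poly_bounded_const poly_bounded_add poly_bounded_mult poly_bounded_power

text \<open>Every encoded number has size at least 1 and the encoding lists all costs and budgets,
  so \<open>n\<close> and the number of budgets are bounded by the size itself, although they are
  written in binary. This makes a table with \<open>p M + 1\<close> columns affordable.\<close>

lemma size_bounds:
  shows "2 * num_items I + num_budgets I + 1 \<le> input_size (enc_instance I)"
    and "i < 2 * num_items I + num_budgets I \<Longrightarrow> isize (rate_num I i) \<le> input_size (enc_instance I)"
    and "(\<Sum>i<2 * num_items I + num_budgets I. isize (rate_den I i)) \<le> input_size (enc_instance I)"
proof -
  let ?m = "2 * num_items I + num_budgets I"
  let ?p = "concat (map (\<lambda>i. [rate_num I i, rate_den I i]) [0..<?m])"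
  have "length ?p = 2 * ?m" by (simp add: length_concat o_def sum_list_triv)
  then have "2 * ?m + 3 \<le> length (enc_instance I)" unfolding enc_instance_eq by simp
  also note length_le_input_size
  finally show "?m + 1 \<le> input_size (enc_instance I)" by simp
  show "isize (rate_num I i) \<le> input_size (enc_instance I)" if "i < ?m"
    by (rule isize_le_input_size) (use that in \<open>auto simp: enc_instance_eq\<close>)
  have "(\<Sum>i<?m. isize (rate_den I i)) \<le> (\<Sum>i<?m. input_size [rate_num I i, rate_den I i])"
    by (intro sum_mono) (simp add: input_size_def)
  also have "\<dots> = input_size ?p" by (rule input_size_concat_map[symmetric])
  also have "\<dots> \<le> input_size (enc_instance I)" unfolding enc_instance_eq input_size_append by simp
  finally show "(\<Sum>i<?m. isize (rate_den I i)) \<le> input_size (enc_instance I)" .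
qed

section \<open>An instance in memory and on the grid\<close>

lemma init_state_in: "i < length zs \<Longrightarrow> init_state zs ''in'' (int i) = zs ! i"
  unfolding init_state_def by simp

lemma init_state_input:
  assumes "selection_run (num_items I) (num_selected I) (num_budgets I) N (rate_num I) (rate_den I) (incidence I) L"
  shows "selection_run.input (num_items I) (num_selected I) (num_budgets I) N (rate_num I) (rate_den I) (incidence I)
    (init_state (int N # enc_instance I))"
proof -
  interpret selection_run "num_items I" "num_selected I" "num_budgets I" N "rate_num I" "rate_den I" "incidence I" L
    by (rule assms)
  let ?n = "num_items I" and ?K = "num_budgets I"
  let ?m = "2 * ?n + ?K"
  let ?P = "concat (map (\<lambda>i. [rate_num I i, rate_den I i]) [0..<?m])"
  let ?R = "concat (map (\<lambda>j. map (\<lambda>i. int (incidence I j i)) [0..<?n]) [0..<?K])"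
  let ?z = "int N # enc_instance I"
  have z: "?z = [int N, int ?n, int (num_selected I), int ?K] @ ?P @ ?R"
    unfolding enc_instance_eq by simp
  have lP: "length ?P = 2 * ?m" by (simp add: length_concat o_def sum_list_triv)
  have lR: "length ?R = ?K * ?n" by (simp add: length_concat o_def sum_list_triv)
  have lz: "length ?z = 4 + 2 * ?m + ?K * ?n" unfolding z length_append lP lR by simp
  then have le: "length (enc_instance I) = 3 + 2 * ?m + ?K * ?n" by simp
  have nP: "?z ! (4 + i) = ?P ! i" if "i < 2 * ?m" for i
    unfolding z using that lP by (simp add: nth_append)
  have nR: "?z ! (4 + 2 * ?m + i) = ?R ! i" for i
    unfolding z using lP by (simp add: nth_append)
  have head: "init_state ?z ''in'' 0 = int N" "init_state ?z ''in'' 1 = int ?n"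
    "init_state ?z ''in'' 2 = int (num_selected I)" "init_state ?z ''in'' 3 = int ?K"
    by (simp_all add: init_state_def enc_instance_eq)
  have "init_state ?z ''in'' (4 + 2 * int i) = rate_num I i \<and> init_state ?z ''in'' (5 + 2 * int i) = rate_den I i"
    if i: "i < ?m" for i
  proof -
    have "init_state ?z ''in'' (int (4 + 2 * i)) = rate_num I i"
      by (subst init_state_in) (use i nP[of "2 * i"] nth_concat_pairs(1)[OF i] in \<open>simp_all add: le\<close>)
    moreover have "init_state ?z ''in'' (int (4 + (2 * i + 1))) = rate_den I i"
      by (subst init_state_in) (use i nP[of "2 * i + 1"] nth_concat_pairs(2)[OF i] in \<open>simp_all add: le\<close>)
    ultimately show ?thesis by (simp add: add.commute)
  qed
  moreover have "init_state ?z ''in'' (4 + 2 * int ?m + (int j * int ?n + int i)) = int (incidence I j i)"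
    if j: "j < ?K" and i: "i < ?n" for j i
  proof -
    have "j * ?n + i < Suc j * ?n" using i by simp
    also have "\<dots> \<le> ?K * ?n" using j by (intro mult_right_mono) auto
    finally have "init_state ?z ''in'' (int (4 + 2 * ?m + (j * ?n + i))) = int (incidence I j i)"
      by (subst init_state_in) (use nR[of "j * ?n + i"] nth_concat_rows[OF j i] in \<open>simp_all add: le\<close>)
    then show ?thesis by (simp add: add.assoc)
  qed
  ultimately show ?thesis
    unfolding input_def using head by simp
qed

lemma grid_solution_iff:
  assumes "selection_data (num_items I) (num_selected I) (num_budgets I) N (rate_num I) (rate_den I) (incidence I)"
    and M: "M = selection_data.M (num_items I) (num_budgets I) N"
  shows "grid_solution I M x y \<alpha> \<longleftrightarrow>
    selection_data.grid (num_items I) (num_selected I) (num_budgets I) N (incidence I) x y \<alpha> \<and>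
    (\<forall>i\<ge>num_items I. x i = 0)"
proof -
  interpret selection_data "num_items I" "num_selected I" "num_budgets I" N "rate_num I" "rate_den I" "incidence I"
    by (rule assms)
  have inc: "(\<Sum>j<num_budgets I. \<alpha> j * incidence I j i) = (\<Sum>j | j < num_budgets I \<and> i \<in> budget_set I j. \<alpha> j)" for i
    unfolding incidence_def by (rule sum.mono_neutral_cong_right) auto
  have "x i \<in> {0, 1} \<longleftrightarrow> x i \<le> 1" for i by auto
  then show ?thesis
    unfolding grid_solution_def grid_def binary_vectors_def inc M by auto
qed

lemma grid_cost_eq:
  assumes "selection_data (num_items I) (num_selected I) (num_budgets I) N (rate_num I) (rate_den I) (incidence I)"
    and M: "M = selection_data.M (num_items I) (num_budgets I) N"
  shows "of_int (selection_data.D (num_items I) (num_budgets I) (rate_den I)) * grid_cost I M x y \<alpha> =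
    of_int (selection_data.cost (num_items I) (num_budgets I) N (rate_num I) (rate_den I) x y \<alpha>)"
proof -
  interpret selection_data "num_items I" "num_selected I" "num_budgets I" N "rate_num I" "rate_den I" "incidence I"
    by (rule assms)
  have q: "real_of_int (q i) = of_int D * of_rat (rate I i)" if "i < 2 * num_items I + num_budgets I" for i
  proof -
    have "rate_den I i dvd D" unfolding D_def using that by (intro dvd_prodI) auto
    then have "real_of_int (D div rate_den I i) = of_int D / of_int (rate_den I i)"
      by (rule real_of_int_div)
    then show ?thesis unfolding q_def rate_quotient by simp
  qed
  have "(\<Sum>i<num_items I. real_of_int (q i) * real (x i)) =
      of_int D * (\<Sum>i<num_items I. of_rat (first_cost I i) * real (x i))"
    unfolding sum_distrib_left by (rule sum.cong) (auto simp: q rate_def)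
  moreover have "(\<Sum>i<num_items I. real_of_int (q (num_items I + i)) * real (y i)) =
      of_int D * (\<Sum>i<num_items I. of_rat (base_cost I i) * real (y i))"
    unfolding sum_distrib_left by (rule sum.cong) (auto simp: q rate_def)
  moreover have "(\<Sum>j<num_budgets I. real_of_int (q (2 * num_items I + j)) * real (\<alpha> j)) =
      of_int D * (\<Sum>j<num_budgets I. of_rat (budget I j) * real (\<alpha> j))"
    unfolding sum_distrib_left by (rule sum.cong) (auto simp: q rate_def)
  ultimately show ?thesis
    unfolding grid_cost_def cost_def M by (simp add: distrib_left)
qed

text \<open>\<open>n\<close> and \<open>p\<close> are replaced by the size \<open>z\<close>, which
  leaves an expression in \<open>z\<close> and \<open>M\<close> that the closure rules can handle;
  \<open>K\<close> and \<open>c\<close> are constants there.\<close>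

definition step_bound :: "nat \<Rightarrow> nat \<Rightarrow> nat \<Rightarrow> nat \<Rightarrow> nat" where
  "step_bound K z M c = total_steps z K (z * M) M * unit_cost (cell_bits K M z) c"

lemma total_steps_mono:
  assumes "n \<le> n'" "W \<le> W'"
  shows "total_steps n k W M \<le> total_steps n' k W' M"
proof -
  have r: "row_steps W M \<le> row_steps W' M"
    unfolding row_steps_def using assms by (intro add_mono mult_mono) auto
  then have t: "table_steps n k W M \<le> table_steps n' k W' M"
    unfolding table_steps_def using assms by (intro add_mono mult_mono) auto
  then have "search_steps n k W M \<le> search_steps n' k W' M"
    unfolding search_steps_def using assms by (intro add_mono mult_mono) auto
  then show ?thesis unfolding total_steps_def using assms by (intro add_mono mult_mono) auto
qed

lemma poly_bounded_step_bound:
  assumes "poly_bounded A z" "poly_bounded A M"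
  shows "poly_bounded A (\<lambda>I \<epsilon>. step_bound K (z I \<epsilon>) (M I \<epsilon>) c)"
  unfolding step_bound_def total_steps_def search_steps_def table_steps_def row_steps_def unit_cost_def
    cell_bits_def Suc_eq_plus1
  by (intro poly_bounded_intros assms)

text \<open>Solutions are compared through real bounds \<open>v\<close> on their values, which
  excludes those of infinite value; the theorem treats them separately. The conclusion
  \<open>0 \<le> v\<close> will rule out the value minus infinity.\<close>

lemma selection_prog_correct:
  assumes I: "valid_instance I" and N: "N \<ge> 1"
  defines "K \<equiv> num_budgets I" and "z \<equiv> input_size (enc_instance I)"
  defines "M \<equiv> (z + 1) * (K + 1) * N"
  obtains t s x where "exec selection_prog (init_state (int N # enc_instance I)) t s"
    "t \<le> step_bound K z M (csize selection_prog)"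
    "x \<in> sel_feasible I" "output_is s (enc_solution I x)"
    "\<And>x' v. x' \<in> sel_feasible I \<Longrightarrow> sel_value I x' \<le> ereal v \<Longrightarrow>
      0 \<le> v \<and> sel_value I x \<le> ereal ((1 + 1 / N) * v)"
proof -
  define n where "n = num_items I"
  define p where "p = num_selected I"
  let ?num = "rate_num I" and ?den = "rate_den I" and ?inc = "incidence I"
  have data: "selection_data n p K N ?num ?den ?inc"
    unfolding n_def p_def K_def by (rule valid_selection_data[OF I N])
  define L where "L = cell_bits K (selection_data.M n K N) z"
  have run: "selection_run n p K N ?num ?den ?inc L"
    unfolding L_def z_def n_def K_def
    by (rule selection_data.selection_run_bounds[OF data[unfolded n_def K_def]]) (rule size_bounds, assumption?)+
  interpret R: selection_run n p K N ?num ?den ?inc L by (rule run)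
  note data' = data[unfolded n_def p_def K_def]
  \<comment> \<open>\<open>?M\<close> is the resolution that the program uses; \<open>M\<close>,
    with the size in place of \<open>n\<close>, bounds it from above.\<close>
  let ?M = "R.M"
  have nz: "n \<le> z" "p \<le> z" using size_bounds(1)[of I] R.p unfolding n_def K_def z_def by auto
  have MM: "?M \<le> M" unfolding R.M_def M_def using nz by (intro mult_right_mono) auto
  have MN: "?M = (num_items I + 1) * (num_budgets I + 1) * N"
    using R.M_def unfolding n_def K_def by simp
  let ?s = "init_state (int N # enc_instance I)"
  have inp: "R.input ?s"
    using init_state_input[of I N L] run unfolding n_def p_def K_def by simp
  have L: "bounded L ?s" "L \<ge> 1"
  proof -
    \<comment> \<open>The accuracy fits into a cell because \<open>N \<le> ?M \<le> L\<close>; the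
      other input numbers are bounded through the size of the encoding.\<close>
    have "\<bar>a\<bar> \<le> 2 ^ L" if "a \<in> set (int N # enc_instance I)" for a
    proof (cases "a = int N")
      case True
      have "1 * N \<le> (n + 1) * (K + 1) * N" by (rule mult_right_mono) auto
      then have "N \<le> L" unfolding L_def cell_bits_def R.M_def by simp
      then have "a \<le> 2 ^ L" using True by (intro less_power2) simp
      then show ?thesis using True by simp
    next
      case False
      then have "isize a \<le> z" using that unfolding z_def by (intro isize_le_input_size) simp
      then have "(2::int) ^ isize a \<le> 2 ^ L" unfolding L_def cell_bits_def by (intro power_increasing) auto
      then show ?thesis using abs_le_isize[of a] by linarith
    qed
    then show "bounded L ?s" unfolding bounded_def init_state_def by (auto simp del: set_simps list.set simp: nth_mem)
    show "L \<ge> 1" unfolding L_def cell_bits_def by simp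
  qed
  obtain t s where ex: "exec selection_prog ?s t s"
    and t: "t \<le> total_steps n K (p * ?M) ?M * unit_cost L (csize selection_prog)"
    and out: "\<forall>i<n. s ''out'' (int i) = R.best ((?M + 1) ^ K) div 2 ^ i mod 2"
    using R.run_selection[OF inp] L unfolding runs_def by blast
  obtain x y \<alpha> where g: "R.grid x y \<alpha>" "\<And>i. i \<ge> n \<Longrightarrow> x i = 0"
    and best: "R.best ((?M + 1) ^ K) = R.E * R.cost x y \<alpha> + (\<Sum>i<n. 2 ^ i * int (x i))"
    and opt: "\<And>x' y' \<alpha>'. R.grid x' y' \<alpha>' \<Longrightarrow> R.cost x y \<alpha> \<le> R.cost x' y' \<alpha>'"
    using R.best_packed by blast
  have x1: "x i \<le> 1" if "i < n" for i using g(1) that unfolding R.grid_def by blast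
  have iff: "grid_solution I ?M x' y' \<alpha>' \<longleftrightarrow> R.grid x' y' \<alpha>' \<and> (\<forall>i\<ge>n. x' i = 0)" for x' y' \<alpha>'
    using grid_solution_iff[OF data' refl] unfolding n_def p_def K_def .
  have ceq: "of_int R.D * grid_cost I ?M x' y' \<alpha>' = of_int (R.cost x' y' \<alpha>')" for x' y' \<alpha>'
    using grid_cost_eq[OF data' refl] unfolding n_def p_def K_def .
  have gs: "grid_solution I ?M x y \<alpha>" using iff g by blast
  note val = grid_solution_value[OF I R.M_pos gs]
  show ?thesis
  proof (rule that[OF ex _ val(1)])
    show "t \<le> step_bound K z M (csize selection_prog)"
    proof -
      have mono_M: "total_steps z K W a \<le> total_steps z K W b" if "a \<le> b" for W a b
        unfolding total_steps_def search_steps_def table_steps_def row_steps_def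
        using that by (intro add_mono mult_mono power_mono le_refl) auto
      have "total_steps n K (p * ?M) ?M \<le> total_steps z K (z * M) ?M"
        using nz MM by (intro total_steps_mono mult_mono) auto
      also have "\<dots> \<le> total_steps z K (z * M) M" using MM by (rule mono_M)
      finally have 1: "total_steps n K (p * ?M) ?M \<le> total_steps z K (z * M) M" .
      have "L \<le> cell_bits K M z" unfolding L_def cell_bits_def using MM by (intro add_mono mult_mono) auto
      then have "unit_cost L c \<le> unit_cost (cell_bits K M z) c" for c
        unfolding unit_cost_def by (intro mult_mono add_mono) auto
      with 1 t show ?thesis unfolding step_bound_def by (meson mult_le_mono le_trans)
    qed
    show "output_is s (enc_solution I x)"
      unfolding output_is_def enc_solution_def
      using out mask_digit[OF x1, where q = "R.cost x y \<alpha>"] unfolding best R.E_def n_def[symmetric] by simp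
  next
    fix x' v assume x': "x' \<in> sel_feasible I" "sel_value I x' \<le> ereal v"
    obtain y' \<alpha>' where g': "grid_solution I ?M x' y' \<alpha>'"
      and c': "grid_cost I ?M x' y' \<alpha>' \<le> (1 + 1 / N) * ?M * v"
      using grid_solution_exists[OF I N MN x'] by blast
    have "R.cost x y \<alpha> \<le> R.cost x' y' \<alpha>'" using opt g' iff by blast
    then have "of_int R.D * grid_cost I ?M x y \<alpha> \<le> of_int R.D * grid_cost I ?M x' y' \<alpha>'"
      unfolding ceq by simp
    then have "grid_cost I ?M x y \<alpha> \<le> grid_cost I ?M x' y' \<alpha>'" using R.D_pos by simp
    with c' have le: "grid_cost I ?M x y \<alpha> \<le> ?M * ((1 + 1 / N) * v)" by (simp add: mult.assoc mult.left_commute)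
    have nonneg: "grid_cost I ?M x y \<alpha> \<ge> 0"
      unfolding grid_cost_def using I unfolding valid_instance_def
      by (intro add_nonneg_nonneg mult_nonneg_nonneg sum_nonneg) auto
    have M0: "real ?M > 0" using R.M_pos by simp
    have "grid_cost I ?M x y \<alpha> / ?M \<le> (1 + 1 / N) * v"
      using le M0 by (simp add: pos_divide_le_eq mult.commute)
    with val(2) have "sel_value I x \<le> ereal ((1 + 1 / N) * v)" by (meson ereal_less_eq(3) order_trans)
    moreover have "0 \<le> v"
    proof -
      have "0 \<le> real ?M * ((1 + 1 / N) * v)" using le nonneg by linarith
      then have "0 \<le> (1 + 1 / real N) * v" using M0 by (simp add: zero_le_mult_iff)
      moreover have "1 + 1 / real N > 0" by (simp add: add_pos_nonneg)
      ultimately show ?thesis by (simp add: zero_le_mult_iff)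
    qed
    ultimately show "0 \<le> v \<and> sel_value I x \<le> ereal ((1 + 1 / N) * v)" by blast
  qed
qed

theorem theorem16:
  fixes K :: nat
  shows "admits_fptas {I. valid_instance I \<and> num_budgets I = K}
           enc_instance sel_feasible enc_solution sel_value"
proof -
  let ?A = "{I. valid_instance I \<and> num_budgets I = K}"
  let ?z = "\<lambda>I. input_size (enc_instance I)"
  let ?c = "csize selection_prog"
  have "poly_bounded ?A (\<lambda>I \<epsilon>. step_bound K (?z I) ((?z I + 1) * (K + 1) * nat \<lceil>1 / \<epsilon>\<rceil>) ?c)"
    by (intro poly_bounded_step_bound poly_bounded_intros poly_bounded_size poly_bounded_inverse)
  then obtain q :: "real poly poly" where q: "\<And>I \<epsilon>. I \<in> ?A \<Longrightarrow> \<epsilon> > 0 \<Longrightarrow>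
      real (step_bound K (?z I) ((?z I + 1) * (K + 1) * nat \<lceil>1 / \<epsilon>\<rceil>) ?c) \<le>
      poly (poly q [:1 / \<epsilon>:]) (real (?z I))"
    unfolding poly_bounded_def by blast
  show ?thesis unfolding admits_fptas_def
  proof (rule exI[of _ selection_prog], rule exI[of _ q], intro ballI allI impI)
    fix I and \<epsilon> :: real assume I: "I \<in> ?A" and \<epsilon>: "\<epsilon> > 0"
    define N where "N = nat \<lceil>1 / \<epsilon>\<rceil>"
    have "\<lceil>1 / \<epsilon>\<rceil> > 0" unfolding zero_less_ceiling using \<epsilon> by simp
    then have N: "N \<ge> 1" "int N = \<lceil>1 / \<epsilon>\<rceil>" unfolding N_def by linarith+
    have "1 / \<epsilon> \<le> real N" unfolding N_def by (rule real_nat_ceiling_ge)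
    then have N\<epsilon>: "1 / real N \<le> \<epsilon>" using \<epsilon> N(1) by (simp add: field_simps)
    obtain t s x where ex: "exec selection_prog (init_state (int N # enc_instance I)) t s"
      and t: "t \<le> step_bound K (?z I) ((?z I + 1) * (K + 1) * N) ?c"
      and x: "x \<in> sel_feasible I" "output_is s (enc_solution I x)"
      and opt: "\<And>x' v. x' \<in> sel_feasible I \<Longrightarrow> sel_value I x' \<le> ereal v \<Longrightarrow>
        0 \<le> v \<and> sel_value I x \<le> ereal ((1 + 1 / N) * v)"
      using selection_prog_correct[of I N] I N(1) by blast
    have time: "real t \<le> poly (poly q [:1 / \<epsilon>:]) (real (?z I))"
      using t q[OF I \<epsilon>] unfolding N_def by (meson of_nat_mono order_trans)
    have le: "sel_value I x \<le> ereal (1 + \<epsilon>) * sel_value I x'" if x': "x' \<in> sel_feasible I" for x'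
    proof (cases "sel_value I x'")
      case (real v)
      from opt[OF x', of v] real have v: "0 \<le> v" "sel_value I x \<le> ereal ((1 + 1 / N) * v)" by auto
      have "(1 + 1 / N) * v \<le> (1 + \<epsilon>) * v" using v(1) N\<epsilon> by (intro mult_right_mono) auto
      with v(2) have "sel_value I x \<le> ereal ((1 + \<epsilon>) * v)" by (meson ereal_less_eq(3) order_trans)
      then show ?thesis using real by simp
    next
      case PInf
      then show ?thesis using \<epsilon> by simp
    next
      \<comment> \<open>Every real number would be a bound on the value, and \<open>- 1\<close>
        contradicts \<open>0 \<le> v\<close>.\<close>
      case MInf
      with opt[OF x', of "- 1"] show ?thesis by simp
    qed
    \<comment> \<open>The positive finite factor is moved to the left-hand side, so that the
      pointwise bounds pass to the infimum by \<open>INF_greatest\<close>.\<close>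
    have c: "ereal (1 + \<epsilon>) > 0" "ereal (1 + \<epsilon>) \<noteq> \<infinity>" using \<epsilon> by simp_all
    have "sel_value I x / ereal (1 + \<epsilon>) \<le> (INF x'\<in>sel_feasible I. sel_value I x')"
      by (rule INF_greatest) (unfold ereal_divide_le_pos[OF c], rule le)
    then have "sel_value I x \<le> ereal (1 + \<epsilon>) * (INF x'\<in>sel_feasible I. sel_value I x')"
      unfolding ereal_divide_le_pos[OF c] .
    then show "\<exists>t s x. exec selection_prog (init_state (\<lceil>1 / \<epsilon>\<rceil> # enc_instance I)) t s \<and>
        real t \<le> poly (poly q [:1 / \<epsilon>:]) (real (?z I)) \<and>
        x \<in> sel_feasible I \<and> output_is s (enc_solution I x) \<and>
        sel_value I x \<le> ereal (1 + \<epsilon>) * (INF z\<in>sel_feasible I. sel_value I z)"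
      using ex time x unfolding N(2) by blast
  qed
qed

end
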